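(* Consider the 1-bit model $y=\eta\odot\mathrm{sign}(\Psi x^*+\epsilon)$ described in the context, let $s=\|x^*\|_0$, let $c=(2q-1)\sqrt{\frac{2}{\pi(\sigma^2+1)}}$, and let $C_3\ge\|x^*\|_1$. There exist generic positive constants $C_1,C_2$ such that the following holds. Assume $$n>m\ge\max\left\{\frac{4C_1}{C_2^2}\log n,\ \frac{64(4\kappa(\Sigma)+1)^2}{C_1}\,s\log\frac{en}{s}\right\},\qquad s\le e^{1-\frac{C_1}{2}}\,n,$$ and set $\lambda=\frac{4(1+C_3|c|)}{\sqrt{C_1}}\sqrt{\frac{\log n}{m}}$. Let $$x_{\ell_1}\in\arg\min_{x\in\mathbb{R}^n}\frac1{2m}\|y-\Psi x\|_2^2+\lambda\|x\|_1.$$ Then with probability at least $1-2/n^3-6/n^2$, $$\|x_{\ell_1}/c-x^*\|_2\le\frac{816(4\kappa(\Sigma)+1)^2}{\gamma_{\min}(\Sigma)}\cdot\frac{\sigma+1+C_3|q-1/2|}{\sqrt{C_1}\,|q-1/2|}\sqrt{\frac{s\log n}{m}}.$$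
   Context: Model: $y=\eta\odot\mathrm{sign}(\Psi x^*+\epsilon)\in\mathbb{R}^m$, where $x^*\in\mathbb{R}^n$ is a fixed unknown vector; $\Psi\in\mathbb{R}^{m\times n}$ has rows $\psi_1^t,\dots,\psi_m^t$ with $\psi_i$ i.i.d. $\mathcal{N}(\mathbf{0},\Sigma)$, $\Sigma\in\mathbb{R}^{n\times n}$ symmetric positive definite; $\epsilon\in\mathbb{R}^m$ is distributed as $\mathcal{N}(\mathbf{0},\sigma^2\mathbf{I}_m)$; $\eta\in\mathbb{R}^m$ has independent coordinates with $\mathbb{P}[\eta_i=1]=1-\mathbb{P}[\eta_i=-1]=q\neq\frac12$; $\eta_i,\epsilon_i,\psi_i$ are mutually independent. The normalization $\|x^*\|_\Sigma:=((x^* )^t\Sigma x^* )^{1/2}=1$ is assumed. $\mathrm{sign}$ acts componentwise, with $\mathrm{sign}(z)=1$ if $z\ge0$ and $-1$ otherwise; $\odot$ is the componentwise product. $\|x\|_0$ is the number of nonzero entries of $x$. $\gamma_{\max}(\Sigma),\gamma_{\min}(\Sigma)$ are the largest and smallest eigenvalues of $\Sigma$, and $\kappa(\Sigma)=\gamma_{\max}(\Sigma)/\gamma_{\min}(\Sigma)$. The generic constants $C_1,C_2$ do not depend on $m$ or $n$; they may depend on the maximum subgaussian norm of the rows of $\Psi$. *)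

theory Defs
  imports "HOL-Probability.Probability" "Jordan_Normal_Form.Spectral_Radius"
begin

(* The constants C1, C2 of the theorem are uniform in the dimensions m and n, so dimensions must be
   values rather than types: vectors and matrices are those of Jordan_Normal_Form. *)

hide_type (open) Finite_Cartesian_Product.vec
hide_const (open) Finite_Cartesian_Product.vec Finite_Cartesian_Product.row
  Finite_Cartesian_Product.mat Finite_Cartesian_Product.transpose
unbundle no inner_syntax and no vec_syntax

definition norm0 :: "real vec \<Rightarrow> nat" where
  "norm0 x = card {i. i < dim_vec x \<and> x $ i \<noteq> 0}"

definition norm1 :: "real vec \<Rightarrow> real" where
  "norm1 x = (\<Sum>i<dim_vec x. \<bar>x $ i\<bar>)"

definition norm2 :: "real vec \<Rightarrow> real" where
  "norm2 x = sqrt (\<Sum>i<dim_vec x. (x $ i)\<^sup>2)"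

definition norm_wrt :: "real mat \<Rightarrow> real vec \<Rightarrow> real" where
  "norm_wrt A x = sqrt (x \<bullet> (A *\<^sub>v x))"

definition sym_pos_def :: "nat \<Rightarrow> real mat \<Rightarrow> bool" where
  "sym_pos_def n A \<longleftrightarrow> A \<in> carrier_mat n n \<and> A\<^sup>T = A \<and>
     (\<forall>v\<in>carrier_vec n. v \<noteq> 0\<^sub>v n \<longrightarrow> v \<bullet> (A *\<^sub>v v) > 0)"

definition gamma_max :: "real mat \<Rightarrow> real" where
  "gamma_max A = Max (spectrum A)"

definition gamma_min :: "real mat \<Rightarrow> real" where
  "gamma_min A = Min (spectrum A)"

definition kappa :: "real mat \<Rightarrow> real" where
  "kappa A = gamma_max A / gamma_min A"

definition bit_sign :: "real \<Rightarrow> real" where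
  "bit_sign z = (if z \<ge> 0 then 1 else -1)"

(* The type of vectors carries no sigma-algebra; a vector of dimension n is identified with a point
   of the product space PiM {..<n}, in which laws and measurability are expressed. *)

abbreviation euclid :: "nat \<Rightarrow> (nat \<Rightarrow> real) measure" where
  "euclid n \<equiv> PiM {..<n} (\<lambda>_. borel)"

definition coords :: "nat \<Rightarrow> real vec \<Rightarrow> nat \<Rightarrow> real" where
  "coords n v = (\<lambda>i\<in>{..<n}. v $ i)"

(* X has law N(0, S): the law of X is that of A z for a standard Gaussian vector z and some A with
   A A^t = S. It does not depend on the choice of A, and S may be singular. *)

definition has_normal_law :: "'w measure \<Rightarrow> nat \<Rightarrow> real mat \<Rightarrow> ('w \<Rightarrow> real vec) \<Rightarrow> bool" where
  "has_normal_law M n S X \<longleftrightarrow>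
     (\<lambda>\<omega>. coords n (X \<omega>)) \<in> measurable M (euclid n) \<and>
     (\<exists>A\<in>carrier_mat n n. A * A\<^sup>T = S \<and>
        distr M (euclid n) (\<lambda>\<omega>. coords n (X \<omega>)) =
        distr (PiM {..<n} (\<lambda>_. density lborel (\<lambda>t. ennreal (std_normal_density t)))) (euclid n)
          (\<lambda>z. coords n (A *\<^sub>v vec n z)))"

(* Subgaussian norms take values in ereal, so that the norm of a variable that is not subgaussian
   is infinite. *)

definition subgaussian_norm :: "'w measure \<Rightarrow> ('w \<Rightarrow> real) \<Rightarrow> ereal" where
  "subgaussian_norm M X =
     (INF t\<in>{t. t > 0 \<and> (\<integral>\<^sup>+\<omega>. ennreal (exp ((X \<omega> / t)\<^sup>2)) \<partial>M) \<le> 2}. ereal t)"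

definition subgaussian_norm_vec :: "'w measure \<Rightarrow> nat \<Rightarrow> ('w \<Rightarrow> real vec) \<Rightarrow> ereal" where
  "subgaussian_norm_vec M n X =
     (SUP v\<in>{v\<in>carrier_vec n. norm2 v = 1}. subgaussian_norm M (\<lambda>\<omega>. v \<bullet> X \<omega>))"

(* The last assumption is the mutual independence of the 3m variables
   psi_0, ..., psi_(m-1), eps_0, ..., eps_(m-1), eta_0, ..., eta_(m-1). Their value spaces differ,
   so it is stated for the sigma-algebras they generate. *)

locale one_bit_model = prob_space M for M :: "'w measure" +
  fixes m n :: nat
    and S :: "real mat" and \<sigma> q :: real and xstar :: "real vec"
    and \<Psi> :: "'w \<Rightarrow> real mat" and \<epsilon> \<eta> :: "'w \<Rightarrow> real vec"
  assumes S: "sym_pos_def n S"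
    and sigma: "\<sigma> \<ge> 0"
    and q: "q \<noteq> 1/2"
    and xstar: "xstar \<in> carrier_vec n" "norm_wrt S xstar = 1"
    and carrier: "\<And>\<omega>. \<omega> \<in> space M \<Longrightarrow> \<Psi> \<omega> \<in> carrier_mat m n"
      "\<And>\<omega>. \<omega> \<in> space M \<Longrightarrow> \<epsilon> \<omega> \<in> carrier_vec m"
      "\<And>\<omega>. \<omega> \<in> space M \<Longrightarrow> \<eta> \<omega> \<in> carrier_vec m"
    and psi_law: "\<And>i. i < m \<Longrightarrow> has_normal_law M n S (\<lambda>\<omega>. row (\<Psi> \<omega>) i)"
    and eps_law: "has_normal_law M m (\<sigma>\<^sup>2 \<cdot>\<^sub>m 1\<^sub>m m) \<epsilon>"
    and eta_meas: "\<And>i. i < m \<Longrightarrow> (\<lambda>\<omega>. \<eta> \<omega> $ i) \<in> borel_measurable M"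
    and eta_law: "\<And>i. i < m \<Longrightarrow> prob {\<omega>\<in>space M. \<eta> \<omega> $ i = 1} = q"
      "\<And>i. i < m \<Longrightarrow> 1 - prob {\<omega>\<in>space M. \<eta> \<omega> $ i = -1} = q"
    and indep: "indep_sets
      (\<lambda>k. case k of
          Inl i \<Rightarrow> sets (vimage_algebra (space M) (\<lambda>\<omega>. coords n (row (\<Psi> \<omega>) i)) (euclid n))
        | Inr (Inl i) \<Rightarrow> sets (vimage_algebra (space M) (\<lambda>\<omega>. \<epsilon> \<omega> $ i) borel)
        | Inr (Inr i) \<Rightarrow> sets (vimage_algebra (space M) (\<lambda>\<omega>. \<eta> \<omega> $ i) borel))
      ({..<m} <+> ({..<m} <+> {..<m}))"

definition response :: "real mat \<Rightarrow> real vec \<Rightarrow> real vec \<Rightarrow> real vec \<Rightarrow> real vec" where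
  "response P e h x = vec (dim_row P) (\<lambda>i. h $ i * bit_sign ((P *\<^sub>v x + e) $ i))"

definition lasso_objective :: "real mat \<Rightarrow> real vec \<Rightarrow> real \<Rightarrow> real vec \<Rightarrow> real" where
  "lasso_objective P y l x =
     1 / (2 * real (dim_row P)) * (norm2 (y - P *\<^sub>v x))\<^sup>2 + l * norm1 x"

end

(* Write x for the minimiser, d = x - c x* and r = y - c Psi x*. The Gaussian identity
   E[(u . psi) sign(psi . x* + eps)] = sqrt(2 / (pi (sigma^2 + 1))) u^t Sigma x* says that the columns of Psi
   are uncorrelated with r, so a Bernstein inequality bounds every coordinate of Psi^t r / m by lambda / 2.
   Optimality of x then puts d into the cone |d|_1 <= 4 sqrt s |d|_2 and bounds |Psi d|^2 / m by
   lambda times 3 sqrt s |d|_2. On the cone |Psi d|^2 / m is at least gamma_min / 2 |d|^2: the deviation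
   of Psi^t Psi / m from Sigma is at most gamma_min / 50 on 2s-sparse vectors (a union bound over the
   integer points of squared length at most 32 s, rescaled, of which there are exp(O(s log(e n / s)))),
   and it extends to the cone by cutting d into blocks of s entries of decreasing size.
   The subgaussian norm K of the rows dominates the standard deviations of the entries of Psi; this is the
   only way in which C1 depends on K. *)
theory Submission
  imports Defs
begin

section \<open>Quadratic forms and the deterministic Lasso bound\<close>

text \<open>A minimiser need not be unique or depend measurably on \<omega>. The good event
  therefore speaks only of finitely many score coordinates and of the energies of finitely many net
  points; on it the bound holds for every minimiser. The two Bernstein estimates have different
  scales. A score term scales with the standard deviation of one entry of Psi, since |r| is almost
  surely at most 1 + |psi . x*| and psi . x* has variance 1. The energy of a net point scales with
  gamma_max, while the admissible deviation is gamma_min / 100, so m must be of order kappa^2 s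
  log(e n / s); the factor (4 kappa + 1)^2 in the condition on m provides this. It also fixes the
  number 200000 in C1: 64 * 16 * 200000 has to exceed 36 * 512 * 100^2, where 36 is 34 for the
  number of integer points plus 2 for the factor n^(-2) in the failure probability. Rounding towards
  zero preserves supports, so a single integer ball in n dimensions serves all 2s-sparse vectors at
  once and no union over supports is taken.\<close>

lemma top_subset_exists:
  fixes f :: "'a \<Rightarrow> real"
  assumes "finite J" "s \<le> card J"
  shows "\<exists>T\<subseteq>J. card T = s \<and> (\<forall>i\<in>T. \<forall>j\<in>J - T. f j \<le> f i)"
  using assms(2)
proof (induction s)
  case 0
  then show ?case by (intro exI[of _ "{}"]) auto
next
  case (Suc s)
  then obtain T where T: "T \<subseteq> J" "card T = s" "\<forall>i\<in>T. \<forall>j\<in>J - T. f j \<le> f i" by auto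
  have fT: "finite T" using T assms(1) finite_subset by blast
  have "J - T \<noteq> {}"
  proof
    assume "J - T = {}"
    then have "card J \<le> card T" using T fT by (intro card_mono) auto
    then show False using T Suc.prems by simp
  qed
  then have "Max (f ` (J - T)) \<in> f ` (J - T)" using assms(1) by (intro Max_in) auto
  then obtain a where "a \<in> J - T" "f a = Max (f ` (J - T))" by auto
  then have a: "a \<in> J - T" "\<forall>j\<in>J - T. f j \<le> f a" using assms(1) by auto
  show ?case
    using a T fT by (intro exI[of _ "insert a T"]) auto
qed

text \<open>The truncated vector stays a total function, zero off T. Vectors with different supports
  can then be added pointwise, and being supported on T is a plain equation.\<close>

definition restrict_to :: "'a set \<Rightarrow> ('a \<Rightarrow> real) \<Rightarrow> 'a \<Rightarrow> real" where
  "restrict_to T v = (\<lambda>j. if j \<in> T then v j else 0)"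

lemma L2_set_restrict_to: "finite I \<Longrightarrow> T \<subseteq> I \<Longrightarrow> L2_set (restrict_to T v) I = L2_set v T"
  unfolding L2_set_def restrict_to_def
  by (intro arg_cong[where f=sqrt] sum.mono_neutral_cong_right) auto

lemma restrict_to_zero: "j \<notin> T \<Longrightarrow> restrict_to T v j = 0"
  by (simp add: restrict_to_def)

lemma restrict_to_abs_le: "(\<And>j. j \<in> T \<Longrightarrow> \<bar>v j\<bar> \<le> b) \<Longrightarrow> 0 \<le> b \<Longrightarrow> \<bar>restrict_to T v j\<bar> \<le> b"
  by (simp add: restrict_to_def)

lemma restrict_to_add_Diff:
  assumes "\<And>j. j \<notin> J \<Longrightarrow> v j = 0"
  shows "v = (\<lambda>j. restrict_to T v j + restrict_to (J - T) v j)"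
  using assms unfolding restrict_to_def by auto

lemma L2_set_le_of_abs_le:
  assumes "finite T" "card T \<le> s" "\<And>j. j \<in> T \<Longrightarrow> \<bar>v j\<bar> \<le> b" "0 \<le> b"
  shows "L2_set v T \<le> sqrt (real s) * b"
proof -
  have "(\<Sum>j\<in>T. (v j)\<^sup>2) \<le> (\<Sum>j\<in>T. b\<^sup>2)"
    using assms(3,4) by (intro sum_mono) (auto simp: abs_le_square_iff[symmetric])
  also have "\<dots> \<le> real s * b\<^sup>2" using assms(2) by (simp add: mult_right_mono)
  finally have "L2_set v T \<le> sqrt (real s * b\<^sup>2)" unfolding L2_set_def by simp
  then show ?thesis using assms(4) by (simp add: real_sqrt_mult)
qed

section \<open>Shelling: from sparse vectors to a bound by the l2 and l1 norms\<close>

context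
  fixes F :: "('a \<Rightarrow> real) \<Rightarrow> real" and I :: "'a set" and s :: nat and a :: real
  assumes fin: "finite I" and s: "0 < s" and a: "0 \<le> a"
    and subadd: "\<And>u w. F (\<lambda>j. u j + w j) \<le> F u + F w"
    and sparse: "\<And>T u. T \<subseteq> I \<Longrightarrow> card T \<le> s \<Longrightarrow> (\<And>j. j \<notin> T \<Longrightarrow> u j = 0) \<Longrightarrow> F u \<le> a * L2_set u I"
begin

lemma restrict_to_sparse_le:
  assumes "T \<subseteq> I" "card T \<le> s"
  shows "F (restrict_to T v) \<le> a * L2_set v T"
  using sparse[of T "restrict_to T v"] assms L2_set_restrict_to[OF fin assms(1)]
  by (auto simp: restrict_to_def)

(* Shelling: after the s largest entries are removed, each remaining one is at most their average, so
   the l2 norm of every further block of s entries is paid for by the l1 norm of the previous one. *)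
lemma subadditive_le_peel:
  assumes J: "J \<subseteq> I" "\<And>j. j \<notin> J \<Longrightarrow> v j = 0" and b: "\<And>j. \<bar>v j\<bar> \<le> b"
  shows "F v \<le> a * (sqrt (real s) * b + (\<Sum>j\<in>J. \<bar>v j\<bar>) / sqrt (real s))"
  using assms
proof (induction "card J" arbitrary: J v b rule: less_induct)
  case less
  have fJ: "finite J" using less.prems(1) fin finite_subset by blast
  have b0: "0 \<le> b" using order_trans[OF abs_ge_zero less.prems(3)] .
  show ?case
  proof (cases "card J \<le> s")
    case True
    have "F v \<le> a * L2_set v J"
    proof -
      have "restrict_to J v = v" using less.prems(2) by (auto simp: restrict_to_def)
      then show ?thesis using restrict_to_sparse_le[OF less.prems(1) True, of v] by simp
    qed
    also have "\<dots> \<le> a * (sqrt (real s) * b)"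
      by (intro mult_left_mono a L2_set_le_of_abs_le[OF fJ True less.prems(3) b0])
    also have "\<dots> \<le> a * (sqrt (real s) * b + (\<Sum>j\<in>J. \<bar>v j\<bar>) / sqrt (real s))"
      by (intro mult_left_mono a) (simp add: sum_nonneg)
    finally show ?thesis .
  next
    case False
    then obtain T where T: "T \<subseteq> J" "card T = s" "\<And>i j. i \<in> T \<Longrightarrow> j \<in> J - T \<Longrightarrow> \<bar>v j\<bar> \<le> \<bar>v i\<bar>"
      using top_subset_exists[OF fJ, of s "\<lambda>j. \<bar>v j\<bar>"] by auto
    define b' where "b' = (\<Sum>j\<in>T. \<bar>v j\<bar>) / real s"
    have b': "\<bar>v j\<bar> \<le> b'" if "j \<in> J - T" for j
    proof -
      have "(\<Sum>i\<in>T. \<bar>v j\<bar>) \<le> (\<Sum>i\<in>T. \<bar>v i\<bar>)" using T(3) that by (intro sum_mono) auto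
      then show ?thesis using s T(2) unfolding b'_def by (simp add: field_simps)
    qed
    have b'0: "0 \<le> b'" unfolding b'_def by (simp add: sum_nonneg)
    have "J - T \<subset> J" using T(1,2) s by (cases "T = {}") auto
    then have "card (J - T) < card J" by (rule psubset_card_mono[OF fJ])
    then have IH: "F (restrict_to (J - T) v)
      \<le> a * (sqrt (real s) * b' + (\<Sum>j\<in>J - T. \<bar>restrict_to (J - T) v j\<bar>) / sqrt (real s))"
    proof (rule less.hyps)
      show "J - T \<subseteq> I" using less.prems(1) by blast
      show "restrict_to (J - T) v j = 0" if "j \<notin> J - T" for j using that by (rule restrict_to_zero)
      show "\<bar>restrict_to (J - T) v j\<bar> \<le> b'" for j using b' b'0 by (rule restrict_to_abs_le)
    qed
    have "sqrt (real s) * b' = (\<Sum>j\<in>T. \<bar>v j\<bar>) / sqrt (real s)"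
      unfolding b'_def using s by (simp add: field_simps)
    moreover have "(\<Sum>j\<in>J - T. \<bar>restrict_to (J - T) v j\<bar>) = (\<Sum>j\<in>J - T. \<bar>v j\<bar>)"
      by (intro sum.cong) (auto simp: restrict_to_def)
    moreover have "(\<Sum>j\<in>J. \<bar>v j\<bar>) = (\<Sum>j\<in>J - T. \<bar>v j\<bar>) + (\<Sum>j\<in>T. \<bar>v j\<bar>)"
      using sum.subset_diff[OF T(1) fJ] .
    ultimately have rest: "F (restrict_to (J - T) v) \<le> a * ((\<Sum>j\<in>J. \<bar>v j\<bar>) / sqrt (real s))"
      using IH by (simp add: add_divide_distrib add.commute)
    have "F (restrict_to T v) \<le> a * L2_set v T"
      using T less.prems(1) by (intro restrict_to_sparse_le) auto
    also have "\<dots> \<le> a * (sqrt (real s) * b)"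
      using T fJ finite_subset by (intro mult_left_mono a L2_set_le_of_abs_le less.prems(3) b0) auto
    finally have "F (restrict_to T v) + F (restrict_to (J - T) v)
      \<le> a * (sqrt (real s) * b + (\<Sum>j\<in>J. \<bar>v j\<bar>) / sqrt (real s))"
      using rest by (simp add: distrib_left)
    moreover have "F v = F (\<lambda>j. restrict_to T v j + restrict_to (J - T) v j)"
      by (rule arg_cong[OF restrict_to_add_Diff[OF less.prems(2)]])
    ultimately show ?thesis
      using subadd[of "restrict_to T v" "restrict_to (J - T) v"] by linarith
  qed
qed

text \<open>The block of the s largest entries is measured by the l2 norm itself; the rest is
  peeled, its entries being bounded by the average over that block. \<open>F\<close> is an abstract
  subadditive functional because it is instantiated twice, with either argument of a bilinear form
  held fixed.\<close>

lemma subadditive_le_l2_l1: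
  assumes v: "\<And>j. j \<notin> I \<Longrightarrow> v j = 0"
  shows "F v \<le> a * (L2_set v I + (\<Sum>j\<in>I. \<bar>v j\<bar>) / sqrt (real s))"
proof (cases "card I \<le> s")
  case True
  have "F v \<le> a * L2_set v I" using sparse[OF subset_refl True v] .
  also have "\<dots> \<le> a * (L2_set v I + (\<Sum>j\<in>I. \<bar>v j\<bar>) / sqrt (real s))"
    by (intro mult_left_mono a) (simp add: sum_nonneg)
  finally show ?thesis .
next
  case False
  then obtain T where T: "T \<subseteq> I" "card T = s" "\<And>i j. i \<in> T \<Longrightarrow> j \<in> I - T \<Longrightarrow> \<bar>v j\<bar> \<le> \<bar>v i\<bar>"
    using top_subset_exists[OF fin, of s "\<lambda>j. \<bar>v j\<bar>"] by auto
  define b' where "b' = (\<Sum>j\<in>T. \<bar>v j\<bar>) / real s"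
  have b': "\<bar>v j\<bar> \<le> b'" if "j \<in> I - T" for j
  proof -
    have "(\<Sum>i\<in>T. \<bar>v j\<bar>) \<le> (\<Sum>i\<in>T. \<bar>v i\<bar>)" using T(3) that by (intro sum_mono) auto
    then show ?thesis using s T(2) unfolding b'_def by (simp add: field_simps)
  qed
  have b'0: "0 \<le> b'" unfolding b'_def by (simp add: sum_nonneg)
  have "F (restrict_to (I - T) v)
    \<le> a * (sqrt (real s) * b' + (\<Sum>j\<in>I - T. \<bar>restrict_to (I - T) v j\<bar>) / sqrt (real s))"
    using b' b'0 by (intro subadditive_le_peel) (auto simp: restrict_to_def)
  moreover have "sqrt (real s) * b' = (\<Sum>j\<in>T. \<bar>v j\<bar>) / sqrt (real s)"
    unfolding b'_def using s by (simp add: field_simps)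
  moreover have "(\<Sum>j\<in>I - T. \<bar>restrict_to (I - T) v j\<bar>) = (\<Sum>j\<in>I - T. \<bar>v j\<bar>)"
    by (intro sum.cong) (auto simp: restrict_to_def)
  moreover have "(\<Sum>j\<in>I. \<bar>v j\<bar>) = (\<Sum>j\<in>I - T. \<bar>v j\<bar>) + (\<Sum>j\<in>T. \<bar>v j\<bar>)"
    using sum.subset_diff[OF T(1) fin] .
  ultimately have rest: "F (restrict_to (I - T) v) \<le> a * ((\<Sum>j\<in>I. \<bar>v j\<bar>) / sqrt (real s))"
    by (simp add: add_divide_distrib add.commute)
  have "F (restrict_to T v) \<le> a * L2_set v T"
    using restrict_to_sparse_le T by simp
  also have "\<dots> \<le> a * L2_set v I"
    unfolding L2_set_def using T(1) fin by (intro mult_left_mono a) (simp add: sum_mono2)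
  finally have "F (restrict_to T v) + F (restrict_to (I - T) v)
    \<le> a * (L2_set v I + (\<Sum>j\<in>I. \<bar>v j\<bar>) / sqrt (real s))"
    using rest by (simp add: distrib_left)
  moreover have "F v = F (\<lambda>j. restrict_to T v j + restrict_to (I - T) v j)"
    by (rule arg_cong[OF restrict_to_add_Diff[OF v]])
  ultimately show ?thesis
    using subadd[of "restrict_to T v" "restrict_to (I - T) v"] by linarith
qed

end

text \<open>The kernel is a function rather than a matrix, so that the same algebra serves Sigma,
  its negative, and the random deviation Psi^t Psi / m - Sigma.\<close>

definition bform :: "'a set \<Rightarrow> ('a \<Rightarrow> 'a \<Rightarrow> real) \<Rightarrow> ('a \<Rightarrow> real) \<Rightarrow> ('a \<Rightarrow> real) \<Rightarrow> real" where
  "bform I D u w = (\<Sum>j\<in>I. \<Sum>k\<in>I. D j k * u j * w k)"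

lemma bform_add_left: "bform I D (\<lambda>j. u j + v j) w = bform I D u w + bform I D v w"
  by (simp add: bform_def algebra_simps sum.distrib)

lemma bform_add_right: "bform I D w (\<lambda>j. u j + v j) = bform I D w u + bform I D w v"
  by (simp add: bform_def algebra_simps sum.distrib)

lemma bform_diff_left: "bform I D (\<lambda>j. u j - v j) w = bform I D u w - bform I D v w"
  by (simp add: bform_def algebra_simps sum_subtractf)

lemma bform_diff_right: "bform I D w (\<lambda>j. u j - v j) = bform I D w u - bform I D w v"
  by (simp add: bform_def algebra_simps sum_subtractf)

lemma bform_scale_left: "bform I D (\<lambda>j. r * u j) w = r * bform I D u w"
  by (simp add: bform_def sum_distrib_left algebra_simps)

lemma bform_scale_right: "bform I D w (\<lambda>j. r * u j) = r * bform I D w u"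
  by (simp add: bform_def sum_distrib_left algebra_simps)

lemma bform_commute:
  assumes "\<And>j k. j \<in> I \<Longrightarrow> k \<in> I \<Longrightarrow> D j k = D k j"
  shows "bform I D u w = bform I D w u"
  unfolding bform_def by (subst sum.swap) (intro sum.cong refl, simp add: assms mult_ac)

lemmas bform_simps = bform_add_left bform_add_right bform_diff_left bform_diff_right
  bform_scale_left bform_scale_right

lemma L2_set_sq: "(L2_set u I)\<^sup>2 = (\<Sum>j\<in>I. (u j)\<^sup>2)"
  by (simp add: L2_set_def sum_nonneg)

lemma L2_set_scale: "L2_set (\<lambda>j. r * u j) I = \<bar>r\<bar> * L2_set u I"
  by (simp add: L2_set_def power_mult_distrib real_sqrt_mult flip: sum_distrib_left)

lemma L2_set_parallelogram:
  "(L2_set (\<lambda>j. u j + w j) I)\<^sup>2 + (L2_set (\<lambda>j. u j - w j) I)\<^sup>2 = 2 * ((L2_set u I)\<^sup>2 + (L2_set w I)\<^sup>2)"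
proof -
  have eq: "(u j + w j)\<^sup>2 + (u j - w j)\<^sup>2 = 2 * ((u j)\<^sup>2 + (w j)\<^sup>2)" for j
    by (simp add: power2_eq_square algebra_simps)
  show ?thesis
    unfolding L2_set_sq by (simp only: sum.distrib[symmetric] eq sum_distrib_left[symmetric])
qed

text \<open>Polarization and the parallelogram law give the bound A / 2 * (|u|^2 + |w|^2). Rescaling
  u and w to unit length turns the sum of squares into the product of the norms. The quadratic bound
  is assumed on a common support T because u + w and u - w have to satisfy it as well.\<close>

lemma bform_le_of_quadratic:
  fixes u w :: "'a \<Rightarrow> real"
  assumes fin: "finite I" and sym: "\<And>j k. j \<in> I \<Longrightarrow> k \<in> I \<Longrightarrow> D j k = D k j"
    and q: "\<And>v. (\<And>j. j \<notin> T \<Longrightarrow> v j = 0) \<Longrightarrow> \<bar>bform I D v v\<bar> \<le> A * (L2_set v I)\<^sup>2"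
    and u: "\<And>j. j \<notin> T \<Longrightarrow> u j = 0" and w: "\<And>j. j \<notin> T \<Longrightarrow> w j = 0"
  shows "\<bar>bform I D u w\<bar> \<le> A * L2_set u I * L2_set w I"
proof -
  have comm: "bform I D u w = bform I D w u" for u w by (rule bform_commute) (rule sym)
  have half: "\<bar>bform I D u w\<bar> \<le> A / 2 * ((L2_set u I)\<^sup>2 + (L2_set w I)\<^sup>2)"
    if u: "\<And>j. j \<notin> T \<Longrightarrow> u j = 0" and w: "\<And>j. j \<notin> T \<Longrightarrow> w j = 0" for u w
  proof -
    have "4 * bform I D u w = bform I D (\<lambda>j. u j + w j) (\<lambda>j. u j + w j)
        - bform I D (\<lambda>j. u j - w j) (\<lambda>j. u j - w j)"
      using comm[of w u] by (simp add: bform_simps)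
    moreover have "\<bar>bform I D (\<lambda>j. u j + w j) (\<lambda>j. u j + w j)\<bar> \<le> A * (L2_set (\<lambda>j. u j + w j) I)\<^sup>2"
      using u w by (intro q) auto
    moreover have "\<bar>bform I D (\<lambda>j. u j - w j) (\<lambda>j. u j - w j)\<bar> \<le> A * (L2_set (\<lambda>j. u j - w j) I)\<^sup>2"
      using u w by (intro q) auto
    ultimately have "4 * \<bar>bform I D u w\<bar>
      \<le> A * ((L2_set (\<lambda>j. u j + w j) I)\<^sup>2 + (L2_set (\<lambda>j. u j - w j) I)\<^sup>2)"
      by (simp add: distrib_left)
    then show ?thesis by (simp only: L2_set_parallelogram)
  qed
  show ?thesis
  proof (cases "L2_set u I = 0 \<or> L2_set w I = 0")
    case True
    then have "(\<forall>j\<in>I. u j = 0) \<or> (\<forall>j\<in>I. w j = 0)" using L2_set_eq_0_iff[OF fin] by blast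
    then have "bform I D u w = 0" by (auto simp: bform_def)
    then show ?thesis using True by auto
  next
    case False
    define p where "p = L2_set u I" define r where "r = L2_set w I"
    have pr: "p > 0" "r > 0" using False unfolding p_def r_def by (auto simp: less_le L2_set_nonneg)
    have "\<bar>bform I D (\<lambda>j. (1/p) * u j) (\<lambda>j. (1/r) * w j)\<bar>
      \<le> A / 2 * ((L2_set (\<lambda>j. (1/p) * u j) I)\<^sup>2 + (L2_set (\<lambda>j. (1/r) * w j) I)\<^sup>2)"
      using u w by (intro half) auto
    also have "\<dots> = A" unfolding L2_set_scale using pr by (simp add: p_def[symmetric] r_def[symmetric])
    finally show ?thesis using pr unfolding bform_simps p_def[symmetric] r_def[symmetric]
      by (simp add: abs_mult field_simps)
  qed
qed

(* If A is the supremum of the form over the unit vectors supported on T, rounding sqrt (32 s) v towards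
   zero changes v by at most 1/4 without leaving T, whence A <= tau / 2 + A / 2. *)
lemma quadratic_le_of_net:
  fixes T I :: "'a set" and s :: nat
  assumes fin: "finite I" and T: "T \<subseteq> I" "card T \<le> 2 * s" and s: "0 < s"
    and sym: "\<And>j k. j \<in> I \<Longrightarrow> k \<in> I \<Longrightarrow> D j k = D k j"
    and net: "\<And>z :: 'a \<Rightarrow> int. (\<And>j. j \<notin> T \<Longrightarrow> z j = 0) \<Longrightarrow> (\<Sum>j\<in>I. (z j)\<^sup>2) \<le> int (32 * s) \<Longrightarrow>
      \<bar>bform I D (\<lambda>j. real_of_int (z j) / sqrt (real (32 * s))) (\<lambda>j. real_of_int (z j) / sqrt (real (32 * s)))\<bar> \<le> \<tau> / 2"
    and v: "\<And>j. j \<notin> T \<Longrightarrow> v j = 0"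
  shows "\<bar>bform I D v v\<bar> \<le> \<tau> * (L2_set v I)\<^sup>2"
proof -
  have comm: "bform I D u w = bform I D w u" for u w by (rule bform_commute) (rule sym)
  define k where "k = real (32 * s)"
  have k: "k > 0" using s unfolding k_def by simp
  define V where "V = {v :: 'a \<Rightarrow> real. (\<forall>j. j \<notin> T \<longrightarrow> v j = 0) \<and> L2_set v I \<le> 1}"
  define A where "A = (SUP v\<in>V. \<bar>bform I D v v\<bar>)"
  \<comment> \<open>Needed for the supremum \<open>A\<close> to be meaningful: the coordinates of a
    vector in \<open>V\<close> are at most 1 in modulus, so the form is bounded by the sum of all |D
    j k|.\<close>
  have bdd: "bdd_above ((\<lambda>v. \<bar>bform I D v v\<bar>) ` V)"
  proof (intro bdd_aboveI2)
    fix v assume "v \<in> V"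
    have "\<bar>v j\<bar> \<le> 1" if "j \<in> I" for j
    proof -
      have "\<bar>v j\<bar> \<le> L2_set (\<lambda>j. \<bar>v j\<bar>) I" using member_le_L2_set[OF fin that, of "\<lambda>j. \<bar>v j\<bar>"] by simp
      also have "\<dots> = L2_set v I" by (simp add: L2_set_def)
      finally show ?thesis using \<open>v \<in> V\<close> by (simp add: V_def)
    qed
    then have "\<bar>D j k * v j * v k\<bar> \<le> \<bar>D j k\<bar>" if "j \<in> I" "k \<in> I" for j k
    proof -
      have "\<bar>v j\<bar> * \<bar>v k\<bar> \<le> 1 * 1" using that \<open>\<And>j. j \<in> I \<Longrightarrow> \<bar>v j\<bar> \<le> 1\<close> by (intro mult_mono) auto
      then have "\<bar>D j k\<bar> * (\<bar>v j\<bar> * \<bar>v k\<bar>) \<le> \<bar>D j k\<bar> * 1" by (intro mult_left_mono) auto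
      then show ?thesis by (simp add: abs_mult mult_ac)
    qed
    then show "\<bar>bform I D v v\<bar> \<le> (\<Sum>j\<in>I. \<Sum>k\<in>I. \<bar>D j k\<bar>)"
      unfolding bform_def by (intro order_trans[OF sum_abs] sum_mono) auto
  qed
  have le_A: "\<bar>bform I D v v\<bar> \<le> A" if "v \<in> V" for v
    unfolding A_def using bdd that by (intro cSUP_upper) auto
  have zero: "(\<lambda>j. 0) \<in> V" by (simp add: V_def L2_set_def)
  have A0: "0 \<le> A" using le_A[OF zero] by linarith
  have quad_A: "\<bar>bform I D v v\<bar> \<le> A * (L2_set v I)\<^sup>2" if v: "\<And>j. j \<notin> T \<Longrightarrow> v j = 0" for v
  proof (cases "L2_set v I = 0")
    case True
    then have "\<forall>j\<in>I. v j = 0" using L2_set_eq_0_iff[OF fin] by blast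
    then show ?thesis using True by (simp add: bform_def)
  next
    case False
    define p where "p = L2_set v I"
    have p: "p > 0" using False unfolding p_def by (auto simp: less_le L2_set_nonneg)
    have "(\<lambda>j. (1/p) * v j) \<in> V"
      unfolding V_def mem_Collect_eq L2_set_scale p_def[symmetric] using v p by auto
    from le_A[OF this] show ?thesis using p unfolding bform_simps p_def[symmetric]
      by (simp add: abs_mult field_simps power2_eq_square)
  qed
  have "\<bar>bform I D v v\<bar> \<le> \<tau> / 2 + A / 2" if "v \<in> V" for v
  proof -
    \<comment> \<open>Rounding towards zero, unlike the floor, gives |x j| \<le> |v j|: zeros remain
      zeros, x stays in the unit ball, and the squared length of z is at most k.\<close>
    define z where "z j = (if v j \<ge> 0 then \<lfloor>sqrt k * v j\<rfloor> else - \<lfloor>- (sqrt k * v j)\<rfloor>)" for j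
    define x where "x j = real_of_int (z j) / sqrt k" for j
    define e where "e j = v j - x j" for j
    have supp: "v j = 0" "z j = 0" "x j = 0" "e j = 0" if "j \<notin> T" for j
      using \<open>v \<in> V\<close> that by (auto simp: V_def z_def x_def e_def)
    have z_le: "\<bar>real_of_int (z j)\<bar> \<le> sqrt k * \<bar>v j\<bar>" for j
    proof (cases "v j \<ge> 0")
      case True
      then have "0 \<le> \<lfloor>sqrt k * v j\<rfloor>" using k by simp
      then show ?thesis using True of_int_floor_le[of "sqrt k * v j"] by (simp add: z_def)
    next
      case False
      then have "0 \<le> - (sqrt k * v j)" using k by (simp add: mult_nonneg_nonpos)
      then have "0 \<le> \<lfloor>- (sqrt k * v j)\<rfloor>" by simp
      then show ?thesis using False of_int_floor_le[of "- (sqrt k * v j)"] by (simp add: z_def)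
    qed
    have x_le: "\<bar>x j\<bar> \<le> \<bar>v j\<bar>" for j
      using z_le[of j] k by (simp add: x_def field_simps)
    have "\<bar>sqrt k * v j - real_of_int (z j)\<bar> \<le> 1" for j
      unfolding z_def by (auto; linarith)
    then have e_le: "\<bar>e j\<bar> \<le> 1 / sqrt k" for j
    proof -
      have "sqrt k * e j = sqrt k * v j - real_of_int (z j)"
        using k by (simp add: e_def x_def field_simps)
      then have "sqrt k * \<bar>e j\<bar> \<le> 1"
        using \<open>\<bar>sqrt k * v j - real_of_int (z j)\<bar> \<le> 1\<close> k
        by (metis abs_mult abs_of_pos real_sqrt_gt_0_iff)
      then show ?thesis using k by (simp add: field_simps)
    qed
    \<comment> \<open>Origin of the 32: the error lives on at most 2s coordinates and is at most 1 /
      sqrt (32 s) on each, so its norm is at most sqrt (2s / (32 s)) = 1/4.\<close>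
    have "L2_set e I = L2_set e T"
      unfolding L2_set_def using supp T fin
      by (intro arg_cong[where f=sqrt] sum.mono_neutral_right) auto
    also have "\<dots> \<le> sqrt (real (2 * s)) * (1 / sqrt k)"
      using T fin finite_subset k by (intro L2_set_le_of_abs_le e_le) auto
    also have "\<dots> = sqrt (1/16)"
      unfolding k_def using s by (simp add: field_simps flip: real_sqrt_divide real_sqrt_mult)
    also have "\<dots> = sqrt ((1/4)\<^sup>2)" by (simp add: power2_eq_square)
    also have "\<dots> = 1/4" by (simp only: real_sqrt_abs)
    finally have e: "L2_set e I \<le> 1/4" .
    have xv: "L2_set x I \<le> L2_set v I"
    proof -
      have "(x j)\<^sup>2 \<le> (v j)\<^sup>2" for j using x_le by (simp add: abs_le_square_iff)
      then show ?thesis unfolding L2_set_def by (simp add: sum_mono)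
    qed
    have v1: "L2_set v I \<le> 1" using \<open>v \<in> V\<close> by (simp add: V_def)
    have "L2_set (\<lambda>j. v j + x j) I \<le> 2"
      using L2_set_triangle_ineq[of v x I] xv v1 by linarith
    \<comment> \<open>By symmetry the values at v and at x differ by the form at the pair v - x, v +
      x, whose norms are at most 1/4 and 2. Polarization with the constant \<open>A\<close> bounds
      this by A / 2, which is small enough to be absorbed.\<close>
    then have "\<bar>bform I D e (\<lambda>j. v j + x j)\<bar> \<le> A * (1/4) * 2"
    proof -
      have "\<bar>bform I D e (\<lambda>j. v j + x j)\<bar> \<le> A * L2_set e I * L2_set (\<lambda>j. v j + x j) I"
        by (rule bform_le_of_quadratic[where T=T]) (use fin sym quad_A supp in auto)
      also have "\<dots> \<le> A * (1/4) * 2"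
        using \<open>L2_set (\<lambda>j. v j + x j) I \<le> 2\<close> e A0 by (intro mult_mono) (auto simp: L2_set_nonneg)
      finally show ?thesis .
    qed
    moreover have "bform I D e (\<lambda>j. v j + x j) = bform I D v v - bform I D x x"
    proof -
      have "e = (\<lambda>j. v j - x j)" by (auto simp: e_def)
      then show ?thesis using comm[of v x] by (simp add: bform_simps)
    qed
    moreover have "\<bar>bform I D x x\<bar> \<le> \<tau> / 2"
    proof -
      have "(\<Sum>j\<in>I. (real_of_int (z j))\<^sup>2) \<le> (\<Sum>j\<in>I. k * (v j)\<^sup>2)"
      proof (intro sum_mono)
        fix j have "\<bar>real_of_int (z j)\<bar> \<le> \<bar>sqrt k * v j\<bar>" using z_le[of j] k by (simp add: abs_mult)
        then have "(real_of_int (z j))\<^sup>2 \<le> (sqrt k * v j)\<^sup>2" by (simp only: abs_le_square_iff)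
        then show "(real_of_int (z j))\<^sup>2 \<le> k * (v j)\<^sup>2" using k by (simp add: power_mult_distrib)
      qed
      also have "\<dots> = k * (L2_set v I)\<^sup>2" by (simp add: L2_set_sq sum_distrib_left)
      also have "\<dots> \<le> k" using v1 k by (simp add: L2_set_nonneg power_le_one)
      finally have "real_of_int (\<Sum>j\<in>I. (z j)\<^sup>2) \<le> real_of_int (int (32 * s))" by (simp add: k_def)
      then have "(\<Sum>j\<in>I. (z j)\<^sup>2) \<le> int (32 * s)" by linarith
      from net[OF supp(2) this] show ?thesis unfolding x_def k_def by simp
    qed
    ultimately show ?thesis by linarith
  qed
  then have "(SUP v\<in>V. \<bar>bform I D v v\<bar>) \<le> \<tau> / 2 + A / 2"
    using zero by (intro cSUP_least) auto
  then have "A \<le> \<tau> / 2 + A / 2" by (simp only: A_def[symmetric])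
  then have "A \<le> \<tau>" by simp
  then show ?thesis using quad_A[OF v] by (meson mult_right_mono order_trans zero_le_power2)
qed

text \<open>Shelling is applied once per argument. For a fixed s-sparse u it acts on the second
  argument and gives a bound proportional to |u|; this is exactly the sparse hypothesis for shelling
  in the first argument. Two s-sparse supports together have at most 2s elements, hence the 2s in
  the assumption.\<close>

lemma quadratic_le_l2_l1:
  assumes fin: "finite I" and s: "0 < s" and \<tau>: "0 \<le> \<tau>"
    and sym: "\<And>j k. j \<in> I \<Longrightarrow> k \<in> I \<Longrightarrow> D j k = D k j"
    and q: "\<And>T v. T \<subseteq> I \<Longrightarrow> card T \<le> 2 * s \<Longrightarrow> (\<And>j. j \<notin> T \<Longrightarrow> v j = 0) \<Longrightarrow>
      \<bar>bform I D v v\<bar> \<le> \<tau> * (L2_set v I)\<^sup>2"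
    and v: "\<And>j. j \<notin> I \<Longrightarrow> v j = 0"
  shows "\<bar>bform I D v v\<bar> \<le> \<tau> * (L2_set v I + (\<Sum>j\<in>I. \<bar>v j\<bar>) / sqrt (real s))\<^sup>2"
proof -
  define N where "N = L2_set v I + (\<Sum>j\<in>I. \<bar>v j\<bar>) / sqrt (real s)"
  have N: "0 \<le> N" unfolding N_def by (simp add: L2_set_nonneg sum_nonneg)
  have sparse: "\<bar>bform I D u w\<bar> \<le> (\<tau> * L2_set u I) * L2_set w I"
    if "T \<subseteq> I" "card T \<le> s" "\<And>j. j \<notin> T \<Longrightarrow> u j = 0" "T' \<subseteq> I" "card T' \<le> s" "\<And>j. j \<notin> T' \<Longrightarrow> w j = 0"
    for T u T' w
  proof -
    have "card (T \<union> T') \<le> 2 * s" using card_Un_le[of T T'] that by linarith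
    then show ?thesis
      using that by (intro bform_le_of_quadratic[OF fin sym, where T="T \<union> T'"] q[of "T \<union> T'"]) auto
  qed
  have one: "\<bar>bform I D u v\<bar> \<le> (\<tau> * L2_set u I) * N"
    if "T \<subseteq> I" "card T \<le> s" "\<And>j. j \<notin> T \<Longrightarrow> u j = 0" for T u
    unfolding N_def
  proof (rule subadditive_le_l2_l1[OF fin s, where F="\<lambda>w. \<bar>bform I D u w\<bar>"])
    show "0 \<le> \<tau> * L2_set u I" using \<tau> by (simp add: L2_set_nonneg)
    show "\<bar>bform I D u (\<lambda>j. x j + w j)\<bar> \<le> \<bar>bform I D u x\<bar> + \<bar>bform I D u w\<bar>" for x w
      by (simp add: bform_simps)
    show "\<bar>bform I D u w\<bar> \<le> \<tau> * L2_set u I * L2_set w I"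
      if "T' \<subseteq> I" "card T' \<le> s" "\<And>j. j \<notin> T' \<Longrightarrow> w j = 0" for T' w
      by (rule sparse[OF \<open>T \<subseteq> I\<close> \<open>card T \<le> s\<close> _ that]) (rule \<open>\<And>j. j \<notin> T \<Longrightarrow> u j = 0\<close>)
  qed (rule v)
  have "\<bar>bform I D v v\<bar> \<le> (\<tau> * N) * (L2_set v I + (\<Sum>j\<in>I. \<bar>v j\<bar>) / sqrt (real s))"
  proof (rule subadditive_le_l2_l1[OF fin s, where F="\<lambda>u. \<bar>bform I D u v\<bar>"])
    show "0 \<le> \<tau> * N" using \<tau> N by simp
    show "\<bar>bform I D (\<lambda>j. x j + w j) v\<bar> \<le> \<bar>bform I D x v\<bar> + \<bar>bform I D w v\<bar>" for x w
      by (simp add: bform_simps)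
    show "\<bar>bform I D u v\<bar> \<le> \<tau> * N * L2_set u I"
      if "T \<subseteq> I" "card T \<le> s" "\<And>j. j \<notin> T \<Longrightarrow> u j = 0" for T u
      using one[OF that] by (simp add: mult_ac)
  qed (rule v)
  then show ?thesis unfolding N_def[symmetric] by (simp add: power2_eq_square)
qed


text \<open>Here x is the target, d the error, r the residual at the target. After expanding the
  squares, the cross term costs l / 2 times the l1 norm of d on T and off T, while the penalty
  contributes +l on T and -l off T, where x vanishes. The sums 3/2 and -1/2 are doubled at the
  end.\<close>

lemma lasso_basic_inequality:
  fixes P :: "nat \<Rightarrow> 'a \<Rightarrow> real"
  assumes fin: "finite I" and m: "0 < m" and l: "0 \<le> l"
    and opt: "1 / (2 * real m) * (\<Sum>i<m. (r i - (\<Sum>j\<in>I. P i j * d j))\<^sup>2) + l * (\<Sum>j\<in>I. \<bar>x j + d j\<bar>)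
      \<le> 1 / (2 * real m) * (\<Sum>i<m. (r i)\<^sup>2) + l * (\<Sum>j\<in>I. \<bar>x j\<bar>)"
    and W: "\<And>j. j \<in> I \<Longrightarrow> \<bar>(\<Sum>i<m. P i j * r i) / real m\<bar> \<le> l / 2"
    and T: "T \<subseteq> I" "\<And>j. j \<in> I - T \<Longrightarrow> x j = 0"
  shows "1 / real m * (\<Sum>i<m. (\<Sum>j\<in>I. P i j * d j)\<^sup>2)
    \<le> l * (3 * (\<Sum>j\<in>T. \<bar>d j\<bar>) - (\<Sum>j\<in>I - T. \<bar>d j\<bar>))"
proof -
  have "(\<Sum>i<m. (r i - (\<Sum>j\<in>I. P i j * d j))\<^sup>2)
    = (\<Sum>i<m. (r i)\<^sup>2 - 2 * (r i * (\<Sum>j\<in>I. P i j * d j)) + (\<Sum>j\<in>I. P i j * d j)\<^sup>2)"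
    by (intro sum.cong refl) (simp add: power2_diff)
  also have "\<dots> = (\<Sum>i<m. (r i)\<^sup>2) - 2 * (\<Sum>i<m. r i * (\<Sum>j\<in>I. P i j * d j))
      + (\<Sum>i<m. (\<Sum>j\<in>I. P i j * d j)\<^sup>2)"
    by (simp add: sum.distrib sum_subtractf sum_distrib_left)
  finally have expand: "1 / (2 * real m) * (\<Sum>i<m. (\<Sum>j\<in>I. P i j * d j)\<^sup>2)
      \<le> (\<Sum>i<m. r i * (\<Sum>j\<in>I. P i j * d j)) / real m
        + l * ((\<Sum>j\<in>I. \<bar>x j\<bar>) - (\<Sum>j\<in>I. \<bar>x j + d j\<bar>))"
  proof -
    assume eq: "(\<Sum>i<m. (r i - (\<Sum>j\<in>I. P i j * d j))\<^sup>2) = (\<Sum>i<m. (r i)\<^sup>2)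
      - 2 * (\<Sum>i<m. r i * (\<Sum>j\<in>I. P i j * d j)) + (\<Sum>i<m. (\<Sum>j\<in>I. P i j * d j)\<^sup>2)"
    have "1 / (2 * real m) * (R - 2 * N + Q) = 1 / (2 * real m) * R - N / real m + 1 / (2 * real m) * Q"
      for R N Q using m by (simp add: field_simps)
    note this[of "\<Sum>i<m. (r i)\<^sup>2" "\<Sum>i<m. r i * (\<Sum>j\<in>I. P i j * d j)" "\<Sum>i<m. (\<Sum>j\<in>I. P i j * d j)\<^sup>2"]
    then show ?thesis using opt[unfolded eq] unfolding right_diff_distrib[of l] by linarith
  qed
  have "(\<Sum>i<m. r i * (\<Sum>j\<in>I. P i j * d j)) / real m = (\<Sum>j\<in>I. (\<Sum>i<m. P i j * r i) / real m * d j)"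
  proof -
    have "(\<Sum>i<m. r i * (\<Sum>j\<in>I. P i j * d j)) = (\<Sum>j\<in>I. \<Sum>i<m. P i j * r i * d j)"
      unfolding sum_distrib_left by (subst sum.swap) (intro sum.cong refl, simp)
    then show ?thesis by (simp add: sum_divide_distrib sum_distrib_right)
  qed
  also have "\<dots> \<le> (\<Sum>j\<in>I. l / 2 * \<bar>d j\<bar>)"
  proof (intro sum_mono)
    fix j assume "j \<in> I"
    have "(\<Sum>i<m. P i j * r i) / real m * d j \<le> \<bar>(\<Sum>i<m. P i j * r i) / real m\<bar> * \<bar>d j\<bar>"
      by (metis abs_ge_self abs_mult)
    also have "\<dots> \<le> l / 2 * \<bar>d j\<bar>" by (intro mult_right_mono W \<open>j \<in> I\<close>) simp
    finally show "(\<Sum>i<m. P i j * r i) / real m * d j \<le> l / 2 * \<bar>d j\<bar>" .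
  qed
  also have "\<dots> = l / 2 * ((\<Sum>j\<in>T. \<bar>d j\<bar>) + (\<Sum>j\<in>I - T. \<bar>d j\<bar>))"
    unfolding sum_distrib_left[symmetric] using sum.subset_diff[OF T(1) fin, of "\<lambda>j. \<bar>d j\<bar>"] by simp
  finally have noise: "(\<Sum>i<m. r i * (\<Sum>j\<in>I. P i j * d j)) / real m
      \<le> l / 2 * ((\<Sum>j\<in>T. \<bar>d j\<bar>) + (\<Sum>j\<in>I - T. \<bar>d j\<bar>))" .
  have "(\<Sum>j\<in>I. \<bar>x j\<bar>) - (\<Sum>j\<in>I. \<bar>x j + d j\<bar>)
    = (\<Sum>j\<in>T. \<bar>x j\<bar> - \<bar>x j + d j\<bar>) + (\<Sum>j\<in>I - T. \<bar>x j\<bar> - \<bar>x j + d j\<bar>)"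
    unfolding sum_subtractf[symmetric]
    using sum.subset_diff[OF T(1) fin, of "\<lambda>j. \<bar>x j\<bar> - \<bar>x j + d j\<bar>"] by simp
  also have "\<dots> \<le> (\<Sum>j\<in>T. \<bar>d j\<bar>) + (\<Sum>j\<in>I - T. - \<bar>d j\<bar>)"
    using T(2) by (intro add_mono sum_mono) auto
  finally have "l * ((\<Sum>j\<in>I. \<bar>x j\<bar>) - (\<Sum>j\<in>I. \<bar>x j + d j\<bar>))
      \<le> l * ((\<Sum>j\<in>T. \<bar>d j\<bar>) - (\<Sum>j\<in>I - T. \<bar>d j\<bar>))"
    using l by (intro mult_left_mono) (auto simp: sum_negf)
  with expand noise have "1 / (2 * real m) * (\<Sum>i<m. (\<Sum>j\<in>I. P i j * d j)\<^sup>2)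
    \<le> l / 2 * (3 * (\<Sum>j\<in>T. \<bar>d j\<bar>) - (\<Sum>j\<in>I - T. \<bar>d j\<bar>))"
    by (simp add: algebra_simps)
  then show ?thesis using m by (simp add: field_simps)
qed

text \<open>The basic inequality gives the cone condition with factor 3, so the l1 norm of d is at
  most 4 sqrt s times its l2 norm, and the bracket in the deviation is at most 5 times the l2 norm.
  Then 25 * g / 50 = g / 2 leaves half of the curvature g. Dividing by the norm of d gives 6 = 3 *
  2.\<close>

lemma lasso_error_bound:
  fixes P :: "nat \<Rightarrow> 'a \<Rightarrow> real"
  assumes fin: "finite I" and m: "0 < m" and l: "0 < l" and g: "0 < g" and s: "0 < s"
    and opt: "1 / (2 * real m) * (\<Sum>i<m. (r i - (\<Sum>j\<in>I. P i j * d j))\<^sup>2) + l * (\<Sum>j\<in>I. \<bar>x j + d j\<bar>)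
      \<le> 1 / (2 * real m) * (\<Sum>i<m. (r i)\<^sup>2) + l * (\<Sum>j\<in>I. \<bar>x j\<bar>)"
    and W: "\<And>j. j \<in> I \<Longrightarrow> \<bar>(\<Sum>i<m. P i j * r i) / real m\<bar> \<le> l / 2"
    and T: "T \<subseteq> I" "\<And>j. j \<in> I - T \<Longrightarrow> x j = 0" "card T \<le> s"
    and d: "\<And>j. j \<notin> I \<Longrightarrow> d j = 0"
    and S: "\<And>v. g * (L2_set v I)\<^sup>2 \<le> bform I S v v"
    and RE: "\<bar>1 / real m * (\<Sum>i<m. (\<Sum>j\<in>I. P i j * d j)\<^sup>2) - bform I S d d\<bar>
      \<le> g / 50 * (L2_set d I + (\<Sum>j\<in>I. \<bar>d j\<bar>) / sqrt (real s))\<^sup>2"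
  shows "L2_set d I \<le> 6 * l * sqrt (real s) / g"
proof -
  let ?q = "1 / real m * (\<Sum>i<m. (\<Sum>j\<in>I. P i j * d j)\<^sup>2)"
  have basic: "?q \<le> l * (3 * (\<Sum>j\<in>T. \<bar>d j\<bar>) - (\<Sum>j\<in>I - T. \<bar>d j\<bar>))"
    using l by (intro lasso_basic_inequality[OF fin m _ opt W T(1,2)]) auto
  have "0 \<le> ?q" by (simp add: sum_nonneg)
  with basic have "0 \<le> l * (3 * (\<Sum>j\<in>T. \<bar>d j\<bar>) - (\<Sum>j\<in>I - T. \<bar>d j\<bar>))" by linarith
  then have cone: "(\<Sum>j\<in>I - T. \<bar>d j\<bar>) \<le> 3 * (\<Sum>j\<in>T. \<bar>d j\<bar>)"
    using l by (simp add: zero_le_mult_iff)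
  have fT: "finite T" using T(1) fin finite_subset by blast
  have "(\<Sum>j\<in>T. \<bar>d j\<bar>) = (\<Sum>j\<in>T. \<bar>1\<bar> * \<bar>d j\<bar>)" by simp
  also have "\<dots> \<le> L2_set (\<lambda>j. 1) T * L2_set d T" by (rule L2_set_mult_ineq)
  also have "\<dots> \<le> sqrt (real s) * L2_set d I"
  proof (intro mult_mono)
    show "L2_set (\<lambda>j. 1) T \<le> sqrt (real s)" using T(3) by (simp add: L2_set_def)
    show "L2_set d T \<le> L2_set d I" using T(1) fin by (simp add: L2_set_def sum_mono2)
  qed (auto simp: L2_set_nonneg)
  finally have T1: "(\<Sum>j\<in>T. \<bar>d j\<bar>) \<le> sqrt (real s) * L2_set d I" .
  have "(\<Sum>j\<in>I. \<bar>d j\<bar>) \<le> 4 * (sqrt (real s) * L2_set d I)"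
    using sum.subset_diff[OF T(1) fin, of "\<lambda>j. \<bar>d j\<bar>"] cone T1 by linarith
  then have "(\<Sum>j\<in>I. \<bar>d j\<bar>) / sqrt (real s) \<le> 4 * L2_set d I"
    using s by (simp add: field_simps)
  then have "(L2_set d I + (\<Sum>j\<in>I. \<bar>d j\<bar>) / sqrt (real s))\<^sup>2 \<le> (5 * L2_set d I)\<^sup>2"
    by (intro power_mono) (auto simp: L2_set_nonneg sum_nonneg)
  also have "\<dots> = 25 * (L2_set d I)\<^sup>2" by (simp add: power_mult_distrib)
  finally have "g / 50 * (L2_set d I + (\<Sum>j\<in>I. \<bar>d j\<bar>) / sqrt (real s))\<^sup>2 \<le> g / 50 * (25 * (L2_set d I)\<^sup>2)"
    using g by (intro mult_left_mono) auto
  then have "g / 2 * (L2_set d I)\<^sup>2 \<le> ?q" using RE S[of d] by linarith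
  also have "\<dots> \<le> l * (3 * (\<Sum>j\<in>T. \<bar>d j\<bar>))"
    by (rule order_trans[OF basic], intro mult_left_mono) (use l in \<open>auto simp: sum_nonneg\<close>)
  also have "\<dots> \<le> l * (3 * (sqrt (real s) * L2_set d I))"
    using T1 l by (intro mult_left_mono) auto
  finally have "L2_set d I * (g / 2 * L2_set d I) \<le> L2_set d I * (3 * l * sqrt (real s))"
    by (simp add: power2_eq_square mult_ac)
  then have "L2_set d I = 0 \<or> g / 2 * L2_set d I \<le> 3 * l * sqrt (real s)"
    using L2_set_nonneg[of d I] by (metis less_le mult_le_cancel_left_pos)
  then show ?thesis
  proof
    assume "L2_set d I = 0"
    then show ?thesis using l g by simp
  next
    assume "g / 2 * L2_set d I \<le> 3 * l * sqrt (real s)"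
    then show ?thesis using g by (simp add: field_simps)
  qed
qed

section \<open>Integer points of small norm, and Bernstein's inequality\<close>

lemma sum_power_abs_int_le:
  fixes x :: real
  assumes x: "0 \<le> x" "x \<le> 1/2"
  shows "(\<Sum>t\<in>{- int k..int k}. x ^ nat \<bar>t\<bar>) \<le> 1 + 4 * x"
proof -
  \<comment> \<open>The induction needs the additional term 4 x^(k+1), which dominates the part of
    the series not yet summed: it pays for the two new terms x^(k+1), and what remains is at least 4
    x^(k+2) because x \<le> 1/2.\<close>
  have "(\<Sum>t\<in>{- int k..int k}. x ^ nat \<bar>t\<bar>) + 4 * x ^ Suc k \<le> 1 + 4 * x"
  proof (induction k)
    case 0
    then show ?case by simp
  next
    case (Suc k)
    have "{- int (Suc k)..int (Suc k)} = insert (int (Suc k)) (insert (- int (Suc k)) {- int k..int k})"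
      by auto
    then have "(\<Sum>t\<in>{- int (Suc k)..int (Suc k)}. x ^ nat \<bar>t\<bar>)
      = 2 * x ^ Suc k + (\<Sum>t\<in>{- int k..int k}. x ^ nat \<bar>t\<bar>)"
      by (simp add: nat_add_distrib)
    moreover have "x ^ Suc (Suc k) \<le> 1/2 * x ^ Suc k"
      unfolding power_Suc[of x "Suc k"] using x by (intro mult_right_mono) auto
    ultimately show ?case using Suc by linarith
  qed
  then show ?thesis using x zero_le_power[of x "Suc k"] by linarith
qed

text \<open>Members are extensional, so each integer vector on I is represented exactly once and the
  set is finite. The enclosing box is a product, over which a sum of products of weights factors
  into coordinates.\<close>

definition int_ball :: "'a set \<Rightarrow> nat \<Rightarrow> ('a \<Rightarrow> int) set" where
  "int_ball I k = {z \<in> I \<rightarrow>\<^sub>E {- int k..int k}. (\<Sum>j\<in>I. (z j)\<^sup>2) \<le> int k}"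

lemma finite_int_ball: "finite I \<Longrightarrow> finite (int_ball I k)"
  unfolding int_ball_def by (rule finite_subset[of _ "I \<rightarrow>\<^sub>E {- int k..int k}"]) (auto intro: finite_PiE)

lemma abs_le_power2_int: "\<bar>t\<bar> \<le> (t::int)\<^sup>2"
  using self_le_power[of "\<bar>t\<bar>" 2] by (cases "t = 0") auto

lemma restrict_in_int_ball:
  assumes fin: "finite I" and z: "(\<Sum>j\<in>I. (z j)\<^sup>2) \<le> int k"
  shows "restrict z I \<in> int_ball I k"
proof -
  have "\<bar>z j\<bar> \<le> int k" if "j \<in> I" for j
  proof -
    have "(z j)\<^sup>2 \<le> (\<Sum>j\<in>I. (z j)\<^sup>2)" using fin that by (intro member_le_sum) auto
    then show ?thesis using z abs_le_power2_int[of "z j"] by linarith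
  qed
  then show ?thesis using z by (force simp: int_ball_def abs_le_iff)
qed

(* Chernoff-type counting: each point of the ball carries weight at least x^k in the product of the
   geometric weights x^|t|. *)
lemma card_int_ball_le:
  assumes fin: "finite I" and x: "0 < x" "x \<le> (1/2::real)"
  shows "real (card (int_ball I k)) \<le> (1 / x) ^ k * (1 + 4 * x) ^ card I"
proof -
  have "real (card (int_ball I k)) * x ^ k = (\<Sum>z\<in>int_ball I k. x ^ k)" by simp
  also have "\<dots> \<le> (\<Sum>z\<in>int_ball I k. \<Prod>j\<in>I. x ^ nat \<bar>z j\<bar>)"
  proof (intro sum_mono)
    fix z assume z: "z \<in> int_ball I k"
    have "int (\<Sum>j\<in>I. nat \<bar>z j\<bar>) = (\<Sum>j\<in>I. \<bar>z j\<bar>)" by simp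
    also have "\<dots> \<le> (\<Sum>j\<in>I. (z j)\<^sup>2)" by (intro sum_mono abs_le_power2_int)
    also have "\<dots> \<le> int k" using z by (simp add: int_ball_def)
    finally have "(\<Sum>j\<in>I. nat \<bar>z j\<bar>) \<le> k" by linarith
    then have "x ^ k \<le> x ^ (\<Sum>j\<in>I. nat \<bar>z j\<bar>)" using x by (intro power_decreasing) auto
    then show "x ^ k \<le> (\<Prod>j\<in>I. x ^ nat \<bar>z j\<bar>)" by (simp add: power_sum)
  qed
  also have "\<dots> \<le> (\<Sum>z\<in>I \<rightarrow>\<^sub>E {- int k..int k}. \<Prod>j\<in>I. x ^ nat \<bar>z j\<bar>)"
    using x fin by (intro sum_mono2) (auto simp: int_ball_def intro!: prod_nonneg finite_PiE)
  also have "\<dots> = (\<Prod>j\<in>I. \<Sum>t\<in>{- int k..int k}. x ^ nat \<bar>t\<bar>)"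
    using fin by (subst prod_sum_PiE) auto
  also have "\<dots> \<le> (\<Prod>j\<in>I. 1 + 4 * x)"
    using x by (intro prod_mono conjI sum_power_abs_int_le sum_nonneg) auto
  finally have "real (card (int_ball I k)) * x ^ k \<le> (1 + 4 * x) ^ card I" by simp
  then show ?thesis using x by (simp add: field_simps power_divide)
qed

text \<open>The weight is x = s / (e n). With L = ln (e n / s), the factor (1/x)^(32 s) is exp (32 s
  L), and (1 + 4x)^n is at most exp (4 n x) = exp (4 s / e), which is at most exp (2 s L) since e
  \<ge> 2 and L \<ge> 1.\<close>

lemma card_int_ball_le_exp:
  assumes s: "0 < s" "s \<le> n"
  shows "real (card (int_ball {..<n} (32 * s))) \<le> exp (34 * (real s * ln (exp 1 * real n / real s)))"
proof -
  define x where "x = real s / (exp 1 * real n)"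
  define L where "L = ln (exp 1 * real n / real s)"
  have n: "0 < n" using s by simp
  have e: "2 \<le> exp (1::real)" using exp_ge_add_one_self[of "1::real"] by simp
  have x0: "0 < x" using s n by (simp add: x_def)
  have "x \<le> 1 / exp 1" using s n by (simp add: x_def field_simps)
  also have "\<dots> \<le> 1 / 2" using e by (intro divide_left_mono) auto
  finally have x1: "x \<le> 1/2" .
  have inv: "1 / x = exp L" using s n by (simp add: x_def L_def)
  have "ln (exp 1) \<le> L" unfolding L_def using s n by (intro ln_mono) (auto simp: field_simps)
  then have L: "1 \<le> L" by simp
  have "real (card (int_ball {..<n} (32 * s))) \<le> (1 / x) ^ (32 * s) * (1 + 4 * x) ^ n"
    using card_int_ball_le[of "{..<n}" x "32 * s"] x0 x1 by simp
  also have "(1 / x) ^ (32 * s) = exp (32 * (real s * L))"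
    unfolding inv by (simp flip: exp_of_nat_mult)
  also have "(1 + 4 * x) ^ n \<le> exp (4 * x) ^ n"
    using x0 exp_ge_add_one_self[of "4 * x"] by (intro power_mono) (auto simp: add.commute)
  also have "exp (4 * x) ^ n = exp (real n * (4 * x))" by (simp flip: exp_of_nat_mult)
  also have "real n * (4 * x) \<le> 2 * (real s * L)"
  proof -
    have "real n * (4 * x) = 4 * real s / exp 1" using n by (simp add: x_def)
    also have "\<dots> \<le> 4 * real s / 2" using e by (intro divide_left_mono) auto
    also have "\<dots> \<le> 2 * (real s * L)" using mult_left_mono[OF L, of "real s"] by simp
    finally show ?thesis .
  qed
  finally have "real (card (int_ball {..<n} (32 * s))) \<le> exp (32 * (real s * L)) * exp (2 * (real s * L))"
    by simp
  then show ?thesis by (simp add: L_def flip: exp_add)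
qed

section \<open>Bernstein's inequality for centered subexponential variables\<close>

context prob_space
begin

text \<open>Taylor expansion to second order; the linear term has mean zero. With w = |X| / B the
  condition on \<theta> gives |\<theta> X| \<le> w / 2, so the remainder uses up only exp (w / 2),
  and the other half of the exponent absorbs the square through w^2 / 2 \<le> 4 exp (w / 2). Since
  exp w has mean at most 2, the factor 4 becomes 8.\<close>

lemma mgf_le_of_subexponential:
  assumes X[measurable]: "X \<in> borel_measurable M" and int: "integrable M X" and mean: "expectation X = 0"
    and B: "0 < B" and sub: "(\<integral>\<^sup>+\<omega>. ennreal (exp (\<bar>X \<omega>\<bar> / B)) \<partial>M) \<le> 2"
    and \<theta>: "\<bar>\<theta>\<bar> * (2 * B) \<le> 1"
  shows "(\<integral>\<^sup>+\<omega>. ennreal (exp (\<theta> * X \<omega>)) \<partial>M) \<le> ennreal (exp (8 * (\<theta> * B)\<^sup>2))"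
proof -
  have int_e: "integrable M (\<lambda>\<omega>. exp (\<bar>X \<omega>\<bar> / B))"
    using sub by (intro integrableI_bounded) (auto simp: order.strict_trans1[OF _ ennreal_numeral_less_top]
      order_le_less_trans)
  have E_le: "expectation (\<lambda>\<omega>. exp (\<bar>X \<omega>\<bar> / B)) \<le> 2"
  proof -
    have "ennreal (expectation (\<lambda>\<omega>. exp (\<bar>X \<omega>\<bar> / B))) \<le> ennreal 2"
      using sub nn_integral_eq_integral[OF int_e] by simp
    then show ?thesis by (subst (asm) ennreal_le_iff) auto
  qed
  have point: "exp (\<theta> * X \<omega>) \<le> 1 + \<theta> * X \<omega> + 4 * (\<theta> * B)\<^sup>2 * exp (\<bar>X \<omega>\<bar> / B)" for \<omega>
  proof -
    define u where "u = \<theta> * X \<omega>"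
    define w where "w = \<bar>X \<omega>\<bar> / B"
    have w: "0 \<le> w" using B by (simp add: w_def)
    have u_eq: "\<bar>u\<bar> = \<bar>\<theta>\<bar> * B * w" using B by (simp add: u_def w_def abs_mult)
    have "\<bar>\<theta>\<bar> * B * w \<le> 1/2 * w" using \<theta> w by (intro mult_right_mono) auto
    then have u: "\<bar>u\<bar> \<le> w / 2" using u_eq by simp
    obtain t where t: "\<bar>t\<bar> \<le> \<bar>u\<bar>" "exp u = (\<Sum>m<2. u ^ m / fact m) + exp t / fact 2 * u ^ 2"
      using Maclaurin_exp_le[of u 2] by auto
    have "exp u = 1 + u + u\<^sup>2 / 2 * exp t" using t(2) by (simp add: numeral_2_eq_2)
    also have "u\<^sup>2 / 2 * exp t \<le> u\<^sup>2 / 2 * exp (w / 2)"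
      using t(1) u by (intro mult_left_mono) auto
    also have "u\<^sup>2 = (\<theta> * B)\<^sup>2 * w\<^sup>2"
      using u_eq by (metis abs_mult abs_of_pos B power2_abs power_mult_distrib)
    also have "(\<theta> * B)\<^sup>2 * w\<^sup>2 / 2 * exp (w / 2) = (\<theta> * B)\<^sup>2 * (w\<^sup>2 / 2 * exp (w / 2))" by simp
    also have "\<dots> \<le> (\<theta> * B)\<^sup>2 * (4 * exp (w / 2) * exp (w / 2))"
    proof (intro mult_left_mono mult_right_mono)
      have "1 + w / 2 + (w / 2)\<^sup>2 / 2 \<le> exp (w / 2)" using w by (intro exp_lower_Taylor_quadratic) auto
      then show "w\<^sup>2 / 2 \<le> 4 * exp (w / 2)" using w by (simp add: power_divide)
    qed auto
    also have "\<dots> = 4 * (\<theta> * B)\<^sup>2 * exp w" by (simp add: mult.assoc flip: exp_add)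
    finally show ?thesis unfolding u_def w_def by simp
  qed
  have int_\<theta>: "integrable M (\<lambda>\<omega>. exp (\<theta> * X \<omega>))"
  proof (rule Bochner_Integration.integrable_bound[OF int_e])
    show "AE \<omega> in M. norm (exp (\<theta> * X \<omega>)) \<le> norm (exp (\<bar>X \<omega>\<bar> / B))"
    proof (intro AE_I2)
      fix \<omega>
      have "\<theta> * X \<omega> \<le> \<bar>\<theta>\<bar> * \<bar>X \<omega>\<bar>" by (metis abs_ge_self abs_mult)
      also have "\<dots> \<le> (1 / B) * \<bar>X \<omega>\<bar>"
      proof (intro mult_right_mono)
        have "\<bar>\<theta>\<bar> * B \<le> \<bar>\<theta>\<bar> * (2 * B)" using B by (intro mult_left_mono) auto
        then have "\<bar>\<theta>\<bar> * B \<le> 1" using \<theta> by linarith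
        then show "\<bar>\<theta>\<bar> \<le> 1 / B" using B by (simp add: field_simps)
      qed simp
      finally show "norm (exp (\<theta> * X \<omega>)) \<le> norm (exp (\<bar>X \<omega>\<bar> / B))" by simp
    qed
  qed auto
  have "(\<integral>\<^sup>+\<omega>. ennreal (exp (\<theta> * X \<omega>)) \<partial>M) = ennreal (expectation (\<lambda>\<omega>. exp (\<theta> * X \<omega>)))"
    by (intro nn_integral_eq_integral int_\<theta>) auto
  also have "expectation (\<lambda>\<omega>. exp (\<theta> * X \<omega>))
    \<le> expectation (\<lambda>\<omega>. 1 + \<theta> * X \<omega> + 4 * (\<theta> * B)\<^sup>2 * exp (\<bar>X \<omega>\<bar> / B))"
    using int int_e by (intro integral_mono int_\<theta> point) auto
  also have "\<dots> = 1 + 4 * (\<theta> * B)\<^sup>2 * expectation (\<lambda>\<omega>. exp (\<bar>X \<omega>\<bar> / B))"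
    using int int_e mean by (simp add: prob_space)
  also have "\<dots> \<le> 1 + 4 * (\<theta> * B)\<^sup>2 * 2" using E_le by (intro add_left_mono mult_left_mono) auto
  also have "\<dots> \<le> exp (8 * (\<theta> * B)\<^sup>2)" using exp_ge_add_one_self[of "8 * (\<theta> * B)\<^sup>2"] by simp
  finally show ?thesis by (simp add: ennreal_leI)
qed

text \<open>Chernoff's method in the range t \<le> 8 B, where the tail is Gaussian. Nonnegative
  integrals let independence factor the exponential moment without an integrability proof for the
  product.\<close>

lemma bernstein_upper_tail:
  assumes indep: "indep_vars (\<lambda>_. borel) X {..<m}" and m: "0 < m"
    and int: "\<And>i. i < m \<Longrightarrow> integrable M (X i)" and mean: "\<And>i. i < m \<Longrightarrow> expectation (X i) = 0"
    and B: "0 < B" and sub: "\<And>i. i < m \<Longrightarrow> (\<integral>\<^sup>+\<omega>. ennreal (exp (\<bar>X i \<omega>\<bar> / B)) \<partial>M) \<le> 2"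
    and t: "0 < t" "t \<le> 8 * B"
  shows "prob {\<omega>\<in>space M. t \<le> (\<Sum>i<m. X i \<omega>) / real m} \<le> exp (- real m * t\<^sup>2 / (32 * B\<^sup>2))"
proof -
  have [measurable]: "X i \<in> borel_measurable M" if "i < m" for i
    using indep that by (auto simp: indep_vars_def)
  \<comment> \<open>The minimiser of - \<theta> m t + 8 m \<theta>^2 B^2. The condition t \<le> 8 B
    says precisely that 2 B \<theta> \<le> 1.\<close>
  define \<theta> where "\<theta> = t / (16 * B\<^sup>2)"
  have \<theta>0: "0 < \<theta>" using t B by (simp add: \<theta>_def)
  have \<theta>B: "\<bar>\<theta>\<bar> * (2 * B) \<le> 1" using t B \<theta>0 by (simp add: \<theta>_def power2_eq_square field_simps)
  have "{\<omega>\<in>space M. t \<le> (\<Sum>i<m. X i \<omega>) / real m} = {\<omega>\<in>space M. (\<Sum>i<m. X i \<omega>) \<ge> real m * t}"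
    using m by (simp add: field_simps)
  then have "ennreal (prob {\<omega>\<in>space M. t \<le> (\<Sum>i<m. X i \<omega>) / real m})
    = emeasure M {\<omega>\<in>space M. (\<Sum>i<m. X i \<omega>) \<ge> real m * t}"
    by (simp add: emeasure_eq_measure)
  also have "\<dots> \<le> ennreal (exp (- \<theta> * (real m * t)))
      * (\<integral>\<^sup>+\<omega>. ennreal (exp (\<theta> * (\<Sum>i<m. X i \<omega>))) * indicator (space M) \<omega> \<partial>M)"
    by (intro Chernoff_ineq_nn_integral_ge \<theta>0) auto
  also have "(\<integral>\<^sup>+\<omega>. ennreal (exp (\<theta> * (\<Sum>i<m. X i \<omega>))) * indicator (space M) \<omega> \<partial>M)
      = (\<integral>\<^sup>+\<omega>. (\<Prod>i<m. ennreal (exp (\<theta> * X i \<omega>))) \<partial>M)"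
    by (intro nn_integral_cong) (simp add: sum_distrib_left exp_sum prod_ennreal)
  also have "\<dots> = (\<Prod>i<m. \<integral>\<^sup>+\<omega>. ennreal (exp (\<theta> * X i \<omega>)) \<partial>M)"
    by (intro indep_vars_nn_integral indep_vars_compose2[OF indep]) auto
  also have "\<dots> \<le> (\<Prod>i<m. ennreal (exp (8 * (\<theta> * B)\<^sup>2)))"
    using int mean sub B \<theta>B by (intro prod_mono_ennreal mgf_le_of_subexponential) auto
  also have "\<dots> = ennreal (exp (real m * (8 * (\<theta> * B)\<^sup>2)))"
    by (simp add: ennreal_power exp_of_nat_mult)
  also have "ennreal (exp (- \<theta> * (real m * t))) * ennreal (exp (real m * (8 * (\<theta> * B)\<^sup>2)))
      = ennreal (exp (- real m * t\<^sup>2 / (32 * B\<^sup>2)))"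
  proof -
    have "- \<theta> * (real m * t) + real m * (8 * (\<theta> * B)\<^sup>2) = - real m * t\<^sup>2 / (32 * B\<^sup>2)"
      using B by (simp add: \<theta>_def power2_eq_square field_simps)
    then show ?thesis by (simp flip: ennreal_mult exp_add)
  qed
  finally show ?thesis by (simp add: mult_left_mono)
qed

text \<open>The event is strict, so that its complement is the non-strict bound that the
  deterministic argument consumes.\<close>

lemma bernstein_two_sided:
  assumes indep: "indep_vars (\<lambda>_. borel) X {..<m}" and m: "0 < m"
    and int: "\<And>i. i < m \<Longrightarrow> integrable M (X i)" and mean: "\<And>i. i < m \<Longrightarrow> expectation (X i) = 0"
    and B: "0 < B" and sub: "\<And>i. i < m \<Longrightarrow> (\<integral>\<^sup>+\<omega>. ennreal (exp (\<bar>X i \<omega>\<bar> / B)) \<partial>M) \<le> 2"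
    and t: "0 < t" "t \<le> 8 * B"
  shows "prob {\<omega>\<in>space M. t < \<bar>(\<Sum>i<m. X i \<omega>) / real m\<bar>} \<le> 2 * exp (- real m * t\<^sup>2 / (32 * B\<^sup>2))"
proof -
  have [measurable]: "X i \<in> borel_measurable M" if "i < m" for i
    using indep that by (auto simp: indep_vars_def)
  let ?U = "{\<omega>\<in>space M. t \<le> (\<Sum>i<m. X i \<omega>) / real m}"
  let ?L = "{\<omega>\<in>space M. t \<le> (\<Sum>i<m. - X i \<omega>) / real m}"
  have "prob {\<omega>\<in>space M. t < \<bar>(\<Sum>i<m. X i \<omega>) / real m\<bar>} \<le> prob (?U \<union> ?L)"
    by (intro finite_measure_mono) (auto simp: sum_negf abs_if split: if_splits)
  also have "\<dots> \<le> prob ?U + prob ?L" by (intro measure_Un_le) auto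
  also have "prob ?U \<le> exp (- real m * t\<^sup>2 / (32 * B\<^sup>2))"
    by (intro bernstein_upper_tail assms)
  also have "prob ?L \<le> exp (- real m * t\<^sup>2 / (32 * B\<^sup>2))"
    using int mean sub by (intro bernstein_upper_tail indep_vars_compose2[OF indep] m B t) auto
  finally show ?thesis by simp
qed

end

section \<open>Rayleigh quotients\<close>

text \<open>The dimension n is a value, so R^n is realised as the sequences that vanish from n on,
  with the product topology; compactness is Tychonoff's theorem.\<close>

lemma compact_zero_extended_box:
  "compact (PiE UNIV (\<lambda>i::nat. if i < n then {-1..1::real} else {0}))"
proof -
  have "compactin (product_topology (\<lambda>i::nat. euclidean) UNIV) (PiE UNIV (\<lambda>i. if i < n then {-1..1::real} else {0}))"
    by (subst compactin_PiE) (auto simp: compactin_euclidean_iff)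
  then show ?thesis by (simp add: euclidean_product_topology compactin_euclidean_iff)
qed

lemma mem_zero_extended_box_iff:
  "v \<in> PiE UNIV (\<lambda>i::nat. if i < n then {-1..1::real} else {0})
    \<longleftrightarrow> (\<forall>i<n. \<bar>v i\<bar> \<le> 1) \<and> (\<forall>i\<ge>n. v i = 0)"
  by (auto simp: PiE_iff not_less abs_le_iff split: if_splits)

lemma compact_zero_extended_sphere:
  "compact {v :: nat \<Rightarrow> real. (\<forall>i\<ge>n. v i = 0) \<and> (\<Sum>i<n. (v i)\<^sup>2) = 1}" (is "compact ?K")
proof -
  have "continuous_on UNIV (\<lambda>v :: nat \<Rightarrow> real. \<Sum>i<n. (v i)\<^sup>2)"
    by (intro continuous_on_sum continuous_on_power continuous_on_product_coordinates)
  then have "closed {v :: nat \<Rightarrow> real. (\<Sum>i<n. (v i)\<^sup>2) = 1}"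
    by (intro closed_Collect_eq continuous_on_const)
  note compact = compact_Int_closed[OF compact_zero_extended_box[of n] this]
  have "\<bar>v i\<bar> \<le> 1" if v: "(\<Sum>i<n. (v i)\<^sup>2) = 1" and i: "i < n" for v :: "nat \<Rightarrow> real" and i
  proof -
    have "(v i)\<^sup>2 \<le> (\<Sum>i<n. (v i)\<^sup>2)" using i by (intro member_le_sum) auto
    then show ?thesis using v by (simp add: abs_square_le_1)
  qed
  then have "?K = PiE UNIV (\<lambda>i. if i < n then {-1..1::real} else {0}) \<inter> {v. (\<Sum>i<n. (v i)\<^sup>2) = 1}"
    unfolding set_eq_iff Int_iff mem_zero_extended_box_iff by blast
  then show ?thesis using compact by simp
qed

lemma linear_coeff_zero_of_quadratic_nonneg:
  fixes b c :: real
  assumes "\<And>t. 0 \<le> t * b + t\<^sup>2 * c"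
  shows "b = 0"
proof -
  have "((\<lambda>t. t * b + t\<^sup>2 * c) has_real_derivative b) (at 0)"
    by (auto intro!: derivative_eq_intros)
  then show ?thesis
    using assms by (intro DERIV_local_min[where d=1 and x=0 and f="\<lambda>t. t * b + t\<^sup>2 * c"]) auto
qed

text \<open>A minimiser v of the form on the unit sphere exists by compactness. Comparing v + t e
  with the minimum, for e a coordinate vector, gives a quadratic in t that is nonnegative and zero
  at t = 0; its linear coefficient must vanish, which is the j-th coordinate of the eigenvector
  equation.\<close>

lemma rayleigh_minimum:
  fixes D :: "nat \<Rightarrow> nat \<Rightarrow> real"
  assumes n: "0 < n" and sym: "\<forall>j<n. \<forall>k<n. D j k = D k j"
  shows "\<exists>\<mu> v. (\<forall>u. \<mu> * (L2_set u {..<n})\<^sup>2 \<le> bform {..<n} D u u)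
    \<and> (\<forall>j<n. (\<Sum>k<n. D j k * v k) = \<mu> * v j) \<and> (\<Sum>i<n. (v i)\<^sup>2) = 1"
proof -
  define K where "K = {v :: nat \<Rightarrow> real. (\<forall>i\<ge>n. v i = 0) \<and> (\<Sum>i<n. (v i)\<^sup>2) = 1}"
  let ?f = "\<lambda>v. bform {..<n} D v v"
  have comm: "bform {..<n} D u w = bform {..<n} D w u" for u w
    by (rule bform_commute) (use sym in auto)
  have "compact K" unfolding K_def by (rule compact_zero_extended_sphere)
  moreover have "(\<lambda>i. if i = 0 then 1 else 0) \<in> K"
    using n by (auto simp: K_def if_distrib[of "\<lambda>x. x\<^sup>2"] cong: if_cong)
  moreover have "continuous_on K ?f"
    unfolding bform_def
    by (intro continuous_intros continuous_on_subset[OF continuous_on_product_coordinates]) auto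
  ultimately obtain v where v: "v \<in> K" "\<And>u. u \<in> K \<Longrightarrow> ?f v \<le> ?f u"
    using continuous_attains_inf[of K ?f] by blast
  define \<mu> where "\<mu> = ?f v"
  have min: "\<mu> * (L2_set u {..<n})\<^sup>2 \<le> ?f u" for u
  proof (cases "L2_set u {..<n} = 0")
    case True
    then have "\<forall>j\<in>{..<n}. u j = 0" using L2_set_eq_0_iff[of "{..<n}"] by blast
    then show ?thesis using True by (simp add: bform_def)
  next
    case False
    define p where "p = L2_set u {..<n}"
    have p: "p > 0" using False unfolding p_def by (auto simp: less_le L2_set_nonneg)
    define w where "w = restrict_to {..<n} (\<lambda>j. (1/p) * u j)"
    have "(\<Sum>i<n. (w i)\<^sup>2) = (\<Sum>i<n. ((1/p) * u i)\<^sup>2)"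
      by (intro sum.cong) (auto simp: w_def restrict_to_def)
    also have "\<dots> = (L2_set (\<lambda>i. (1/p) * u i) {..<n})\<^sup>2" by (simp only: L2_set_sq)
    also have "\<dots> = 1" unfolding L2_set_scale using p by (simp add: p_def[symmetric])
    finally have "w \<in> K" by (auto simp: K_def w_def restrict_to_def)
    then have "\<mu> \<le> ?f w" using v(2) by (simp add: \<mu>_def)
    also have "?f w = bform {..<n} D (\<lambda>j. (1/p) * u j) (\<lambda>j. (1/p) * u j)"
      unfolding bform_def by (intro sum.cong) (auto simp: w_def restrict_to_def)
    also have "\<dots> = ?f u / p\<^sup>2" unfolding bform_simps by (simp add: power2_eq_square)
    finally show ?thesis using p unfolding p_def[symmetric] by (simp add: field_simps)
  qed
  have v1: "(\<Sum>i<n. (v i)\<^sup>2) = 1" using v(1) by (simp add: K_def)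
  have "(\<Sum>k<n. D j k * v k) = \<mu> * v j" if j: "j < n" for j
  proof -
    define e where "e = (\<lambda>i. if i = j then 1 else (0::real))"
    have e2: "(\<Sum>i<n. (e i)\<^sup>2) = 1" and ve: "(\<Sum>i<n. v i * e i) = v j"
      using j by (auto simp: e_def if_distrib[of "\<lambda>x. x\<^sup>2"] if_distrib[of "\<lambda>x. _ * x"] cong: if_cong)
    have "0 \<le> t * (2 * (bform {..<n} D e v - \<mu> * v j)) + t\<^sup>2 * (?f e - \<mu>)" for t
    proof -
      have "(L2_set (\<lambda>i. v i + t * e i) {..<n})\<^sup>2
        = (\<Sum>i<n. (v i)\<^sup>2 + 2 * t * (v i * e i) + t\<^sup>2 * (e i)\<^sup>2)"
        unfolding L2_set_sq by (intro sum.cong) (auto simp: power2_eq_square algebra_simps)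
      also have "\<dots> = 1 + 2 * t * v j + t\<^sup>2"
        by (simp add: sum.distrib v1 e2 ve flip: sum_distrib_left)
      finally have "\<mu> * (1 + 2 * t * v j + t\<^sup>2) \<le> ?f (\<lambda>i. v i + t * e i)"
        using min[of "\<lambda>i. v i + t * e i"] by simp
      also have "\<dots> = \<mu> + 2 * t * bform {..<n} D e v + t\<^sup>2 * ?f e"
        using comm[of v e] by (simp add: bform_simps \<mu>_def power2_eq_square)
      finally show ?thesis by (simp add: algebra_simps)
    qed
    then have "bform {..<n} D e v = \<mu> * v j"
      using linear_coeff_zero_of_quadratic_nonneg by fastforce
    moreover have "bform {..<n} D e v = (\<Sum>k<n. D j k * v k)"
    proof -
      have "bform {..<n} D e v = (\<Sum>i<n. if i = j then (\<Sum>k<n. D i k * v k) else 0)"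
        unfolding bform_def e_def by (intro sum.cong) auto
      then show ?thesis using j by simp
    qed
    ultimately show ?thesis by simp
  qed
  with min v1 show ?thesis by blast
qed

definition qform :: "real mat \<Rightarrow> (nat \<Rightarrow> real) \<Rightarrow> (nat \<Rightarrow> real) \<Rightarrow> real" where
  "qform S = bform {..<dim_row S} (\<lambda>j k. S $$ (j, k))"

lemma scalar_prod_mult_mat_vec:
  assumes "S \<in> carrier_mat n n" "u \<in> carrier_vec n" "w \<in> carrier_vec n"
  shows "u \<bullet> (S *\<^sub>v w) = qform S (($) u) (($) w)"
  using assms unfolding qform_def bform_def scalar_prod_def
  by (auto simp: scalar_prod_def sum_distrib_left lessThan_atLeast0 mult_ac intro!: sum.cong)

lemma sym_pos_def_sym:
  assumes S: "sym_pos_def n S" and jk: "j < n" "k < n"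
  shows "S $$ (j, k) = S $$ (k, j)"
proof -
  have car: "S \<in> carrier_mat n n" and eq: "S\<^sup>T = S" using S by (auto simp: sym_pos_def_def)
  have "S\<^sup>T $$ (j, k) = S $$ (k, j)" using car jk by (intro index_transpose_mat(1)) auto
  then show ?thesis unfolding eq .
qed

lemma eigenvalue_of_coords:
  assumes S: "S \<in> carrier_mat n n" and v: "\<And>j. j < n \<Longrightarrow> (\<Sum>k<n. S $$ (j, k) * v k) = \<mu> * v j"
    and nz: "(\<Sum>i<n. (v i)\<^sup>2) = (1::real)"
  shows "\<mu> \<in> spectrum S"
proof -
  have "eigenvector S (vec n v) \<mu>"
    unfolding eigenvector_def
  proof (intro conjI)
    show "vec n v \<in> carrier_vec (dim_row S)" using S by simp
    show "vec n v \<noteq> 0\<^sub>v (dim_row S)"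
    proof
      assume "vec n v = 0\<^sub>v (dim_row S)"
      then have "v i = 0" if "i < n" for i using S that by (metis carrier_matD(1) index_vec index_zero_vec(1))
      then show False using nz by simp
    qed
    show "S *\<^sub>v vec n v = \<mu> \<cdot>\<^sub>v vec n v"
      using S v by (intro eq_vecI) (auto simp: scalar_prod_def lessThan_atLeast0)
  qed
  then show ?thesis unfolding spectrum_def eigenvalue_def by auto
qed

text \<open>The minimum of the Rayleigh quotient is an eigenvalue, hence at least
  \<open>gamma_min S\<close>; this direction is enough for the lower bound. The upper bound is the
  same argument for -S, and positivity comes from evaluating the form at an eigenvector of
  \<open>gamma_min S\<close>.\<close>

lemma sym_pos_def_spectrum:
  assumes S: "sym_pos_def n S" and n: "0 < n"
  shows gamma_min_pos: "0 < gamma_min S"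
    and gamma_min_le_gamma_max: "gamma_min S \<le> gamma_max S"
    and gamma_min_le_qform: "gamma_min S * (L2_set u {..<n})\<^sup>2 \<le> qform S u u"
    and qform_le_gamma_max: "qform S u u \<le> gamma_max S * (L2_set u {..<n})\<^sup>2"
proof -
  have car: "S \<in> carrier_mat n n" using S by (simp add: sym_pos_def_def)
  then have dim: "dim_row S = n" by simp
  have fin: "finite (spectrum S)" by (rule card_finite_spectrum(1)[OF car])
  have sym: "\<forall>j<n. \<forall>k<n. S $$ (j, k) = S $$ (k, j)" using sym_pos_def_sym[OF S] by blast
  then have symn: "\<forall>j<n. \<forall>k<n. - S $$ (j, k) = - S $$ (k, j)" by simp
  obtain \<mu> v where \<mu>: "\<And>u. \<mu> * (L2_set u {..<n})\<^sup>2 \<le> bform {..<n} (\<lambda>j k. S $$ (j, k)) u u"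
    "\<And>j. j < n \<Longrightarrow> (\<Sum>k<n. S $$ (j, k) * v k) = \<mu> * v j" "(\<Sum>i<n. (v i)\<^sup>2) = 1"
    using rayleigh_minimum[OF n sym] by blast
  obtain \<nu> w where \<nu>: "\<And>u. \<nu> * (L2_set u {..<n})\<^sup>2 \<le> bform {..<n} (\<lambda>j k. - S $$ (j, k)) u u"
    "\<And>j. j < n \<Longrightarrow> (\<Sum>k<n. - S $$ (j, k) * w k) = \<nu> * w j" "(\<Sum>i<n. (w i)\<^sup>2) = 1"
    using rayleigh_minimum[OF n symn] by blast
  have mem_\<mu>: "\<mu> \<in> spectrum S" by (rule eigenvalue_of_coords[OF car \<mu>(2,3)])
  have "(\<Sum>k<n. S $$ (j, k) * w k) = - \<nu> * w j" if "j < n" for j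
    using \<nu>(2)[OF that] by (simp add: sum_negf)
  then have mem_\<nu>: "- \<nu> \<in> spectrum S" by (rule eigenvalue_of_coords[OF car _ \<nu>(3)])
  have neg: "bform {..<n} (\<lambda>j k. - S $$ (j, k)) u u = - qform S u u"
    by (simp add: qform_def dim bform_def sum_negf)
  show "gamma_min S \<le> gamma_max S"
    unfolding gamma_min_def gamma_max_def using fin mem_\<mu> by (meson Max_ge Min_le order_trans)
  have "gamma_min S * (L2_set u {..<n})\<^sup>2 \<le> \<mu> * (L2_set u {..<n})\<^sup>2"
    unfolding gamma_min_def using fin mem_\<mu> by (intro mult_right_mono) auto
  then show "gamma_min S * (L2_set u {..<n})\<^sup>2 \<le> qform S u u"
    using \<mu>(1)[of u] unfolding qform_def dim by linarith
  have "- \<nu> * (L2_set u {..<n})\<^sup>2 \<le> gamma_max S * (L2_set u {..<n})\<^sup>2"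
    unfolding gamma_max_def using fin mem_\<nu> by (intro mult_right_mono) auto
  then show "qform S u u \<le> gamma_max S * (L2_set u {..<n})\<^sup>2"
    using \<nu>(1)[of u] unfolding neg by linarith
  have "gamma_min S \<in> spectrum S" unfolding gamma_min_def using fin mem_\<mu> by (intro Min_in) auto
  then obtain x where "eigenvector S x (gamma_min S)" unfolding spectrum_def eigenvalue_def by auto
  then have x: "x \<in> carrier_vec n" "x \<noteq> 0\<^sub>v n" "S *\<^sub>v x = gamma_min S \<cdot>\<^sub>v x"
    by (auto simp: eigenvector_def dim)
  have "\<forall>v\<in>carrier_vec n. v \<noteq> 0\<^sub>v n \<longrightarrow> 0 < v \<bullet> (S *\<^sub>v v)" using S unfolding sym_pos_def_def by blast
  then have "0 < x \<bullet> (S *\<^sub>v x)" using x(1,2) by blast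
  also have "x \<bullet> (S *\<^sub>v x) = gamma_min S * (x \<bullet> x)" using x by simp
  finally have "0 < gamma_min S * (x \<bullet> x)" .
  moreover have "0 \<le> x \<bullet> x" by (simp add: scalar_prod_def sum_nonneg)
  ultimately show "0 < gamma_min S" by (simp add: zero_less_mult_iff)
qed

section \<open>Centered Gaussian variables\<close>

text \<open>N(0, V) as the law of a scaled standard normal variable rather than through a density,
  so that V = 0 is included: it occurs for the zero functional and for \<sigma> = 0.\<close>

definition centered_gaussian :: "'w measure \<Rightarrow> real \<Rightarrow> ('w \<Rightarrow> real) \<Rightarrow> bool" where
  "centered_gaussian M V X \<longleftrightarrow> X \<in> borel_measurable M \<and> 0 \<le> V \<and>
     distr M borel X = distr std_normal_distribution borel (\<lambda>z. sqrt V * z)"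

lemma char_scaled_std_normal:
  "char (distr std_normal_distribution borel (\<lambda>z. c * z)) t = complex_of_real (exp (- (c\<^sup>2 * t\<^sup>2) / 2))"
proof -
  have "char (distr std_normal_distribution borel (\<lambda>z. c * z)) t = char std_normal_distribution (t * c)"
    unfolding char_def by (subst integral_distr) (auto simp: mult.assoc)
  then show ?thesis by (simp add: char_std_normal_distribution power_mult_distrib mult.commute)
qed

lemma real_distribution_scaled_std_normal:
  "real_distribution (distr std_normal_distribution borel (\<lambda>z. c * z))"
proof -
  interpret real_distribution std_normal_distribution by (rule real_dist_normal_dist)
  show ?thesis by (rule real_distribution_distr) simp
qed

lemma centered_gaussianD_char:
  assumes "centered_gaussian M V X"
  shows "char (distr M borel X) t = complex_of_real (exp (- (V * t\<^sup>2) / 2))"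
  using assms char_scaled_std_normal[of "sqrt V" t] by (simp add: centered_gaussian_def)

lemma (in prob_space) centered_gaussianI_char:
  assumes [measurable]: "X \<in> borel_measurable M" and V: "0 \<le> V"
    and char: "\<And>t. char (distr M borel X) t = complex_of_real (exp (- (V * t\<^sup>2) / 2))"
  shows "centered_gaussian M V X"
proof -
  have "distr M borel X = distr std_normal_distribution borel (\<lambda>z. sqrt V * z)"
  proof (rule Levy_uniqueness)
    show "real_distribution (distr M borel X)" by (rule real_distribution_distr) simp
    show "real_distribution (distr std_normal_distribution borel (\<lambda>z. sqrt V * z))"
      by (rule real_distribution_scaled_std_normal)
    show "char (distr M borel X) = char (distr std_normal_distribution borel (\<lambda>z. sqrt V * z))"
      using V by (auto simp: char char_scaled_std_normal)
  qed
  then show ?thesis using V by (simp add: centered_gaussian_def)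
qed

lemma (in prob_space) centered_gaussian_add:
  assumes X: "centered_gaussian M V X" and Y: "centered_gaussian M W Y" and indep: "indep_var borel X borel Y"
  shows "centered_gaussian M (V + W) (\<lambda>\<omega>. X \<omega> + Y \<omega>)"
proof (rule centered_gaussianI_char)
  show "(\<lambda>\<omega>. X \<omega> + Y \<omega>) \<in> borel_measurable M" "0 \<le> V + W"
    using X Y by (auto simp: centered_gaussian_def)
  fix t
  show "char (distr M borel (\<lambda>\<omega>. X \<omega> + Y \<omega>)) t = complex_of_real (exp (- ((V + W) * t\<^sup>2) / 2))"
    unfolding char_distr_add[OF indep] centered_gaussianD_char[OF X] centered_gaussianD_char[OF Y]
    by (simp add: distrib_right add_divide_distrib flip: of_real_mult exp_add)
qed

lemma centered_gaussian_nn_integral: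
  assumes X: "centered_gaussian M V X" and [measurable]: "f \<in> borel_measurable borel"
  shows "(\<integral>\<^sup>+\<omega>. f (X \<omega>) \<partial>M) = (\<integral>\<^sup>+z. f (sqrt V * z) \<partial>std_normal_distribution)"
proof -
  have [measurable]: "X \<in> borel_measurable M" using X by (simp add: centered_gaussian_def)
  have "(\<integral>\<^sup>+\<omega>. f (X \<omega>) \<partial>M) = (\<integral>\<^sup>+x. f x \<partial>distr M borel X)" by (simp add: nn_integral_distr)
  also have "distr M borel X = distr std_normal_distribution borel (\<lambda>z. sqrt V * z)"
    using X by (simp add: centered_gaussian_def)
  finally show ?thesis by (simp add: nn_integral_distr)
qed

lemma centered_gaussian_integrable_iff:
  fixes f :: "real \<Rightarrow> real"
  assumes X: "centered_gaussian M V X" and [measurable]: "f \<in> borel_measurable borel"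
  shows "integrable M (\<lambda>\<omega>. f (X \<omega>)) \<longleftrightarrow> integrable std_normal_distribution (\<lambda>z. f (sqrt V * z))"
proof -
  have [measurable]: "X \<in> borel_measurable M" using X by (simp add: centered_gaussian_def)
  have "integrable M (\<lambda>\<omega>. f (X \<omega>)) \<longleftrightarrow> integrable (distr M borel X) f" by (simp add: integrable_distr_eq)
  also have "distr M borel X = distr std_normal_distribution borel (\<lambda>z. sqrt V * z)"
    using X by (simp add: centered_gaussian_def)
  finally show ?thesis by (simp add: integrable_distr_eq)
qed

lemma centered_gaussian_integral:
  fixes f :: "real \<Rightarrow> real"
  assumes X: "centered_gaussian M V X" and [measurable]: "f \<in> borel_measurable borel"
  shows "(\<integral>\<omega>. f (X \<omega>) \<partial>M) = (\<integral>z. f (sqrt V * z) \<partial>std_normal_distribution)"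
proof -
  have [measurable]: "X \<in> borel_measurable M" using X by (simp add: centered_gaussian_def)
  have "(\<integral>\<omega>. f (X \<omega>) \<partial>M) = (\<integral>x. f x \<partial>distr M borel X)" by (simp add: integral_distr)
  also have "distr M borel X = distr std_normal_distribution borel (\<lambda>z. sqrt V * z)"
    using X by (simp add: centered_gaussian_def)
  finally show ?thesis by (simp add: integral_distr)
qed

lemma centered_gaussian_integrable_power:
  assumes X: "centered_gaussian M V X"
  shows "integrable M (\<lambda>\<omega>. (X \<omega>) ^ k)"
  using integrable_std_normal_distribution_moment[of k]
  by (subst centered_gaussian_integrable_iff[OF X]) (auto simp: power_mult_distrib)

lemma centered_gaussian_integrable: "centered_gaussian M V X \<Longrightarrow> integrable M X"
  using centered_gaussian_integrable_power[of M V X 1] by simp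

lemma centered_gaussian_second_moment:
  assumes X: "centered_gaussian M V X"
  shows "(\<integral>\<omega>. (X \<omega>)\<^sup>2 \<partial>M) = V"
proof -
  have "(\<integral>\<omega>. (X \<omega>)\<^sup>2 \<partial>M) = (\<integral>z. (sqrt V * z)\<^sup>2 \<partial>std_normal_distribution)"
    by (rule centered_gaussian_integral[OF X]) simp
  also have "\<dots> = V * (\<integral>z. z\<^sup>2 \<partial>std_normal_distribution)"
    using X by (simp add: power_mult_distrib centered_gaussian_def)
  also have "(\<integral>z. z\<^sup>2 \<partial>std_normal_distribution) = 1"
    using std_normal_distribution_even_moments(1)[of 1] by (simp add: fact_2)
  finally show ?thesis by simp
qed

lemma centered_gaussian_abs_moment:
  assumes X: "centered_gaussian M V X"
  shows "(\<integral>\<omega>. \<bar>X \<omega>\<bar> \<partial>M) = sqrt (2 / pi) * sqrt V"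
proof -
  have "(\<integral>\<omega>. \<bar>X \<omega>\<bar> \<partial>M) = (\<integral>z. \<bar>sqrt V * z\<bar> \<partial>std_normal_distribution)"
    by (rule centered_gaussian_integral[OF X]) simp
  also have "\<dots> = sqrt V * (\<integral>z. \<bar>z\<bar> \<partial>std_normal_distribution)"
    using X by (simp add: abs_mult centered_gaussian_def)
  also have "(\<integral>z. \<bar>z\<bar> \<partial>std_normal_distribution) = sqrt (2 / pi)"
    using std_normal_distribution_odd_moments_abs[of 0] by simp
  finally show ?thesis by simp
qed

text \<open>The integrand against Lebesgue measure is r times the density of N(0, r^2) with r = 1 /
  sqrt (1 - 2a).\<close>

lemma nn_integral_std_normal_exp_square:
  assumes a: "a < 1/2"
  shows "(\<integral>\<^sup>+z. ennreal (exp (a * z\<^sup>2)) \<partial>std_normal_distribution) = ennreal (1 / sqrt (1 - 2 * a))"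
proof -
  define r where "r = 1 / sqrt (1 - 2 * a)"
  have r: "0 < r" using a by (simp add: r_def)
  have r2: "1 / r\<^sup>2 = 1 - 2 * a" using a by (simp add: r_def power_divide)
  interpret N: prob_space "density lborel (normal_density 0 r)" by (rule prob_space_normal_density[OF r])
  have eq: "std_normal_density z * exp (a * z\<^sup>2) = r * normal_density 0 r z" for z
  proof -
    have "- z\<^sup>2 / 2 + a * z\<^sup>2 = - (z\<^sup>2 * (1 / r\<^sup>2)) / 2" unfolding r2 by (simp add: field_simps)
    then have "exp (- z\<^sup>2 / 2) * exp (a * z\<^sup>2) = exp (- z\<^sup>2 / (2 * r\<^sup>2))"
      by (simp flip: exp_add)
    then show ?thesis using r
      by (simp add: normal_density_def real_sqrt_mult)
  qed
  have "(\<integral>\<^sup>+z. ennreal (exp (a * z\<^sup>2)) \<partial>std_normal_distribution)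
    = (\<integral>\<^sup>+z. ennreal (std_normal_density z) * ennreal (exp (a * z\<^sup>2)) \<partial>lborel)"
    by (rule nn_integral_density) auto
  also have "\<dots> = (\<integral>\<^sup>+z. ennreal r * ennreal (normal_density 0 r z) \<partial>lborel)"
    using r by (simp add: eq flip: ennreal_mult')
  also have "\<dots> = ennreal r * (\<integral>\<^sup>+z. ennreal (normal_density 0 r z) \<partial>lborel)"
    by (rule nn_integral_cmult) simp
  also have "(\<integral>\<^sup>+z. ennreal (normal_density 0 r z) \<partial>lborel) = 1"
    using N.emeasure_space_1 by (simp add: emeasure_density)
  finally show ?thesis by (simp add: r_def)
qed

lemma centered_gaussian_exp_square:
  assumes X: "centered_gaussian M V X" and a: "0 \<le> a" "4 * (a * V) \<le> 1"
  shows "(\<integral>\<^sup>+\<omega>. ennreal (exp (a * (X \<omega>)\<^sup>2)) \<partial>M) \<le> ennreal (sqrt 2)"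
proof -
  have V: "0 \<le> V" using X by (simp add: centered_gaussian_def)
  have "(\<integral>\<^sup>+\<omega>. ennreal (exp (a * (X \<omega>)\<^sup>2)) \<partial>M)
    = (\<integral>\<^sup>+z. ennreal (exp (a * (sqrt V * z)\<^sup>2)) \<partial>std_normal_distribution)"
    by (rule centered_gaussian_nn_integral[OF X]) simp
  also have "\<dots> = (\<integral>\<^sup>+z. ennreal (exp ((a * V) * z\<^sup>2)) \<partial>std_normal_distribution)"
    using V by (simp add: power_mult_distrib mult.assoc)
  also have "\<dots> = ennreal (1 / sqrt (1 - 2 * (a * V)))"
    using a by (intro nn_integral_std_normal_exp_square) linarith
  also have "\<dots> \<le> ennreal (sqrt 2)"
  proof (rule ennreal_leI)
    have "sqrt 1 \<le> sqrt (2 * (1 - 2 * (a * V)))" using a(2) by (intro real_sqrt_le_mono) argo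
    then have "1 \<le> sqrt 2 * sqrt (1 - 2 * (a * V))" by (simp only: real_sqrt_mult real_sqrt_one)
    moreover have "0 < sqrt (1 - 2 * (a * V))" using a(2) by simp
    ultimately show "1 / sqrt (1 - 2 * (a * V)) \<le> sqrt 2" by (simp only: pos_divide_le_eq)
  qed
  finally show ?thesis .
qed

text \<open>Both subexponential estimates below end in this product; their scales 4v and 8G are
  chosen so that it falls under the threshold 2 of Bernstein's inequality. The inequality itself is
  e \<le> 4.\<close>

lemma exp_quarter_sqrt2: "exp (1/4) * sqrt 2 \<le> (2::real)"
proof -
  have "exp (1/4 :: real) ^ 4 \<le> (sqrt 2) ^ 4"
  proof -
    have "exp (1/4 :: real) ^ 4 = exp 1" by (simp flip: exp_of_nat_mult)
    also have "\<dots> \<le> 4" using exp_le by simp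
    also have "\<dots> = (sqrt 2) ^ 4" by (simp add: power4_eq_xxxx)
    finally show ?thesis .
  qed
  then have "exp (1/4 :: real) \<le> sqrt 2" by (rule power_mono_iff[THEN iffD1, rotated 3]) auto
  then have "exp (1/4) * sqrt 2 \<le> sqrt 2 * sqrt (2::real)" by (intro mult_right_mono) auto
  then show ?thesis by simp
qed

text \<open>From |X^2 - V| \<le> v + X^2 the exponent is at most 1/4 + X^2 / (4v), and the
  square-exponential moment is then at most sqrt 2.\<close>

lemma centered_gaussian_square_subexponential:
  assumes X: "centered_gaussian M V X" and v: "V \<le> v" "0 < v"
  shows "(\<integral>\<^sup>+\<omega>. ennreal (exp (\<bar>(X \<omega>)\<^sup>2 - V\<bar> / (4 * v))) \<partial>M) \<le> 2"
proof -
  have [measurable]: "X \<in> borel_measurable M" and V: "0 \<le> V" using X by (auto simp: centered_gaussian_def)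
  have "exp (\<bar>(X \<omega>)\<^sup>2 - V\<bar> / (4 * v)) \<le> exp (1/4) * exp (1 / (4 * v) * (X \<omega>)\<^sup>2)" for \<omega>
  proof -
    have "\<bar>(X \<omega>)\<^sup>2 - V\<bar> \<le> v + (X \<omega>)\<^sup>2" using V v by (simp add: abs_le_iff) (smt (verit) zero_le_power2)
    then have "\<bar>(X \<omega>)\<^sup>2 - V\<bar> / (4 * v) \<le> (v + (X \<omega>)\<^sup>2) / (4 * v)"
      using v by (intro divide_right_mono) auto
    also have "\<dots> = 1/4 + 1 / (4 * v) * (X \<omega>)\<^sup>2" using v by (simp add: add_divide_distrib)
    finally show ?thesis by (simp flip: exp_add)
  qed
  then have "(\<integral>\<^sup>+\<omega>. ennreal (exp (\<bar>(X \<omega>)\<^sup>2 - V\<bar> / (4 * v))) \<partial>M)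
      \<le> (\<integral>\<^sup>+\<omega>. ennreal (exp (1/4)) * ennreal (exp (1 / (4 * v) * (X \<omega>)\<^sup>2)) \<partial>M)"
    by (intro nn_integral_mono) (simp flip: ennreal_mult)
  also have "\<dots> = ennreal (exp (1/4)) * (\<integral>\<^sup>+\<omega>. ennreal (exp (1 / (4 * v) * (X \<omega>)\<^sup>2)) \<partial>M)"
    by (rule nn_integral_cmult) simp
  also have "\<dots> \<le> ennreal (exp (1/4)) * ennreal (sqrt 2)"
    using v by (intro mult_left_mono centered_gaussian_exp_square[OF X]) auto
  also have "\<dots> = ennreal (exp (1/4) * sqrt 2)" by (simp flip: ennreal_mult)
  also have "\<dots> \<le> ennreal 2" by (intro ennreal_leI exp_quarter_sqrt2)
  finally show ?thesis by simp
qed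

text \<open>Applied with X a functional of a row, Y = psi . x* and Z the residual. These are
  dependent, so the exponential is not factored: Young's inequality separates the exponent into
  squares of X / G and Y, and the arithmetic-geometric mean then splits the product of exponentials
  into a sum, for which the marginal laws suffice.\<close>

lemma gaussian_product_subexponential:
  assumes X: "centered_gaussian M V X" and Y: "centered_gaussian M 1 Y"
    and G: "V \<le> G\<^sup>2" "0 < G" and [measurable]: "Z \<in> borel_measurable M"
    and Z: "AE \<omega> in M. \<bar>Z \<omega>\<bar> \<le> 1 + \<bar>Y \<omega>\<bar>"
  shows "(\<integral>\<^sup>+\<omega>. ennreal (exp (\<bar>X \<omega> * Z \<omega>\<bar> / (8 * G))) \<partial>M) \<le> 2"
proof -
  have [measurable]: "X \<in> borel_measurable M" "Y \<in> borel_measurable M"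
    using X Y by (auto simp: centered_gaussian_def)
  let ?p = "\<lambda>\<omega>. exp (1 / (8 * G\<^sup>2) * (X \<omega>)\<^sup>2)" and ?q = "\<lambda>\<omega>. exp (1/4 * (Y \<omega>)\<^sup>2)"
  have point: "exp (\<bar>X \<omega> * Z \<omega>\<bar> / (8 * G)) \<le> exp (1/4) * (1/2 * (?p \<omega> + ?q \<omega>))"
    if "\<bar>Z \<omega>\<bar> \<le> 1 + \<bar>Y \<omega>\<bar>" for \<omega>
  proof -
    define p where "p = \<bar>X \<omega>\<bar> / G"
    define y where "y = \<bar>Y \<omega>\<bar>"
    have p: "0 \<le> p" using G by (simp add: p_def)
    have "\<bar>X \<omega> * Z \<omega>\<bar> / (8 * G) = p * \<bar>Z \<omega>\<bar> / 8" using G by (simp add: p_def abs_mult)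
    also have "\<dots> \<le> p * (1 + y) / 8" using that p by (intro divide_right_mono mult_left_mono) (auto simp: y_def)
    also have "\<dots> \<le> 1/4 + (1/8 * p\<^sup>2 + 1/4 * y\<^sup>2) / 2"
    proof -
      have "0 \<le> (p - (1 + y))\<^sup>2" "0 \<le> (1 - y)\<^sup>2" by simp_all
      then have "p * (1 + y) \<le> 2 + p\<^sup>2 / 2 + y\<^sup>2"
        by (simp add: power2_eq_square algebra_simps)
      then show ?thesis by (simp add: add_divide_distrib)
    qed
    finally have "exp (\<bar>X \<omega> * Z \<omega>\<bar> / (8 * G)) \<le> exp (1/4 + (1/8 * p\<^sup>2 + 1/4 * y\<^sup>2) / 2)" by simp
    also have "\<dots> = exp (1/4) * (exp (1/8 * p\<^sup>2 / 2) * exp (1/4 * y\<^sup>2 / 2))"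
      by (simp add: add_divide_distrib flip: exp_add)
    also have "exp (1/8 * p\<^sup>2 / 2) * exp (1/4 * y\<^sup>2 / 2)
      \<le> 1/2 * ((exp (1/8 * p\<^sup>2 / 2))\<^sup>2 + (exp (1/4 * y\<^sup>2 / 2))\<^sup>2)"
      using sum_squares_bound[of "exp (1/8 * p\<^sup>2 / 2)" "exp (1/4 * y\<^sup>2 / 2)"] by simp
    also have "(exp (1/8 * p\<^sup>2 / 2))\<^sup>2 = ?p \<omega>"
      using G by (simp add: p_def power_divide flip: exp_of_nat_mult exp_double)
    also have "(exp (1/4 * y\<^sup>2 / 2))\<^sup>2 = ?q \<omega>"
      by (simp add: y_def flip: exp_double)
    finally show ?thesis by simp
  qed
  have "(\<integral>\<^sup>+\<omega>. ennreal (exp (\<bar>X \<omega> * Z \<omega>\<bar> / (8 * G))) \<partial>M)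
      \<le> (\<integral>\<^sup>+\<omega>. ennreal (exp (1/4) / 2) * (ennreal (?p \<omega>) + ennreal (?q \<omega>)) \<partial>M)"
  proof (rule nn_integral_mono_AE)
    show "AE \<omega> in M. ennreal (exp (\<bar>X \<omega> * Z \<omega>\<bar> / (8 * G)))
      \<le> ennreal (exp (1/4) / 2) * (ennreal (?p \<omega>) + ennreal (?q \<omega>))"
      using Z
    proof eventually_elim
      case (elim \<omega>)
      from point[OF elim] show ?case
        by (subst ennreal_plus[symmetric], simp, simp, subst ennreal_mult[symmetric], simp, simp)
           (intro ennreal_leI, simp)
    qed
  qed
  also have "\<dots> = ennreal (exp (1/4) / 2) * ((\<integral>\<^sup>+\<omega>. ennreal (?p \<omega>) \<partial>M) + (\<integral>\<^sup>+\<omega>. ennreal (?q \<omega>) \<partial>M))"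
    by (simp add: nn_integral_cmult nn_integral_add)
  also have "\<dots> \<le> ennreal (exp (1/4) / 2) * (ennreal (sqrt 2) + ennreal (sqrt 2))"
  proof (intro mult_left_mono add_mono)
    have "4 * (1 / (8 * G\<^sup>2) * V) \<le> 1" using G zero_le_power2[of G] by (simp add: field_simps, linarith)
    then show "(\<integral>\<^sup>+\<omega>. ennreal (?p \<omega>) \<partial>M) \<le> ennreal (sqrt 2)"
      by (intro centered_gaussian_exp_square[OF X]) auto
    show "(\<integral>\<^sup>+\<omega>. ennreal (?q \<omega>) \<partial>M) \<le> ennreal (sqrt 2)"
      by (intro centered_gaussian_exp_square[OF Y]) auto
  qed auto
  also have "\<dots> = ennreal (exp (1/4) * sqrt 2)"
    by (simp flip: ennreal_mult ennreal_plus)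
  also have "\<dots> \<le> ennreal 2" by (intro ennreal_leI exp_quarter_sqrt2)
  finally show ?thesis by simp
qed

lemma borel_measurable_bit_sign[measurable]: "bit_sign \<in> borel_measurable borel"
  unfolding bit_sign_def[abs_def] by measurable

lemma abs_bit_sign[simp]: "\<bar>bit_sign z\<bar> = 1"
  by (simp add: bit_sign_def)

text \<open>The convention \<open>bit_sign 0 = 1\<close> is harmless: 1 belongs to the
  subdifferential of the absolute value at 0.\<close>

lemma abs_add_ge_bit_sign: "\<bar>u\<bar> + w * bit_sign u \<le> \<bar>u + w\<bar>"
  unfolding bit_sign_def by (cases "0 \<le> u") auto

(* Instead of conditioning on U, differentiate E|U + tZ| at t = 0: the sign of U is a subgradient of
   the absolute value at U. *)
lemma (in prob_space) expectation_gaussian_sign: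
  assumes G: "\<And>t. centered_gaussian M (V + 2 * t * B + t\<^sup>2 * W) (\<lambda>\<omega>. U \<omega> + t * Z \<omega>)"
    and Z: "integrable M Z" and V: "0 < V"
  shows "expectation (\<lambda>\<omega>. Z \<omega> * bit_sign (U \<omega>)) = B * sqrt (2 / (pi * V))"
proof -
  have U: "integrable M U" using centered_gaussian_integrable[OF G[of 0]] by simp
  have [measurable]: "U \<in> borel_measurable M" "Z \<in> borel_measurable M" using U Z by auto
  have int: "integrable M (\<lambda>\<omega>. Z \<omega> * bit_sign (U \<omega>))"
    by (rule Bochner_Integration.integrable_bound[OF Z]) (auto simp: abs_mult)
  define E where "E = expectation (\<lambda>\<omega>. Z \<omega> * bit_sign (U \<omega>))"
  define \<phi> where "\<phi> t = sqrt (2 / pi) * sqrt (V + 2 * t * B + t\<^sup>2 * W)" for t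
  have \<phi>: "expectation (\<lambda>\<omega>. \<bar>U \<omega> + t * Z \<omega>\<bar>) = \<phi> t" for t
    unfolding \<phi>_def by (rule centered_gaussian_abs_moment[OF G])
  have le: "\<phi> 0 + t * E \<le> \<phi> t" for t
  proof -
    have "\<phi> 0 + t * E = expectation (\<lambda>\<omega>. \<bar>U \<omega>\<bar> + t * Z \<omega> * bit_sign (U \<omega>))"
      using \<phi>[of 0] U int by (simp add: E_def mult.assoc)
    also have "\<dots> \<le> expectation (\<lambda>\<omega>. \<bar>U \<omega> + t * Z \<omega>\<bar>)"
      using U Z int by (intro integral_mono abs_add_ge_bit_sign) (auto simp: mult.assoc)
    finally show ?thesis using \<phi> by simp
  qed
  \<comment> \<open>The line through \<phi> 0 with slope \<open>E\<close> supports \<phi>, so it is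
    the tangent at 0, where \<phi> is differentiable because V > 0.\<close>
  have "((\<lambda>t. \<phi> t - t * E) has_real_derivative sqrt (2 / pi) * (2 * B * (inverse (sqrt V) / 2)) - E) (at 0)"
    unfolding \<phi>_def using V by (auto intro!: derivative_eq_intros)
  moreover have "\<phi> 0 - 0 * E \<le> \<phi> t - t * E" for t using le[of t] by simp
  ultimately have "sqrt (2 / pi) * (2 * B * (inverse (sqrt V) / 2)) - E = 0"
    by (intro DERIV_local_min[where d=1 and x=0 and f="\<lambda>t. \<phi> t - t * E"]) auto
  then have "E = B * (sqrt (2 / pi) / sqrt V)" by (simp add: field_simps)
  also have "sqrt (2 / pi) / sqrt V = sqrt (2 / (pi * V))" by (simp flip: real_sqrt_divide)
  finally show ?thesis by (simp add: E_def)
qed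

section \<open>Linear functionals of the model\<close>

lemma char_linear_std_normal_product:
  assumes fin: "finite I"
  shows "char (distr (PiM I (\<lambda>_. std_normal_distribution)) borel (\<lambda>z. \<Sum>k\<in>I. b k * z k)) t
    = complex_of_real (exp (- ((\<Sum>k\<in>I. (b k)\<^sup>2) * t\<^sup>2) / 2))"
proof -
  interpret N: real_distribution std_normal_distribution by (rule real_dist_normal_dist)
  interpret product_sigma_finite "\<lambda>_. std_normal_distribution"
    by standard
  let ?P = "PiM I (\<lambda>_. std_normal_distribution)"
  have "char (distr ?P borel (\<lambda>z. \<Sum>k\<in>I. b k * z k)) t = (CLINT z|?P. iexp (t * (\<Sum>k\<in>I. b k * z k)))"
    unfolding char_def by (subst integral_distr) auto
  also have "\<dots> = (CLINT z|?P. (\<Prod>k\<in>I. iexp ((t * b k) * z k)))"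
  proof (rule Bochner_Integration.integral_cong[OF refl])
    fix z :: "'a \<Rightarrow> real"
    have "(\<Prod>k\<in>I. iexp ((t * b k) * z k)) = exp (\<Sum>k\<in>I. \<i> * complex_of_real ((t * b k) * z k))"
      by (simp only: exp_sum[OF fin])
    also have "(\<Sum>k\<in>I. \<i> * complex_of_real ((t * b k) * z k)) = \<i> * complex_of_real (t * (\<Sum>k\<in>I. b k * z k))"
      by (simp add: sum_distrib_left mult.assoc)
    finally show "iexp (t * (\<Sum>k\<in>I. b k * z k)) = (\<Prod>k\<in>I. iexp ((t * b k) * z k))" ..
  qed
  also have "\<dots> = (\<Prod>k\<in>I. char std_normal_distribution (t * b k))"
    unfolding char_def using fin N.integrable_iexp by (intro product_integral_prod) auto
  also have "\<dots> = complex_of_real (exp (\<Sum>k\<in>I. - (t * b k)\<^sup>2 / 2))"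
    by (simp add: char_std_normal_distribution exp_sum fin)
  also have "(\<Sum>k\<in>I. - (t * b k)\<^sup>2 / 2) = - ((\<Sum>k\<in>I. (b k)\<^sup>2) * t\<^sup>2) / 2"
    by (simp add: sum_negf sum_distrib_left sum_distrib_right sum_divide_distrib power_mult_distrib mult.commute)
  finally show ?thesis .
qed

text \<open>For X distributed as A z, the functional v . X has the law of b . z with b = A^t v, and
  |b|^2 = v^t A A^t v = v^t S v. The choice of A thus disappears from the result.\<close>

lemma (in prob_space) has_normal_law_linear:
  assumes law: "has_normal_law M n S X"
  shows "centered_gaussian M (bform {..<n} (\<lambda>j k. S $$ (j, k)) v v) (\<lambda>\<omega>. \<Sum>j<n. v j * X \<omega> $ j)"
proof -
  let ?P = "PiM {..<n} (\<lambda>_. std_normal_distribution)"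
  let ?X = "\<lambda>\<omega>. coords n (X \<omega>)"
  obtain A where A: "A \<in> carrier_mat n n" "A * A\<^sup>T = S"
    and eq: "distr M (euclid n) ?X = distr ?P (euclid n) (\<lambda>z. coords n (A *\<^sub>v vec n z))"
    and X[measurable]: "?X \<in> measurable M (euclid n)"
    using law unfolding has_normal_law_def by auto
  define b where "b k = (\<Sum>j<n. v j * A $$ (j, k))" for k
  have mult: "(A *\<^sub>v vec n z) $ j = (\<Sum>k<n. A $$ (j, k) * z k)" if "j < n" for z j
    using A that by (auto simp: scalar_prod_def lessThan_atLeast0 intro!: sum.cong)
  have "(\<lambda>z. \<lambda>j\<in>{..<n}. \<Sum>k<n. A $$ (j, k) * z k) \<in> measurable ?P (euclid n)"
    by (rule measurable_restrict) measurable
  also have "(\<lambda>z. \<lambda>j\<in>{..<n}. \<Sum>k<n. A $$ (j, k) * z k) = (\<lambda>z. coords n (A *\<^sub>v vec n z))"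
    by (intro ext) (auto simp: coords_def mult restrict_def)
  finally have A_meas[measurable]: "(\<lambda>z. coords n (A *\<^sub>v vec n z)) \<in> measurable ?P (euclid n)" .
  let ?h = "\<lambda>u. \<Sum>j<n. v j * u j"
  have h[measurable]: "?h \<in> borel_measurable (euclid n)" by measurable
  have hX: "(\<lambda>\<omega>. \<Sum>j<n. v j * X \<omega> $ j) = (\<lambda>\<omega>. ?h (?X \<omega>))"
    by (intro ext sum.cong) (auto simp: coords_def)
  have "S $$ (j, k) = (\<Sum>l<n. A $$ (j, l) * A $$ (k, l))" if "j < n" "k < n" for j k
    using A(1) that unfolding A(2)[symmetric]
    by (auto simp: scalar_prod_def lessThan_atLeast0 intro!: sum.cong)
  then have "bform {..<n} (\<lambda>j k. S $$ (j, k)) v v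
    = (\<Sum>j<n. \<Sum>k<n. \<Sum>l<n. (v j * A $$ (j, l)) * (v k * A $$ (k, l)))"
    unfolding bform_def by (intro sum.cong refl) (simp add: sum_distrib_right sum_distrib_left mult_ac)
  also have "\<dots> = (\<Sum>j<n. \<Sum>l<n. \<Sum>k<n. (v j * A $$ (j, l)) * (v k * A $$ (k, l)))"
    by (rule sum.cong[OF refl], rule sum.swap)
  also have "\<dots> = (\<Sum>l<n. \<Sum>j<n. \<Sum>k<n. (v j * A $$ (j, l)) * (v k * A $$ (k, l)))"
    by (rule sum.swap)
  also have "\<dots> = (\<Sum>l<n. (b l)\<^sup>2)"
    unfolding b_def power2_eq_square sum_product ..
  finally have V: "bform {..<n} (\<lambda>j k. S $$ (j, k)) v v = (\<Sum>l<n. (b l)\<^sup>2)" .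
  have "distr M borel (\<lambda>\<omega>. \<Sum>j<n. v j * X \<omega> $ j) = distr (distr M (euclid n) ?X) borel ?h"
    unfolding hX by (subst distr_distr) (auto simp: comp_def)
  also have "\<dots> = distr ?P borel (\<lambda>z. ?h (coords n (A *\<^sub>v vec n z)))"
    unfolding eq by (subst distr_distr) (auto simp: comp_def)
  also have "(\<lambda>z. ?h (coords n (A *\<^sub>v vec n z))) = (\<lambda>z. \<Sum>k<n. b k * z k)"
  proof
    fix z
    have "?h (coords n (A *\<^sub>v vec n z)) = (\<Sum>j<n. \<Sum>k<n. v j * A $$ (j, k) * z k)"
      by (intro sum.cong refl) (simp add: coords_def mult sum_distrib_left mult.assoc)
    also have "\<dots> = (\<Sum>k<n. b k * z k)" unfolding b_def sum_distrib_right by (rule sum.swap)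
    finally show "?h (coords n (A *\<^sub>v vec n z)) = (\<Sum>k<n. b k * z k)" .
  qed
  finally have "distr M borel (\<lambda>\<omega>. \<Sum>j<n. v j * X \<omega> $ j) = distr ?P borel (\<lambda>z. \<Sum>k<n. b k * z k)" .
  then show ?thesis
    unfolding V
    by (intro centered_gaussianI_char) (auto simp: char_linear_std_normal_product sum_nonneg hX)
qed

lemma bform_coord:
  "i < n \<Longrightarrow> bform {..<n} (\<lambda>j k. S $$ (j, k)) (\<lambda>j. if j = i then 1 else 0) (\<lambda>j. if j = i then 1 else 0) = S $$ (i, i)"
proof -
  assume "i < n"
  have "bform {..<n} (\<lambda>j k. S $$ (j, k)) (\<lambda>j. if j = i then 1 else 0) (\<lambda>j. if j = i then 1 else 0)
    = (\<Sum>j<n. if j = i then (\<Sum>k<n. if k = i then S $$ (j, k) else 0) else 0)"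
    unfolding bform_def by (intro sum.cong refl) (auto simp: if_distrib[of "\<lambda>x. _ * x"] cong: if_cong)
  then show ?thesis using \<open>i < n\<close> by simp
qed

section \<open>Sigma-algebras generated by blocks of the 3m variables, and Gaussian
  functionals\<close>

context one_bit_model
begin

definition noise_index :: "(nat + nat + nat) set" where
  "noise_index = {..<m} <+> ({..<m} <+> {..<m})"

definition gen :: "nat + nat + nat \<Rightarrow> 'w set set" where
  "gen k = (case k of
      Inl i \<Rightarrow> sets (vimage_algebra (space M) (\<lambda>\<omega>. coords n (row (\<Psi> \<omega>) i)) (euclid n))
    | Inr (Inl i) \<Rightarrow> sets (vimage_algebra (space M) (\<lambda>\<omega>. \<epsilon> \<omega> $ i) borel)
    | Inr (Inr i) \<Rightarrow> sets (vimage_algebra (space M) (\<lambda>\<omega>. \<eta> \<omega> $ i) borel))"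

text \<open>Packaged as a measure only for the sake of its measurable sets: depending on the block K
  alone becomes ordinary measurability, closed under the usual operations.\<close>

definition gen_algebra :: "(nat + nat + nat) set \<Rightarrow> 'w measure" where
  "gen_algebra K = sigma (space M) (\<Union>k\<in>K. gen k)"

lemma indep_gen: "indep_sets gen noise_index"
  using indep unfolding gen_def[abs_def] noise_index_def .

lemma gen_subset_Pow: "gen k \<subseteq> Pow (space M)"
proof -
  have "sets (vimage_algebra (space M) f N) \<subseteq> Pow (space M)" for f :: "'w \<Rightarrow> 'b" and N
    using sets.space_closed[of "vimage_algebra (space M) f N"] by simp
  note this[of "_ :: 'w \<Rightarrow> (nat \<Rightarrow> real)"] this[of "_ :: 'w \<Rightarrow> real"]
  then show ?thesis unfolding gen_def by (auto split: sum.split)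
qed

lemma Int_stable_gen: "Int_stable (gen k)"
  unfolding gen_def by (auto split: sum.split intro!: sets.Int_stable)

lemma sets_gen_algebra: "sets (gen_algebra K) = sigma_sets (space M) (\<Union>k\<in>K. gen k)"
  unfolding gen_algebra_def using gen_subset_Pow by (intro sets_measure_of) blast

lemma space_gen_algebra[simp]: "space (gen_algebra K) = space M"
  by (simp add: gen_algebra_def space_measure_of_conv)

text \<open>The generators are events by the independence assumption itself, since
  \<open>indep_sets\<close> includes this.\<close>

lemma measurable_gen_algebra_imp:
  assumes K: "K \<subseteq> noise_index" and f: "f \<in> measurable (gen_algebra K) N"
  shows "f \<in> measurable M N"
proof -
  have "(\<Union>k\<in>K. gen k) \<subseteq> sets M" using indep_gen K unfolding indep_sets_def by blast
  then have "sets (gen_algebra K) \<subseteq> sets M"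
    unfolding sets_gen_algebra by (rule sets.sigma_sets_subset)
  then show ?thesis using f unfolding measurable_def by auto
qed

text \<open>Grouping: disjoint blocks of an independent family of intersection-stable generators
  generate independent sigma-algebras, and the variables are measurable with respect to
  these.\<close>

lemma indep_vars_gen_algebra:
  assumes disj: "disjoint_family_on K J" and K: "\<And>j. j \<in> J \<Longrightarrow> K j \<subseteq> noise_index"
    and X: "\<And>j. j \<in> J \<Longrightarrow> X j \<in> measurable (gen_algebra (K j)) N"
  shows "indep_vars (\<lambda>_. N) X J"
proof -
  have "indep_sets gen (\<Union>j\<in>J. K j)" using K by (intro indep_sets_mono_index[OF _ indep_gen]) auto
  then have "indep_sets (\<lambda>j. sigma_sets (space M) (\<Union>k\<in>K j. gen k)) J"
    by (rule indep_sets_collect_sigma) (auto intro: Int_stable_gen disj)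
  then have "indep_sets (\<lambda>j. {X j -` A \<inter> space M |A. A \<in> sets N}) J"
  proof (rule indep_sets_mono_sets)
    fix j assume "j \<in> J"
    show "{X j -` A \<inter> space M |A. A \<in> sets N} \<subseteq> sigma_sets (space M) (\<Union>k\<in>K j. gen k)"
      using measurable_sets[OF X[OF \<open>j \<in> J\<close>]] unfolding sets_gen_algebra by auto
  qed
  then show ?thesis
    unfolding indep_vars_def2 using measurable_gen_algebra_imp[OF K X] by auto
qed

lemma indep_var_gen_algebra:
  assumes "K \<inter> L = {}" "K \<subseteq> noise_index" "L \<subseteq> noise_index"
    and "X \<in> measurable (gen_algebra K) N" "Y \<in> measurable (gen_algebra L) N"
  shows "indep_var N X N Y"
proof -
  have "indep_vars (\<lambda>_. N) (case_bool X Y) UNIV"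
    using assms by (intro indep_vars_gen_algebra[where K="case_bool K L"])
      (auto simp: disjoint_family_on_def split: bool.split)
  moreover have "(\<lambda>_. N) = case_bool N N" by (auto split: bool.split)
  ultimately show ?thesis unfolding indep_var_def by simp
qed

lemma measurable_gen_algebraI:
  assumes "k \<in> K" "gen k = sets (vimage_algebra (space M) h N)" "h \<in> space M \<rightarrow> space N"
  shows "h \<in> measurable (gen_algebra K) N"
proof -
  have "h \<in> measurable (vimage_algebra (space M) h N) N"
    using assms(3) by (rule measurable_vimage_algebra1)
  moreover have "sets (vimage_algebra (space M) h N) \<subseteq> sets (gen_algebra K)"
    unfolding sets_gen_algebra using assms(1,2) by (auto intro: sigma_sets.Basic)
  ultimately show ?thesis unfolding measurable_def by auto
qed

lemma row_psi: "\<omega> \<in> space M \<Longrightarrow> i < m \<Longrightarrow> j < n \<Longrightarrow> row (\<Psi> \<omega>) i $ j = \<Psi> \<omega> $$ (i, j)"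
  using carrier(1)[of \<omega>] by (intro index_row(1)) auto

lemma measurable_psi:
  assumes "Inl i \<in> K" "i < m" "j < n"
  shows "(\<lambda>\<omega>. \<Psi> \<omega> $$ (i, j)) \<in> borel_measurable (gen_algebra K)"
proof -
  have row: "(\<lambda>\<omega>. coords n (row (\<Psi> \<omega>) i)) \<in> measurable (gen_algebra K) (euclid n)"
    by (rule measurable_gen_algebraI[OF assms(1)]) (auto simp: gen_def coords_def space_PiM)
  have proj: "(\<lambda>u. u j) \<in> borel_measurable (euclid n)"
    using assms(3) measurable_component_singleton[of j "{..<n}" "\<lambda>_. borel"] by simp
  have "(\<lambda>\<omega>. coords n (row (\<Psi> \<omega>) i) j) \<in> borel_measurable (gen_algebra K)"
    by (rule measurable_compose[OF row proj])
  also have "(\<lambda>\<omega>. coords n (row (\<Psi> \<omega>) i) j) \<in> borel_measurable (gen_algebra K)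
    \<longleftrightarrow> (\<lambda>\<omega>. \<Psi> \<omega> $$ (i, j)) \<in> borel_measurable (gen_algebra K)"
    by (rule measurable_cong) (use assms(2,3) in \<open>auto simp: coords_def row_psi\<close>)
  finally show ?thesis .
qed

lemma measurable_eps: "Inr (Inl i) \<in> K \<Longrightarrow> (\<lambda>\<omega>. \<epsilon> \<omega> $ i) \<in> borel_measurable (gen_algebra K)"
  by (erule measurable_gen_algebraI) (auto simp: gen_def)

lemma measurable_eta: "Inr (Inr i) \<in> K \<Longrightarrow> (\<lambda>\<omega>. \<eta> \<omega> $ i) \<in> borel_measurable (gen_algebra K)"
  by (erule measurable_gen_algebraI) (auto simp: gen_def)

definition lin :: "nat \<Rightarrow> (nat \<Rightarrow> real) \<Rightarrow> 'w \<Rightarrow> real" where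
  "lin i v \<omega> = (\<Sum>j<n. v j * \<Psi> \<omega> $$ (i, j))"

abbreviation Sform :: "(nat \<Rightarrow> real) \<Rightarrow> (nat \<Rightarrow> real) \<Rightarrow> real" where
  "Sform \<equiv> bform {..<n} (\<lambda>j k. S $$ (j, k))"

lemma measurable_lin:
  "Inl i \<in> K \<Longrightarrow> i < m \<Longrightarrow> lin i v \<in> borel_measurable (gen_algebra K)"
  unfolding lin_def[abs_def] by (intro borel_measurable_sum borel_measurable_times measurable_psi) auto

lemma gaussian_lin:
  assumes i: "i < m"
  shows "centered_gaussian M (Sform v v) (lin i v)"
proof -
  note G = has_normal_law_linear[OF psi_law[OF i], of v]
  have lin_eq: "(\<Sum>j<n. v j * row (\<Psi> \<omega>) i $ j) = lin i v \<omega>" if "\<omega> \<in> space M" for \<omega>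
    unfolding lin_def using that i by (intro sum.cong) (auto simp: row_psi)
  have "lin i v \<in> borel_measurable M"
    by (rule measurable_gen_algebra_imp[of "{Inl i}"]) (use i in \<open>auto simp: noise_index_def intro: measurable_lin\<close>)
  moreover have "distr M borel (lin i v) = distr M borel (\<lambda>\<omega>. \<Sum>j<n. v j * row (\<Psi> \<omega>) i $ j)"
    by (intro distr_cong) (auto simp: lin_eq)
  ultimately show ?thesis using G by (simp add: centered_gaussian_def)
qed

lemma gaussian_eps:
  assumes i: "i < m"
  shows "centered_gaussian M (\<sigma>\<^sup>2) (\<lambda>\<omega>. \<epsilon> \<omega> $ i)"
proof -
  have "(\<Sum>j<m. (if j = i then 1 else 0) * \<epsilon> \<omega> $ j) = \<epsilon> \<omega> $ i" for \<omega>
    using i by (simp add: if_distrib[of "\<lambda>x. x * _"] cong: if_cong)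
  then show ?thesis
    using has_normal_law_linear[OF eps_law, of "\<lambda>j. if j = i then 1 else 0"] i
    by (simp add: bform_coord)
qed

lemma gaussian_lin_eps:
  assumes i: "i < m"
  shows "centered_gaussian M (Sform v v + \<sigma>\<^sup>2) (\<lambda>\<omega>. lin i v \<omega> + \<epsilon> \<omega> $ i)"
  using i by (intro centered_gaussian_add gaussian_lin gaussian_eps
      indep_var_gen_algebra[of "{Inl i}" "{Inr (Inl i)}"] measurable_lin measurable_eps)
    (auto simp: noise_index_def)

text \<open>The probabilities of the two disjoint events are q and 1 - q and add up to 1, so the
  values are \<plusminus>1 almost surely, though not everywhere.\<close>

lemma eta_AE: 
  assumes i: "i < m"
  shows "AE \<omega> in M. \<eta> \<omega> $ i = 1 \<or> \<eta> \<omega> $ i = -1"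
proof -
  have [measurable]: "(\<lambda>\<omega>. \<eta> \<omega> $ i) \<in> borel_measurable M" by (rule eta_meas[OF i])
  let ?P = "{\<omega>\<in>space M. \<eta> \<omega> $ i = 1}" and ?N = "{\<omega>\<in>space M. \<eta> \<omega> $ i = -1}"
  have "prob (?P \<union> ?N) = prob ?P + prob ?N" by (intro finite_measure_Union) auto
  also have "\<dots> = 1" using eta_law[OF i] by simp
  finally have "prob (?P \<union> ?N) = 1" .
  then have "AE \<omega> in M. \<omega> \<in> ?P \<union> ?N" by (subst (asm) prob_eq_1) auto
  then show ?thesis by eventually_elim auto
qed

lemma eta_mean:
  assumes i: "i < m"
  shows "integrable M (\<lambda>\<omega>. \<eta> \<omega> $ i)" "expectation (\<lambda>\<omega>. \<eta> \<omega> $ i) = 2 * q - 1"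
proof -
  have [measurable]: "(\<lambda>\<omega>. \<eta> \<omega> $ i) \<in> borel_measurable M" by (rule eta_meas[OF i])
  show "integrable M (\<lambda>\<omega>. \<eta> \<omega> $ i)"
    by (rule integrable_const_bound[where B=1]) (use eta_AE[OF i] in auto)
  let ?P = "{\<omega>\<in>space M. \<eta> \<omega> $ i = 1}" and ?N = "{\<omega>\<in>space M. \<eta> \<omega> $ i = -1}"
  have "expectation (\<lambda>\<omega>. \<eta> \<omega> $ i) = expectation (\<lambda>\<omega>. indicator ?P \<omega> - indicator ?N \<omega>)"
  proof (rule integral_cong_AE)
    show "AE \<omega> in M. \<eta> \<omega> $ i = indicator ?P \<omega> - indicator ?N \<omega>"
      using eta_AE[OF i] AE_space by eventually_elim (auto simp: indicator_def)
  qed auto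
  also have "\<dots> = prob ?P - prob ?N" by (subst Bochner_Integration.integral_diff) (auto simp: emeasure_eq_measure)
  also have "\<dots> = 2 * q - 1" using eta_law[OF i] by simp
  finally show "expectation (\<lambda>\<omega>. \<eta> \<omega> $ i) = 2 * q - 1" .
qed

text \<open>The bounds come from a coordinate of \<eta>; for m = 0 there is none, hence the
  guard.\<close>

lemma q_bounds: "0 < m \<Longrightarrow> 0 \<le> q" "0 < m \<Longrightarrow> q \<le> 1"
  using eta_law(1)[of 0] by auto

end

section \<open>Concentration\<close>

lemma (in prob_space) prob_Bex_le:
  assumes fin: "finite T" and meas: "\<And>x. x \<in> T \<Longrightarrow> {\<omega>\<in>space M. P x \<omega>} \<in> events"
    and le: "\<And>x. x \<in> T \<Longrightarrow> prob {\<omega>\<in>space M. P x \<omega>} \<le> p"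
  shows "prob {\<omega>\<in>space M. \<exists>x\<in>T. P x \<omega>} \<le> real (card T) * p"
proof -
  have "{\<omega>\<in>space M. \<exists>x\<in>T. P x \<omega>} = (\<Union>x\<in>T. {\<omega>\<in>space M. P x \<omega>})" by auto
  then have "prob {\<omega>\<in>space M. \<exists>x\<in>T. P x \<omega>} \<le> (\<Sum>x\<in>T. prob {\<omega>\<in>space M. P x \<omega>})"
    using fin meas by (simp add: finite_measure_subadditive_finite image_subset_iff)
  also have "\<dots> \<le> (\<Sum>x\<in>T. p)" by (intro sum_mono le)
  finally show ?thesis by simp
qed

lemma (in prob_space) std_deviation_le_subgaussian_norm:
  assumes X: "centered_gaussian M V X" and K: "subgaussian_norm M X \<le> ereal K"
  shows "sqrt V \<le> K"
proof -
  have [measurable]: "X \<in> borel_measurable M" and V: "0 \<le> V" using X by (auto simp: centered_gaussian_def)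
  have "ereal (sqrt V) \<le> subgaussian_norm M X"
    unfolding subgaussian_norm_def
  proof (rule INF_greatest)
    fix t assume "t \<in> {t. 0 < t \<and> (\<integral>\<^sup>+\<omega>. ennreal (exp ((X \<omega> / t)\<^sup>2)) \<partial>M) \<le> 2}"
    then have t: "0 < t" "(\<integral>\<^sup>+\<omega>. ennreal (exp ((X \<omega> / t)\<^sup>2)) \<partial>M) \<le> 2" by auto
    have int: "integrable M (\<lambda>\<omega>. 1 + (X \<omega> / t)\<^sup>2)"
      using centered_gaussian_integrable_power[OF X, of 2] by (simp add: power_divide)
    have "ennreal (expectation (\<lambda>\<omega>. 1 + (X \<omega> / t)\<^sup>2)) = (\<integral>\<^sup>+\<omega>. ennreal (1 + (X \<omega> / t)\<^sup>2) \<partial>M)"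
      by (intro nn_integral_eq_integral[symmetric] int) auto
    also have "\<dots> \<le> (\<integral>\<^sup>+\<omega>. ennreal (exp ((X \<omega> / t)\<^sup>2)) \<partial>M)"
      by (intro nn_integral_mono ennreal_leI exp_ge_add_one_self)
    also have "\<dots> \<le> ennreal 2" using t(2) by simp
    finally have "expectation (\<lambda>\<omega>. 1 + (X \<omega> / t)\<^sup>2) \<le> 2" by (subst (asm) ennreal_le_iff) auto
    moreover have "expectation (\<lambda>\<omega>. 1 + (X \<omega> / t)\<^sup>2) = 1 + V / t\<^sup>2"
      using centered_gaussian_integrable_power[OF X, of 2] centered_gaussian_second_moment[OF X]
      by (simp add: power_divide prob_space)
    ultimately have "V / t\<^sup>2 \<le> 1" by simp
    then have "V \<le> t\<^sup>2" using t(1) by (simp add: field_simps)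
    then show "ereal (sqrt V) \<le> ereal t" using t(1) by (simp add: real_le_lsqrt)
  qed
  then have "ereal (sqrt V) \<le> ereal K" using K by (rule order_trans)
  then show ?thesis by simp
qed

section \<open>Moments and tails of the score and of the energy\<close>

context one_bit_model
begin

text \<open>The constant c of the theorem. It is the regression coefficient of the response on psi .
  x*, which has variance 1.\<close>

definition slope :: real where
  "slope = (2 * q - 1) * sqrt (2 / (pi * (\<sigma>\<^sup>2 + 1)))"

abbreviation xs :: "nat \<Rightarrow> real" where
  "xs \<equiv> ($) xstar"

definition resid :: "nat \<Rightarrow> 'w \<Rightarrow> real" where
  "resid i \<omega> = \<eta> \<omega> $ i * bit_sign (lin i xs \<omega> + \<epsilon> \<omega> $ i) - slope * lin i xs \<omega>"

lemma S_carrier: "S \<in> carrier_mat n n"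
  using S by (simp add: sym_pos_def_def)

lemma qform_eq_Sform: "qform S = Sform"
  using S_carrier by (simp add: qform_def)

lemma Sform_commute: "Sform u v = Sform v u"
  by (rule bform_commute) (use sym_pos_def_sym[OF S] in auto)

lemma Sform_xs: "Sform xs xs = 1"
  using xstar S_carrier by (simp add: norm_wrt_def scalar_prod_mult_mat_vec qform_eq_Sform)

lemma abs_slope_le:
  assumes "0 < m" shows "\<bar>slope\<bar> \<le> 1"
proof -
  have "\<bar>2 * q - 1\<bar> \<le> 1" using q_bounds[OF assms] by auto
  moreover have "sqrt (2 / (pi * (\<sigma>\<^sup>2 + 1))) \<le> sqrt 1"
  proof (rule real_sqrt_le_mono)
    have "2 * 1 \<le> pi * (\<sigma>\<^sup>2 + 1)" using pi_ge_two by (intro mult_mono) auto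
    then show "2 / (pi * (\<sigma>\<^sup>2 + 1)) \<le> 1" by (simp add: divide_le_eq_1)
  qed
  ultimately have "\<bar>2 * q - 1\<bar> * sqrt (2 / (pi * (\<sigma>\<^sup>2 + 1))) \<le> 1 * 1"
    by (intro mult_mono) auto
  then show ?thesis unfolding slope_def by (simp add: abs_mult)
qed

lemma lin_add: "lin i (\<lambda>j. u j + t * v j) \<omega> = lin i u \<omega> + t * lin i v \<omega>"
  by (simp add: lin_def sum.distrib sum_distrib_left algebra_simps)

lemma borel_measurable_model:
  assumes "i < m"
  shows "lin i v \<in> borel_measurable M" "(\<lambda>\<omega>. \<epsilon> \<omega> $ i) \<in> borel_measurable M"
    "(\<lambda>\<omega>. \<eta> \<omega> $ i) \<in> borel_measurable M"
  using gaussian_lin[OF assms] gaussian_eps[OF assms] eta_meas[OF assms]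
  by (auto simp: centered_gaussian_def)

lemma expectation_lin_lin:
  assumes i: "i < m"
  shows "integrable M (\<lambda>\<omega>. lin i u \<omega> * lin i v \<omega>)"
    and "expectation (\<lambda>\<omega>. lin i u \<omega> * lin i v \<omega>) = Sform u v"
proof -
  \<comment> \<open>Polarization reduces the covariance to variances of single functionals. The
    factor 1 is kept so that \<open>lin_add\<close> applies with t = 1.\<close>
  let ?s = "\<lambda>j. u j + 1 * v j"
  have sq: "integrable M (\<lambda>\<omega>. (lin i w \<omega>)\<^sup>2)" "expectation (\<lambda>\<omega>. (lin i w \<omega>)\<^sup>2) = Sform w w" for w
    using centered_gaussian_integrable_power[OF gaussian_lin[OF i]]
      centered_gaussian_second_moment[OF gaussian_lin[OF i]] by auto
  have eq: "lin i u \<omega> * lin i v \<omega> = ((lin i ?s \<omega>)\<^sup>2 - (lin i u \<omega>)\<^sup>2 - (lin i v \<omega>)\<^sup>2) / 2" for \<omega>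
    unfolding lin_add by (simp add: power2_eq_square algebra_simps)
  show "integrable M (\<lambda>\<omega>. lin i u \<omega> * lin i v \<omega>)"
    unfolding eq using sq(1) by (intro integrable_divide Bochner_Integration.integrable_diff) auto
  have "expectation (\<lambda>\<omega>. lin i u \<omega> * lin i v \<omega>) = (Sform ?s ?s - Sform u u - Sform v v) / 2"
    unfolding eq sq(2)[symmetric] using sq(1) by (simp del: mult_1)
  also have "\<dots> = Sform u v" using Sform_commute[of v u] by (simp add: bform_simps)
  finally show "expectation (\<lambda>\<omega>. lin i u \<omega> * lin i v \<omega>) = Sform u v" .
qed

text \<open>With U = psi . x* + eps and Z = psi . u, the variable U + t Z is the functional of x* +
  t u plus noise, hence Gaussian for every t. Its variance at t = 0 is \<sigma>^2 + 1 by the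
  normalization of x*.\<close>

lemma expectation_lin_sign:
  assumes i: "i < m"
  shows "expectation (\<lambda>\<omega>. lin i u \<omega> * bit_sign (lin i xs \<omega> + \<epsilon> \<omega> $ i))
    = Sform u xs * sqrt (2 / (pi * (\<sigma>\<^sup>2 + 1)))"
proof (rule expectation_gaussian_sign)
  fix t
  have V_eq: "Sform (\<lambda>j. xs j + t * u j) (\<lambda>j. xs j + t * u j) + \<sigma>\<^sup>2
    = (\<sigma>\<^sup>2 + 1) + 2 * t * Sform u xs + t\<^sup>2 * Sform u u"
    using Sform_commute[of xs u] by (simp add: bform_simps Sform_xs power2_eq_square)
  have f_eq: "(\<lambda>\<omega>. lin i (\<lambda>j. xs j + t * u j) \<omega> + \<epsilon> \<omega> $ i) = (\<lambda>\<omega>. lin i xs \<omega> + \<epsilon> \<omega> $ i + t * lin i u \<omega>)"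
    unfolding lin_add by auto
  show "centered_gaussian M ((\<sigma>\<^sup>2 + 1) + 2 * t * Sform u xs + t\<^sup>2 * Sform u u)
      (\<lambda>\<omega>. lin i xs \<omega> + \<epsilon> \<omega> $ i + t * lin i u \<omega>)"
    using gaussian_lin_eps[OF i, of "\<lambda>j. xs j + t * u j"] unfolding V_eq f_eq .
next
  show "integrable M (lin i u)" by (rule centered_gaussian_integrable[OF gaussian_lin[OF i]])
  show "0 < \<sigma>\<^sup>2 + 1" by (simp add: add_nonneg_pos)
qed

text \<open>The flip is independent of row and noise and contributes the factor 2q - 1, so the first
  term has mean \<open>slope * Sform u xs\<close>; this is the mean of the subtracted linear
  term.\<close>

lemma expectation_lin_resid:
  assumes i: "i < m"
  shows "integrable M (\<lambda>\<omega>. lin i u \<omega> * resid i \<omega>)"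
    and "expectation (\<lambda>\<omega>. lin i u \<omega> * resid i \<omega>) = 0"
proof -
  note [measurable] = borel_measurable_model[OF i]
  let ?h = "\<lambda>\<omega>. lin i u \<omega> * bit_sign (lin i xs \<omega> + \<epsilon> \<omega> $ i)"
  have "integrable M (lin i u)" by (rule centered_gaussian_integrable[OF gaussian_lin[OF i]])
  then have int_h: "integrable M ?h"
    by (rule Bochner_Integration.integrable_bound) (auto simp: abs_mult)
  have "(\<lambda>\<omega>. \<eta> \<omega> $ i) \<in> borel_measurable (gen_algebra {Inr (Inr i)})"
    by (rule measurable_eta) simp
  moreover have "?h \<in> borel_measurable (gen_algebra {Inl i, Inr (Inl i)})"
    using measurable_lin[of i "{Inl i, Inr (Inl i)}"] measurable_eps[of i "{Inl i, Inr (Inl i)}"] i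
    by (intro borel_measurable_times measurable_compose[OF _ borel_measurable_bit_sign] borel_measurable_add) auto
  ultimately have indep: "indep_var borel (\<lambda>\<omega>. \<eta> \<omega> $ i) borel ?h"
    using i by (intro indep_var_gen_algebra[of "{Inr (Inr i)}" "{Inl i, Inr (Inl i)}"]) (auto simp: noise_index_def)
  have eq: "lin i u \<omega> * resid i \<omega> = \<eta> \<omega> $ i * ?h \<omega> - slope * (lin i u \<omega> * lin i xs \<omega>)" for \<omega>
    by (simp add: resid_def algebra_simps)
  have int_p: "integrable M (\<lambda>\<omega>. \<eta> \<omega> $ i * ?h \<omega>)"
    by (rule indep_var_integrable[OF indep eta_mean(1)[OF i] int_h])
  show "integrable M (\<lambda>\<omega>. lin i u \<omega> * resid i \<omega>)"
    unfolding eq using int_p expectation_lin_lin(1)[OF i] by simp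
  have "expectation (\<lambda>\<omega>. lin i u \<omega> * resid i \<omega>)
    = expectation (\<lambda>\<omega>. \<eta> \<omega> $ i * ?h \<omega>) - slope * Sform u xs"
    unfolding eq expectation_lin_lin(2)[OF i, symmetric] using int_p expectation_lin_lin(1)[OF i] by simp
  also have "expectation (\<lambda>\<omega>. \<eta> \<omega> $ i * ?h \<omega>) = (2 * q - 1) * expectation ?h"
    using indep_var_lebesgue_integral[OF indep eta_mean(1)[OF i] int_h] eta_mean(2)[OF i] by simp
  also have "\<dots> = slope * Sform u xs"
    unfolding expectation_lin_sign[OF i] slope_def by simp
  finally show "expectation (\<lambda>\<omega>. lin i u \<omega> * resid i \<omega>) = 0" by simp
qed

lemma resid_AE_bound:
  assumes i: "i < m"
  shows "AE \<omega> in M. \<bar>resid i \<omega>\<bar> \<le> 1 + \<bar>lin i xs \<omega>\<bar>"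
  using eta_AE[OF i]
proof eventually_elim
  case (elim \<omega>)
  have "\<bar>resid i \<omega>\<bar> \<le> \<bar>\<eta> \<omega> $ i * bit_sign (lin i xs \<omega> + \<epsilon> \<omega> $ i)\<bar> + \<bar>slope * lin i xs \<omega>\<bar>"
    unfolding resid_def by (rule abs_triangle_ineq4)
  also have "\<bar>\<eta> \<omega> $ i * bit_sign (lin i xs \<omega> + \<epsilon> \<omega> $ i)\<bar> = 1" using elim by (auto simp: abs_mult)
  also have "\<bar>slope * lin i xs \<omega>\<bar> \<le> 1 * \<bar>lin i xs \<omega>\<bar>"
    unfolding abs_mult using abs_slope_le i by (intro mult_right_mono) auto
  finally show ?case by simp
qed

lemma indep_vars_rows:
  assumes "\<And>i. i < m \<Longrightarrow> X i \<in> borel_measurable (gen_algebra {Inl i, Inr (Inl i), Inr (Inr i)})"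
  shows "indep_vars (\<lambda>_. borel) X {..<m}"
  using assms by (intro indep_vars_gen_algebra[where K="\<lambda>i. {Inl i, Inr (Inl i), Inr (Inr i)}"])
    (auto simp: disjoint_family_on_def noise_index_def)

lemma measurable_resid:
  assumes i: "i < m"
  shows "resid i \<in> borel_measurable (gen_algebra {Inl i, Inr (Inl i), Inr (Inr i)})" (is "_ \<in> borel_measurable ?G")
proof -
  have [measurable]: "lin i v \<in> borel_measurable ?G" for v by (rule measurable_lin) (use i in auto)
  have [measurable]: "(\<lambda>\<omega>. \<epsilon> \<omega> $ i) \<in> borel_measurable ?G" by (rule measurable_eps) simp
  have [measurable]: "(\<lambda>\<omega>. \<eta> \<omega> $ i) \<in> borel_measurable ?G" by (rule measurable_eta) simp
  show ?thesis unfolding resid_def[abs_def] by measurable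
qed

text \<open>Bernstein with scale B = 8 G, whence 2048 = 32 * 8^2 and the range t \<le> 8 B = 64 G.
  The normalization of x* supplies the variance 1 of psi . x* that the product estimate
  requires.\<close>

lemma score_tail:
  assumes m: "0 < m" and G: "0 < G" "Sform u u \<le> G\<^sup>2" and t: "0 < t" "t \<le> 64 * G"
  shows "prob {\<omega>\<in>space M. t < \<bar>(\<Sum>i<m. lin i u \<omega> * resid i \<omega>) / real m\<bar>}
    \<le> 2 * exp (- real m * t\<^sup>2 / (2048 * G\<^sup>2))"
proof -
  have "prob {\<omega>\<in>space M. t < \<bar>(\<Sum>i<m. lin i u \<omega> * resid i \<omega>) / real m\<bar>}
    \<le> 2 * exp (- real m * t\<^sup>2 / (32 * (8 * G)\<^sup>2))"
  proof (rule bernstein_two_sided[OF _ m])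
    show "indep_vars (\<lambda>_. borel) (\<lambda>i \<omega>. lin i u \<omega> * resid i \<omega>) {..<m}"
      by (intro indep_vars_rows borel_measurable_times measurable_lin measurable_resid) auto
    show "(\<integral>\<^sup>+\<omega>. ennreal (exp (\<bar>lin i u \<omega> * resid i \<omega>\<bar> / (8 * G))) \<partial>M) \<le> 2" if i: "i < m" for i
    proof (rule gaussian_product_subexponential[OF gaussian_lin[OF i, of u] _ G(2,1) _ resid_AE_bound[OF i]])
      show "centered_gaussian M 1 (lin i xs)" using gaussian_lin[OF i, of xs] by (simp add: Sform_xs)
      show "resid i \<in> borel_measurable M"
        by (rule measurable_gen_algebra_imp[OF _ measurable_resid[OF i]]) (use i in \<open>auto simp: noise_index_def\<close>)
    qed
  qed (use expectation_lin_resid G t in auto)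
  then show ?thesis by (simp add: power_mult_distrib)
qed

text \<open>Bernstein with scale B = 4 v, whence 512 = 32 * 4^2 and the range t \<le> 32 v.\<close>

lemma energy_tail:
  assumes m: "0 < m" and v: "0 < v" "Sform u u \<le> v" and t: "0 < t" "t \<le> 32 * v"
  shows "prob {\<omega>\<in>space M. t < \<bar>(\<Sum>i<m. (lin i u \<omega>)\<^sup>2 - Sform u u) / real m\<bar>}
    \<le> 2 * exp (- real m * t\<^sup>2 / (512 * v\<^sup>2))"
proof -
  have "prob {\<omega>\<in>space M. t < \<bar>(\<Sum>i<m. (lin i u \<omega>)\<^sup>2 - Sform u u) / real m\<bar>}
    \<le> 2 * exp (- real m * t\<^sup>2 / (32 * (4 * v)\<^sup>2))"
  proof (rule bernstein_two_sided[OF _ m])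
    show "indep_vars (\<lambda>_. borel) (\<lambda>i \<omega>. (lin i u \<omega>)\<^sup>2 - Sform u u) {..<m}"
      by (intro indep_vars_rows borel_measurable_diff borel_measurable_power measurable_lin) auto
    fix i assume i: "i < m"
    note sq = centered_gaussian_integrable_power[OF gaussian_lin[OF i, of u], of 2]
    show "integrable M (\<lambda>\<omega>. (lin i u \<omega>)\<^sup>2 - Sform u u)" using sq by simp
    show "expectation (\<lambda>\<omega>. (lin i u \<omega>)\<^sup>2 - Sform u u) = 0"
      using sq centered_gaussian_second_moment[OF gaussian_lin[OF i, of u]] by (simp add: prob_space)
    show "(\<integral>\<^sup>+\<omega>. ennreal (exp (\<bar>(lin i u \<omega>)\<^sup>2 - Sform u u\<bar> / (4 * v))) \<partial>M) \<le> 2"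
      by (rule centered_gaussian_square_subexponential[OF gaussian_lin[OF i] v(2,1)])
  qed (use v t in auto)
  then show ?thesis by (simp add: power_mult_distrib)
qed

text \<open>A coordinate vector is one of the directions in the supremum that defines the
  subgaussian norm of a row. All rows have the same covariance, so row 0 is enough; it exists
  because m > 0.\<close>

lemma Sform_unit_le:
  assumes K: "(SUP i\<in>{..<m}. subgaussian_norm_vec M n (\<lambda>\<omega>. row (\<Psi> \<omega>) i)) = ereal K"
    and m: "0 < m" and j: "j < n"
  shows "Sform (($) (unit_vec n j)) (($) (unit_vec n j)) \<le> K\<^sup>2"
proof -
  let ?e = "unit_vec n j :: real vec"
  have norm: "norm2 ?e = 1"
    using j by (simp add: norm2_def if_distrib[of "\<lambda>x. x\<^sup>2"] cong: if_cong)
  note G = gaussian_lin[OF m, of "($) ?e"]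
  have eq: "?e \<bullet> row (\<Psi> \<omega>) 0 = lin 0 (($) ?e) \<omega>" if "\<omega> \<in> space M" for \<omega>
    using carrier(1)[OF that] that m by (simp add: scalar_prod_def lin_def lessThan_atLeast0 row_psi)
  have "subgaussian_norm M (lin 0 (($) ?e)) = subgaussian_norm M (\<lambda>\<omega>. ?e \<bullet> row (\<Psi> \<omega>) 0)"
    unfolding subgaussian_norm_def by (simp add: eq cong: nn_integral_cong)
  also have "\<dots> \<le> subgaussian_norm_vec M n (\<lambda>\<omega>. row (\<Psi> \<omega>) 0)"
    unfolding subgaussian_norm_vec_def using norm by (intro SUP_upper) auto
  also have "\<dots> \<le> ereal K" unfolding K[symmetric] using m by (intro SUP_upper) auto
  finally have "sqrt (Sform (($) ?e) (($) ?e)) \<le> K" by (rule std_deviation_le_subgaussian_norm[OF G])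
  then show ?thesis
    by (metis G centered_gaussian_def power_mono real_sqrt_ge_zero real_sqrt_pow2)
qed

end

section \<open>The error bound\<close>

text \<open>The difference of the two sides is (s - 1) (ln n - ln s) + s - ln s. Through this
  inequality the sample size s ln (e n / s) also pays for the union over n columns and for the
  failure probability n^(-2).\<close>

lemma ln_le_sparsity_entropy:
  assumes s: "0 < s" "s \<le> n"
  shows "ln (real n) \<le> real s * ln (exp 1 * real n / real s)"
proof -
  have n: "0 < n" using s by simp
  have L: "ln (exp 1 * real n / real s) = 1 + ln (real n) - ln (real s)"
    using s n by (simp add: ln_div ln_mult)
  have "(real s - 1) * ln (real s) \<le> (real s - 1) * ln (real n)"
    using s by (intro mult_left_mono ln_mono) auto
  moreover have "ln (real s) \<le> real s - 1" using s by (intro ln_le_minus_one) auto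
  ultimately show ?thesis unfolding L by (simp add: algebra_simps)
qed

text \<open>Converts the division by c into the shape of the final bound. With r the square root in
  c, |c| = 2 |q - 1/2| r, and 2 (\<sigma> + 1) r \<ge> 1 follows from pi < 4 and \<sigma>^2 + 1
  \<le> (\<sigma> + 1)^2.\<close>

lemma slope_inverse_bound:
  assumes \<sigma>: "0 \<le> \<sigma>" and q: "q \<noteq> 1/2" and c: "c = (2 * q - 1) * sqrt (2 / (pi * (\<sigma>\<^sup>2 + 1)))"
  shows "0 < \<bar>c\<bar>" and "1 / \<bar>c\<bar> \<le> (\<sigma> + 1) / \<bar>q - 1/2\<bar>"
proof -
  define r where "r = sqrt (2 / (pi * (\<sigma>\<^sup>2 + 1)))"
  have pos: "0 < pi * (\<sigma>\<^sup>2 + 1)" by (intro mult_pos_pos add_nonneg_pos) auto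
  then have r: "0 < r" by (simp add: r_def)
  have r2: "r\<^sup>2 = 2 / (pi * (\<sigma>\<^sup>2 + 1))" using pos unfolding r_def by (intro real_sqrt_pow2) auto
  have abs_c: "\<bar>c\<bar> = 2 * \<bar>q - 1/2\<bar> * r"
  proof -
    have "\<bar>2 * q - 1\<bar> = 2 * \<bar>q - 1/2\<bar>" by (auto simp: abs_if)
    then show ?thesis using r unfolding c r_def[symmetric] by (simp add: abs_mult)
  qed
  show c0: "0 < \<bar>c\<bar>" using q r unfolding abs_c by auto
  have "1 \<le> (2 * (\<sigma> + 1) * r)\<^sup>2"
  proof -
    have "pi * (\<sigma>\<^sup>2 + 1) \<le> 4 * (\<sigma> + 1)\<^sup>2"
      using pi_less_4 \<sigma> by (intro mult_mono) (auto simp: power2_sum)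
    also have "\<dots> \<le> 8 * (\<sigma> + 1)\<^sup>2" by simp
    finally have "1 \<le> 8 * (\<sigma> + 1)\<^sup>2 / (pi * (\<sigma>\<^sup>2 + 1))" using pos by simp
    also have "\<dots> = (2 * (\<sigma> + 1) * r)\<^sup>2" by (simp add: power_mult_distrib r2 del: distrib_left_numeral)
    finally show ?thesis .
  qed
  then have "1 \<le> 2 * (\<sigma> + 1) * r" using \<sigma> r by (intro power2_le_imp_le[of 1]) auto
  then have "\<bar>q - 1/2\<bar> * 1 \<le> \<bar>q - 1/2\<bar> * (2 * (\<sigma> + 1) * r)" by (intro mult_left_mono) auto
  then have "\<bar>q - 1/2\<bar> \<le> (\<sigma> + 1) * \<bar>c\<bar>" unfolding abs_c by (simp add: algebra_simps)
  then show "1 / \<bar>c\<bar> \<le> (\<sigma> + 1) / \<bar>q - 1/2\<bar>" using c0 q by (simp add: field_simps)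
qed

section \<open>The good event and the choice of constants\<close>

context one_bit_model
begin

lemma slope_bounds: "0 < \<bar>slope\<bar>" "1 / \<bar>slope\<bar> \<le> (\<sigma> + 1) / \<bar>q - 1/2\<bar>"
  using slope_inverse_bound[OF sigma q slope_def] by auto

lemma sparsity_bounds: "0 < norm0 xstar" "norm0 xstar \<le> n"
proof -
  have dim: "dim_vec xstar = n" using xstar(1) by auto
  have "norm0 xstar \<le> card {..<n}" unfolding norm0_def dim by (intro card_mono) auto
  then show "norm0 xstar \<le> n" by simp
  have "\<exists>i<n. xs i \<noteq> 0"
  proof (rule ccontr)
    assume "\<not> ?thesis"
    then have "Sform xs xs = 0" unfolding bform_def by simp
    then show False using Sform_xs by simp
  qed
  then show "0 < norm0 xstar" unfolding norm0_def dim by (auto simp: card_gt_0_iff)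
qed

lemma dim_pos: "0 < n"
  using sparsity_bounds by simp

lemma lin_cong: "(\<And>j. j < n \<Longrightarrow> u j = v j) \<Longrightarrow> lin i u \<omega> = lin i v \<omega>"
  unfolding lin_def by (intro sum.cong) auto

lemma Sform_cong: "(\<And>j. j < n \<Longrightarrow> u j = v j) \<Longrightarrow> Sform u u = Sform v v"
  unfolding bform_def by (intro sum.cong refl) auto

lemma energy_deviation_eq_bform:
  assumes m: "0 < m"
  shows "bform {..<n} (\<lambda>j k. (\<Sum>i<m. \<Psi> \<omega> $$ (i, j) * \<Psi> \<omega> $$ (i, k)) / real m - S $$ (j, k)) v v
    = (\<Sum>i<m. (lin i v \<omega>)\<^sup>2 - Sform v v) / real m"
proof -
  let ?P = "\<lambda>i j. \<Psi> \<omega> $$ (i, j)"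
  have "(lin i v \<omega>)\<^sup>2 = (\<Sum>j<n. \<Sum>k<n. ?P i j * ?P i k * v j * v k)" for i
    unfolding lin_def power2_eq_square sum_product by (intro sum.cong refl) simp
  then have "(\<Sum>i<m. (lin i v \<omega>)\<^sup>2) = (\<Sum>j<n. \<Sum>i<m. \<Sum>k<n. ?P i j * ?P i k * v j * v k)"
    by (simp add: sum.swap[of _ "{..<n}" "{..<m}"])
  also have "\<dots> = (\<Sum>j<n. \<Sum>k<n. \<Sum>i<m. ?P i j * ?P i k * v j * v k)"
    by (rule sum.cong[OF refl], rule sum.swap)
  finally have "(\<Sum>i<m. (lin i v \<omega>)\<^sup>2) = (\<Sum>j<n. \<Sum>k<n. (\<Sum>i<m. ?P i j * ?P i k) * v j * v k)"
    by (simp add: sum_distrib_right)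
  then have "(\<Sum>i<m. (lin i v \<omega>)\<^sup>2) / real m = bform {..<n} (\<lambda>j k. (\<Sum>i<m. ?P i j * ?P i k) / real m) v v"
    unfolding bform_def by (simp only: times_divide_eq_left sum_divide_distrib[symmetric])
  moreover have "(\<Sum>i<m. (lin i v \<omega>)\<^sup>2 - Sform v v) / real m = (\<Sum>i<m. (lin i v \<omega>)\<^sup>2) / real m - Sform v v"
    using m by (simp add: sum_subtractf field_simps)
  ultimately show ?thesis by (simp add: bform_def left_diff_distrib sum_subtractf)
qed

definition net_point :: "nat \<Rightarrow> (nat \<Rightarrow> int) \<Rightarrow> nat \<Rightarrow> real" where
  "net_point s z j = real_of_int (z j) / sqrt (real (32 * s))"

lemma L2_set_net_point:
  assumes "0 < s" "z \<in> int_ball {..<n} (32 * s)"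
  shows "(L2_set (net_point s z) {..<n})\<^sup>2 \<le> 1"
proof -
  have "(L2_set (net_point s z) {..<n})\<^sup>2 = real_of_int (\<Sum>j<n. (z j)\<^sup>2) / real (32 * s)"
    unfolding L2_set_sq net_point_def by (simp add: power_divide sum_divide_distrib)
  also have "\<dots> \<le> real (32 * s) / real (32 * s)"
  proof (rule divide_right_mono)
    have "(\<Sum>j<n. (z j)\<^sup>2) \<le> int (32 * s)" using assms(2) by (simp add: int_ball_def)
    then show "real_of_int (\<Sum>j<n. (z j)\<^sup>2) \<le> real (32 * s)" by linarith
  qed simp
  finally show ?thesis using assms(1) by simp
qed

text \<open>Holds for each \<omega> separately: the net bound passes to all 2s-sparse vectors by
  rounding, and from these to arbitrary vectors by shelling.\<close>

lemma restricted_energy_deviation: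
  assumes m: "0 < m" and s: "0 < s" and \<tau>: "0 \<le> \<tau>"
    and net: "\<And>z. z \<in> int_ball {..<n} (32 * s) \<Longrightarrow>
      \<bar>(\<Sum>i<m. (lin i (net_point s z) \<omega>)\<^sup>2 - Sform (net_point s z) (net_point s z)) / real m\<bar> \<le> \<tau> / 2"
    and v: "\<And>j. j \<notin> {..<n} \<Longrightarrow> v j = 0"
  shows "\<bar>1 / real m * (\<Sum>i<m. (\<Sum>j<n. \<Psi> \<omega> $$ (i, j) * v j)\<^sup>2) - Sform v v\<bar>
    \<le> \<tau> * (L2_set v {..<n} + (\<Sum>j<n. \<bar>v j\<bar>) / sqrt (real s))\<^sup>2"
proof -
  let ?D = "\<lambda>j k. (\<Sum>i<m. \<Psi> \<omega> $$ (i, j) * \<Psi> \<omega> $$ (i, k)) / real m - S $$ (j, k)"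
  have sym: "?D j k = ?D k j" if "j \<in> {..<n}" "k \<in> {..<n}" for j k
    using sym_pos_def_sym[OF S] that by (simp add: mult.commute)
  have "\<bar>bform {..<n} ?D v v\<bar> \<le> \<tau> * (L2_set v {..<n} + (\<Sum>j<n. \<bar>v j\<bar>) / sqrt (real s))\<^sup>2"
  proof (rule quadratic_le_l2_l1[OF _ s \<tau> sym _ v])
    fix T :: "nat set" and u :: "nat \<Rightarrow> real"
    assume T: "T \<subseteq> {..<n}" "card T \<le> 2 * s" and u: "\<And>j. j \<notin> T \<Longrightarrow> u j = 0"
    show "\<bar>bform {..<n} ?D u u\<bar> \<le> \<tau> * (L2_set u {..<n})\<^sup>2"
    proof (rule quadratic_le_of_net[OF _ T s sym _ u])
      fix z :: "nat \<Rightarrow> int"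
      assume z: "(\<Sum>j<n. (z j)\<^sup>2) \<le> int (32 * s)"
      let ?x = "\<lambda>j. real_of_int (z j) / sqrt (real (32 * s))"
      \<comment> \<open>Members of \<open>int_ball\<close> are extensional while z is an arbitrary
        function; both \<open>lin\<close> and \<open>Sform\<close> see only the coordinates below n,
        so restricting z changes neither.\<close>
      let ?y = "net_point s (restrict z {..<n})"
      have mem: "restrict z {..<n} \<in> int_ball {..<n} (32 * s)"
        by (rule restrict_in_int_ball[OF _ z]) simp
      have "lin i ?x \<omega> = lin i ?y \<omega>" for i by (rule lin_cong) (simp add: net_point_def)
      moreover have "Sform ?x ?x = Sform ?y ?y" by (rule Sform_cong) (simp add: net_point_def)
      ultimately show "\<bar>bform {..<n} ?D ?x ?x\<bar> \<le> \<tau> / 2"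
        unfolding energy_deviation_eq_bform[OF m] using net[OF mem] by simp
    qed simp_all
  qed simp_all
  moreover have "bform {..<n} ?D v v = 1 / real m * (\<Sum>i<m. (\<Sum>j<n. \<Psi> \<omega> $$ (i, j) * v j)\<^sup>2) - Sform v v"
    unfolding energy_deviation_eq_bform[OF m] using m
    by (simp add: sum_subtractf lin_def mult.commute diff_divide_distrib)
  ultimately show ?thesis by simp
qed

text \<open>The objective in terms of the residual and of the error x - c x*, the form in which the
  deterministic bound expects it. At the competitor c x* the error vanishes.\<close>

lemma lasso_objective_eq:
  assumes \<omega>: "\<omega> \<in> space M" and x: "x \<in> carrier_vec n"
  shows "lasso_objective (\<Psi> \<omega>) (response (\<Psi> \<omega>) (\<epsilon> \<omega>) (\<eta> \<omega>) xstar) l x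
    = 1 / (2 * real m) * (\<Sum>i<m. (resid i \<omega> - (\<Sum>j<n. \<Psi> \<omega> $$ (i, j) * (x $ j - slope * xs j)))\<^sup>2)
      + l * (\<Sum>j<n. \<bar>slope * xs j + (x $ j - slope * xs j)\<bar>)"
proof -
  have P: "\<Psi> \<omega> \<in> carrier_mat m n" and e: "\<epsilon> \<omega> \<in> carrier_vec m" using carrier \<omega> by auto
  have mult: "(\<Psi> \<omega> *\<^sub>v u) $ i = lin i (($) u) \<omega>" if "i < m" "u \<in> carrier_vec n" for i u
    using P that by (auto simp: lin_def scalar_prod_def lessThan_atLeast0 mult.commute intro!: sum.cong)
  have "(response (\<Psi> \<omega>) (\<epsilon> \<omega>) (\<eta> \<omega>) xstar - \<Psi> \<omega> *\<^sub>v x) $ i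
    = resid i \<omega> - (\<Sum>j<n. \<Psi> \<omega> $$ (i, j) * (x $ j - slope * xs j))" if i: "i < m" for i
  proof -
    have "(response (\<Psi> \<omega>) (\<epsilon> \<omega>) (\<eta> \<omega>) xstar - \<Psi> \<omega> *\<^sub>v x) $ i
      = \<eta> \<omega> $ i * bit_sign (lin i xs \<omega> + \<epsilon> \<omega> $ i) - lin i (($) x) \<omega>"
      using P e i mult[OF i xstar(1)] mult[OF i x] by (simp add: response_def)
    also have "\<dots> = resid i \<omega> - (lin i (($) x) \<omega> - slope * lin i xs \<omega>)"
      by (simp add: resid_def)
    also have "lin i (($) x) \<omega> - slope * lin i xs \<omega> = (\<Sum>j<n. \<Psi> \<omega> $$ (i, j) * (x $ j - slope * xs j))"
      by (simp add: lin_def sum_distrib_left sum_subtractf[symmetric] algebra_simps)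
    finally show ?thesis .
  qed
  then have "(norm2 (response (\<Psi> \<omega>) (\<epsilon> \<omega>) (\<eta> \<omega>) xstar - \<Psi> \<omega> *\<^sub>v x))\<^sup>2
    = (\<Sum>i<m. (resid i \<omega> - (\<Sum>j<n. \<Psi> \<omega> $$ (i, j) * (x $ j - slope * xs j)))\<^sup>2)"
    using P by (simp add: norm2_def sum_nonneg)
  then show ?thesis using P x by (simp add: lasso_objective_def norm1_def)
qed

text \<open>Of minimality only the comparison with c x* enters. The deterministic bound controls d =
  x - c x*, and x / c - x* = d / c explains the final division by |c|.\<close>

lemma lasso_error_of_good_event:
  assumes \<omega>: "\<omega> \<in> space M" and m: "0 < m" and l: "0 < l"
    and score: "\<And>j. j < n \<Longrightarrow> \<bar>(\<Sum>i<m. \<Psi> \<omega> $$ (i, j) * resid i \<omega>) / real m\<bar> \<le> l / 2"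
    and net: "\<And>z. z \<in> int_ball {..<n} (32 * norm0 xstar) \<Longrightarrow>
      \<bar>(\<Sum>i<m. (lin i (net_point (norm0 xstar) z) \<omega>)\<^sup>2
        - Sform (net_point (norm0 xstar) z) (net_point (norm0 xstar) z)) / real m\<bar> \<le> gamma_min S / 50 / 2"
    and x: "is_arg_min (lasso_objective (\<Psi> \<omega>) (response (\<Psi> \<omega>) (\<epsilon> \<omega>) (\<eta> \<omega>) xstar) l)
      (\<lambda>x. x \<in> carrier_vec n) x"
  shows "norm2 ((1 / slope) \<cdot>\<^sub>v x - xstar) \<le> 6 * l * sqrt (real (norm0 xstar)) / gamma_min S / \<bar>slope\<bar>"
proof -
  have car: "x \<in> carrier_vec n" using x by (simp add: is_arg_min_def)
  let ?d = "restrict_to {..<n} (\<lambda>j. x $ j - slope * xs j)"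
  let ?T = "{i. i < n \<and> xs i \<noteq> 0}"
  note pos = gamma_min_pos[OF S dim_pos]
  have "L2_set ?d {..<n} \<le> 6 * l * sqrt (real (norm0 xstar)) / gamma_min S"
  proof (rule lasso_error_bound[OF _ m l pos sparsity_bounds(1), where r="\<lambda>i. resid i \<omega>"
        and P="\<lambda>i j. \<Psi> \<omega> $$ (i, j)" and x="\<lambda>j. slope * xs j" and T="?T" and S="\<lambda>j k. S $$ (j, k)"])
    have d: "?d j = x $ j - slope * xs j" if "j < n" for j using that by (simp add: restrict_to_def)
    have c_car: "slope \<cdot>\<^sub>v xstar \<in> carrier_vec n" using xstar by simp
    have "lasso_objective (\<Psi> \<omega>) (response (\<Psi> \<omega>) (\<epsilon> \<omega>) (\<eta> \<omega>) xstar) l x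
      \<le> lasso_objective (\<Psi> \<omega>) (response (\<Psi> \<omega>) (\<epsilon> \<omega>) (\<eta> \<omega>) xstar) l (slope \<cdot>\<^sub>v xstar)"
      using x c_car by (auto simp: is_arg_min_def not_less)
    then show "1 / (2 * real m) * (\<Sum>i<m. (resid i \<omega> - (\<Sum>j<n. \<Psi> \<omega> $$ (i, j) * ?d j))\<^sup>2)
        + l * (\<Sum>j<n. \<bar>slope * xs j + ?d j\<bar>)
      \<le> 1 / (2 * real m) * (\<Sum>i<m. (resid i \<omega>)\<^sup>2) + l * (\<Sum>j<n. \<bar>slope * xs j\<bar>)"
      unfolding lasso_objective_eq[OF \<omega> car] lasso_objective_eq[OF \<omega> c_car] using xstar(1) by (simp add: d)
    show "\<bar>(\<Sum>i<m. \<Psi> \<omega> $$ (i, j) * resid i \<omega>) / real m\<bar> \<le> l / 2" if "j \<in> {..<n}" for j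
      using score that by simp
    show "card ?T \<le> norm0 xstar" using xstar(1) by (simp add: norm0_def)
    show "gamma_min S * (L2_set v {..<n})\<^sup>2 \<le> Sform v v" for v
      using gamma_min_le_qform[OF S dim_pos] by (simp add: qform_eq_Sform)
    show "\<bar>1 / real m * (\<Sum>i<m. (\<Sum>j<n. \<Psi> \<omega> $$ (i, j) * ?d j)\<^sup>2) - Sform ?d ?d\<bar>
      \<le> gamma_min S / 50 * (L2_set ?d {..<n} + (\<Sum>j<n. \<bar>?d j\<bar>) / sqrt (real (norm0 xstar)))\<^sup>2"
      using pos by (intro restricted_energy_deviation[OF m sparsity_bounds(1) _ net])
        (auto simp: restrict_to_def)
  qed (auto simp: restrict_to_def)
  moreover have "norm2 ((1 / slope) \<cdot>\<^sub>v x - xstar) = L2_set ?d {..<n} / \<bar>slope\<bar>"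
  proof -
    have "norm2 ((1 / slope) \<cdot>\<^sub>v x - xstar) = L2_set (\<lambda>j. (1 / slope) * ?d j) {..<n}"
      using car xstar(1) slope_bounds(1) unfolding norm2_def L2_set_def
      by (intro arg_cong[where f=sqrt] sum.cong) (auto simp: restrict_to_def field_simps)
    then show ?thesis unfolding L2_set_scale by simp
  qed
  ultimately show ?thesis by (simp only: divide_right_mono abs_ge_zero)
qed

text \<open>The deviation t satisfies m t^2 / (2048 G^2) = (4 * 200000 / 2048) ln n, which exceeds 3
  ln n; the union over n columns of 2 / n^3 gives 2 / n^2. The size assumption keeps t within the
  Gaussian range of Bernstein's inequality.\<close>

lemma score_event:
  assumes m: "0 < m" "m < n" and G: "1 \<le> G" and C1: "C1 = 1 / (200000 * G\<^sup>2)"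
    and var: "\<And>j. j < n \<Longrightarrow> Sform (($) (unit_vec n j)) (($) (unit_vec n j)) \<le> G\<^sup>2"
    and size: "1600 / C1 * ln (real n) \<le> real m"
  shows "{\<omega>\<in>space M. \<exists>j\<in>{..<n}. 2 / sqrt C1 * sqrt (ln (real n) / real m)
      < \<bar>(\<Sum>i<m. \<Psi> \<omega> $$ (i, j) * resid i \<omega>) / real m\<bar>} \<in> events" (is "?E \<in> _")
    and "prob {\<omega>\<in>space M. \<exists>j\<in>{..<n}. 2 / sqrt C1 * sqrt (ln (real n) / real m)
      < \<bar>(\<Sum>i<m. \<Psi> \<omega> $$ (i, j) * resid i \<omega>) / real m\<bar>} \<le> 2 / (real n)\<^sup>2"
proof -
  define t where "t = 2 / sqrt C1 * sqrt (ln (real n) / real m)"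
  have n: "2 \<le> n" using m by simp
  then have ln: "0 < ln (real n)" by simp
  have C1_pos: "0 < C1" using G by (simp add: C1)
  have t_pos: "0 < t" using ln m C1_pos by (simp add: t_def)
  have t_sq: "t\<^sup>2 = 4 * ln (real n) / (C1 * real m)"
    using ln C1_pos by (simp add: t_def power_mult_distrib power_divide)
  have lin_unit: "lin i (($) (unit_vec n j)) \<omega> = \<Psi> \<omega> $$ (i, j)" if "j < n" for i j \<omega>
  proof -
    have "lin i (($) (unit_vec n j)) \<omega> = (\<Sum>k<n. if k = j then \<Psi> \<omega> $$ (i, k) else 0)"
      unfolding lin_def using that by (intro sum.cong) auto
    then show ?thesis using that by simp
  qed
  have psi_meas: "(\<lambda>\<omega>. \<Psi> \<omega> $$ (i, j)) \<in> borel_measurable M" if "i < m" "j < n" for i j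
    using borel_measurable_model(1)[OF that(1), of "($) (unit_vec n j)"] that by (simp add: lin_unit cong: measurable_cong)
  have resid_meas: "resid i \<in> borel_measurable M" if "i < m" for i
    by (rule measurable_gen_algebra_imp[OF _ measurable_resid[OF that]]) (use that in \<open>auto simp: noise_index_def\<close>)
  have meas: "{\<omega>\<in>space M. t < \<bar>(\<Sum>i<m. \<Psi> \<omega> $$ (i, j) * resid i \<omega>) / real m\<bar>} \<in> events" if "j < n" for j
  proof -
    have [measurable]: "(\<lambda>\<omega>. \<Sum>i<m. \<Psi> \<omega> $$ (i, j) * resid i \<omega>) \<in> borel_measurable M"
      using that by (intro borel_measurable_sum borel_measurable_times psi_meas resid_meas) auto
    show ?thesis by measurable
  qed
  have "?E = (\<Union>j\<in>{..<n}. {\<omega>\<in>space M. t < \<bar>(\<Sum>i<m. \<Psi> \<omega> $$ (i, j) * resid i \<omega>) / real m\<bar>})"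
    unfolding t_def[symmetric] by auto
  then show "?E \<in> events" using meas by auto
  have "t\<^sup>2 \<le> 4 / 1600"
  proof -
    have "1600 * ln (real n) \<le> C1 * real m" using size C1_pos by (simp add: field_simps)
    then show ?thesis using C1_pos m unfolding t_sq by (simp add: field_simps)
  qed
  moreover have "1 \<le> (64 * G)\<^sup>2" using G by (intro one_le_power) simp
  ultimately have "t\<^sup>2 \<le> (64 * G)\<^sup>2" by linarith
  then have t_le: "t \<le> 64 * G" by (rule power2_le_imp_le) (use G in simp)
  have tail: "prob {\<omega>\<in>space M. t < \<bar>(\<Sum>i<m. \<Psi> \<omega> $$ (i, j) * resid i \<omega>) / real m\<bar>} \<le> 2 / real n ^ 3"
    if j: "j < n" for j
  proof -
    have "prob {\<omega>\<in>space M. t < \<bar>(\<Sum>i<m. \<Psi> \<omega> $$ (i, j) * resid i \<omega>) / real m\<bar>}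
      \<le> 2 * exp (- real m * t\<^sup>2 / (2048 * G\<^sup>2))"
      using score_tail[OF m(1) _ var[OF j] t_pos t_le] G by (simp add: lin_unit[OF j])
    also have "- real m * t\<^sup>2 / (2048 * G\<^sup>2) = - (4 * 200000 / 2048) * ln (real n)"
      using m G unfolding t_sq C1 by (simp add: field_simps)
    also have "2 * exp (- (4 * 200000 / 2048) * ln (real n)) \<le> 2 * exp (- (3 * ln (real n)))"
      using ln by simp
    also have "\<dots> = 2 / real n ^ 3"
      using n exp_of_nat_mult[of 3 "ln (real n)"] by (simp add: exp_minus divide_inverse)
    finally show ?thesis .
  qed
  have "prob ?E \<le> real (card {..<n}) * (2 / real n ^ 3)"
    unfolding t_def[symmetric] using meas tail by (intro prob_Bex_le) auto
  also have "\<dots> = 2 / (real n)\<^sup>2" using n by (simp add: power3_eq_cube power2_eq_square)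
  finally show "prob ?E \<le> 2 / (real n)\<^sup>2" .
qed

text \<open>Net points lie in the unit ball, so their variances are at most gamma_max, and t =
  gamma_min / 100 gives the exponent m / (512 * 100^2 kappa^2). The sample size makes it at least 36
  L with L = s ln (e n / s); the union costs 34 L, and exp (- 2 L) is at most 1 / n^2.\<close>

lemma energy_event:
  assumes m: "0 < m" and s: "0 < s" "s \<le> n"
    and size: "200000000 * (kappa S)\<^sup>2 * (real s * ln (exp 1 * real n / real s)) \<le> real m"
  shows "{\<omega>\<in>space M. \<exists>z\<in>int_ball {..<n} (32 * s). gamma_min S / 50 / 2
      < \<bar>(\<Sum>i<m. (lin i (net_point s z) \<omega>)\<^sup>2 - Sform (net_point s z) (net_point s z)) / real m\<bar>} \<in> events"
      (is "?E \<in> _")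
    and "prob {\<omega>\<in>space M. \<exists>z\<in>int_ball {..<n} (32 * s). gamma_min S / 50 / 2
      < \<bar>(\<Sum>i<m. (lin i (net_point s z) \<omega>)\<^sup>2 - Sform (net_point s z) (net_point s z)) / real m\<bar>} \<le> 2 / (real n)\<^sup>2"
proof -
  define t where "t = gamma_min S / 50 / 2"
  define L where "L = real s * ln (exp 1 * real n / real s)"
  define N where "N = int_ball {..<n} (32 * s)"
  have fin: "finite N" unfolding N_def by (rule finite_int_ball) simp
  note g = gamma_min_pos[OF S dim_pos] gamma_min_le_gamma_max[OF S dim_pos]
  let ?X = "\<lambda>z \<omega>. (\<Sum>i<m. (lin i (net_point s z) \<omega>)\<^sup>2 - Sform (net_point s z) (net_point s z)) / real m"
  have meas: "{\<omega>\<in>space M. t < \<bar>?X z \<omega>\<bar>} \<in> events" for z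
  proof -
    have [measurable]: "(\<lambda>\<omega>. \<Sum>i<m. (lin i (net_point s z) \<omega>)\<^sup>2 - Sform (net_point s z) (net_point s z)) \<in> borel_measurable M"
      by (intro borel_measurable_sum borel_measurable_diff borel_measurable_power borel_measurable_model) auto
    show ?thesis by measurable
  qed
  have "?E = (\<Union>z\<in>N. {\<omega>\<in>space M. t < \<bar>?X z \<omega>\<bar>})" unfolding t_def[symmetric] N_def[symmetric] by auto
  then show "?E \<in> events" using meas fin by auto
  have lnL: "ln (real n) \<le> L" unfolding L_def by (rule ln_le_sparsity_entropy[OF s])
  have "0 \<le> ln (real n)" using s by (intro ln_ge_zero) auto
  then have "0 \<le> L" using lnL by linarith
  have tail: "prob {\<omega>\<in>space M. t < \<bar>?X z \<omega>\<bar>} \<le> 2 * exp (- (36 * L))" if z: "z \<in> N" for z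
  proof -
    have "Sform (net_point s z) (net_point s z) \<le> gamma_max S * (L2_set (net_point s z) {..<n})\<^sup>2"
      using qform_le_gamma_max[OF S dim_pos] by (simp add: qform_eq_Sform)
    also have "\<dots> \<le> gamma_max S * 1"
      using z g L2_set_net_point[OF s(1)] unfolding N_def by (intro mult_left_mono) auto
    finally have v: "Sform (net_point s z) (net_point s z) \<le> gamma_max S" by simp
    have "prob {\<omega>\<in>space M. t < \<bar>?X z \<omega>\<bar>} \<le> 2 * exp (- real m * t\<^sup>2 / (512 * (gamma_max S)\<^sup>2))"
      using g by (intro energy_tail[OF m _ v]) (auto simp: t_def)
    also have "- real m * t\<^sup>2 / (512 * (gamma_max S)\<^sup>2) = - (real m / (5120000 * (kappa S)\<^sup>2))"
      using g by (simp add: t_def kappa_def power_divide field_simps)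
    also have "2 * exp (- (real m / (5120000 * (kappa S)\<^sup>2))) \<le> 2 * exp (- (36 * L))"
    proof -
      have \<kappa>: "0 < (kappa S)\<^sup>2" using g by (simp add: kappa_def)
      have "36 * L * (5120000 * (kappa S)\<^sup>2) \<le> 200000000 * (kappa S)\<^sup>2 * L"
        using \<kappa> \<open>0 \<le> L\<close> by (simp add: mult_right_mono mult_ac)
      also have "\<dots> \<le> real m" using size by (simp add: L_def)
      finally have "36 * L \<le> real m / (5120000 * (kappa S)\<^sup>2)" using \<kappa> by (simp add: pos_le_divide_eq)
      then show ?thesis by simp
    qed
    finally show ?thesis .
  qed
  have "prob ?E \<le> real (card N) * (2 * exp (- (36 * L)))"
    unfolding t_def[symmetric] N_def[symmetric] using meas tail by (intro prob_Bex_le fin) auto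
  also have "\<dots> \<le> exp (34 * L) * (2 * exp (- (36 * L)))"
    unfolding N_def L_def by (intro mult_right_mono card_int_ball_le_exp[OF s]) auto
  also have "\<dots> = 2 * exp (- (2 * L))" by (simp flip: exp_add)
  also have "\<dots> \<le> 2 * exp (- (2 * ln (real n)))" using lnL by simp
  also have "\<dots> = 2 / (real n)\<^sup>2"
    using s exp_of_nat_mult[of 2 "ln (real n)"] by (simp add: exp_minus divide_inverse)
  finally show "prob ?E \<le> 2 / (real n)\<^sup>2" .
qed

lemma lasso_estimate:
  assumes K: "(SUP i\<in>{..<m}. subgaussian_norm_vec M n (\<lambda>\<omega>. row (\<Psi> \<omega>) i)) = ereal K"
    and C1: "C1 = 1 / (200000 * (\<bar>K\<bar> + 1)\<^sup>2)"
    and C3: "norm1 xstar \<le> C3" and nm: "m < n"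
    and size: "64 * (4 * kappa S + 1)\<^sup>2 / C1 * real (norm0 xstar)
        * ln (exp 1 * real n / real (norm0 xstar)) \<le> real m"
    and l: "l = 4 * (1 + C3 * \<bar>slope\<bar>) / sqrt C1 * sqrt (ln (real n) / real m)"
  shows "\<exists>A\<in>events. 1 - 2 / real n ^ 3 - 6 / real n ^ 2 \<le> prob A \<and>
    (\<forall>\<omega>\<in>A. \<forall>x. is_arg_min (lasso_objective (\<Psi> \<omega>) (response (\<Psi> \<omega>) (\<epsilon> \<omega>) (\<eta> \<omega>) xstar) l)
        (\<lambda>x. x \<in> carrier_vec n) x \<longrightarrow>
      norm2 ((1 / slope) \<cdot>\<^sub>v x - xstar)
        \<le> 816 * (4 * kappa S + 1)\<^sup>2 / gamma_min S
          * ((\<sigma> + 1 + C3 * \<bar>q - 1/2\<bar>) / (sqrt C1 * \<bar>q - 1/2\<bar>))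
          * sqrt (real (norm0 xstar) * ln (real n) / real m))"
proof -
  define s where "s = norm0 xstar"
  define G where "G = \<bar>K\<bar> + 1"
  define L where "L = real s * ln (exp 1 * real n / real s)"
  note s = sparsity_bounds[folded s_def]
  note g = gamma_min_pos[OF S dim_pos] gamma_min_le_gamma_max[OF S dim_pos]
  have G: "1 \<le> G" by (simp add: G_def)
  have C1_G: "C1 = 1 / (200000 * G\<^sup>2)" by (simp add: C1 G_def)
  have C1_pos: "0 < C1" using G by (simp add: C1_G)
  have "1 \<le> G\<^sup>2" using G by (rule one_le_power)
  then have inv_C1: "200000 \<le> 1 / C1" by (simp add: C1_G)
  have \<kappa>: "1 \<le> kappa S" using g by (simp add: kappa_def)
  have lnL: "ln (real n) \<le> L" unfolding L_def by (rule ln_le_sparsity_entropy[OF s])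
  have "0 \<le> ln (real n)" using s by (intro ln_ge_zero) auto
  then have L0: "0 \<le> L" using lnL by linarith
  have size_L: "64 * (4 * kappa S + 1)\<^sup>2 / C1 * L \<le> real m"
    using size by (simp add: L_def s_def mult.assoc)
  have \<kappa>5: "25 \<le> (4 * kappa S + 1)\<^sup>2" using power_mono[of 5 "4 * kappa S + 1" 2] \<kappa> by simp
  \<comment> \<open>For m = 0 the supremum over the empty set of rows is minus infinity, which is no
    real K.\<close>
  have m: "0 < m"
  proof (rule ccontr)
    assume "\<not> 0 < m"
    then show False using K by (simp add: bot_ereal_def)
  qed
  have n: "2 \<le> n" using m nm by simp
  then have ln: "0 < ln (real n)" by simp
  \<comment> \<open>1600 = 64 * 25, where 25 comes from kappa \<ge> 1.\<close>
  have size_score: "1600 / C1 * ln (real n) \<le> real m"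
  proof -
    have "1600 / C1 * ln (real n) \<le> (64 * (4 * kappa S + 1)\<^sup>2 / C1) * L"
      using \<kappa>5 C1_pos lnL L0 ln by (intro mult_mono divide_right_mono) auto
    then show ?thesis using size_L by linarith
  qed
  \<comment> \<open>G \<ge> 1 makes 1 / C1 at least 200000, and 64 * 16 * 200000 =
    204800000.\<close>
  have size_energy: "200000000 * (kappa S)\<^sup>2 * L \<le> real m"
  proof -
    have "(4 * kappa S)\<^sup>2 \<le> (4 * kappa S + 1)\<^sup>2" using \<kappa> by (intro power_mono) auto
    then have "16 * (kappa S)\<^sup>2 \<le> (4 * kappa S + 1)\<^sup>2" by (simp add: power_mult_distrib)
    then have "64 * (16 * (kappa S)\<^sup>2) * 200000 \<le> 64 * (4 * kappa S + 1)\<^sup>2 * (1 / C1)"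
      using inv_C1 by (intro mult_mono) auto
    then have "204800000 * (kappa S)\<^sup>2 * L \<le> 64 * (4 * kappa S + 1)\<^sup>2 / C1 * L"
      using L0 by (intro mult_right_mono) auto
    moreover have "200000000 * (kappa S)\<^sup>2 * L \<le> 204800000 * (kappa S)\<^sup>2 * L"
      using L0 by (intro mult_right_mono) auto
    ultimately show ?thesis using size_L by linarith
  qed
  have var: "Sform (($) (unit_vec n j)) (($) (unit_vec n j)) \<le> G\<^sup>2" if "j < n" for j
  proof -
    have "Sform (($) (unit_vec n j)) (($) (unit_vec n j)) \<le> K\<^sup>2" by (rule Sform_unit_le[OF K m that])
    also have "\<dots> \<le> G\<^sup>2" by (simp add: G_def flip: abs_le_square_iff)
    finally show ?thesis .
  qed
  define E1 where "E1 = {\<omega>\<in>space M. \<exists>j\<in>{..<n}. 2 / sqrt C1 * sqrt (ln (real n) / real m)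
      < \<bar>(\<Sum>i<m. \<Psi> \<omega> $$ (i, j) * resid i \<omega>) / real m\<bar>}"
  define E2 where "E2 = {\<omega>\<in>space M. \<exists>z\<in>int_ball {..<n} (32 * s). gamma_min S / 50 / 2
      < \<bar>(\<Sum>i<m. (lin i (net_point s z) \<omega>)\<^sup>2 - Sform (net_point s z) (net_point s z)) / real m\<bar>}"
  have E1: "E1 \<in> events"
    unfolding E1_def by (rule score_event(1)[OF m nm G C1_G _ size_score]) (rule var)
  have E1_prob: "prob E1 \<le> 2 / (real n)\<^sup>2"
    unfolding E1_def by (rule score_event(2)[OF m nm G C1_G _ size_score]) (rule var)
  have E2: "E2 \<in> events"
    unfolding E2_def by (rule energy_event(1)[OF m s size_energy[unfolded L_def]])
  have E2_prob: "prob E2 \<le> 2 / (real n)\<^sup>2"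
    unfolding E2_def by (rule energy_event(2)[OF m s size_energy[unfolded L_def]])
  have C3_0: "0 \<le> C3" using C3 by (rule order_trans[rotated]) (simp add: norm1_def sum_nonneg)
  have l_pos: "0 < l"
    unfolding l using C3_0 C1_pos ln m by (intro mult_pos_pos divide_pos_pos add_pos_nonneg) auto
  \<comment> \<open>The score threshold is l / 2 with the factor 1 + C3 |c|, which is at least 1,
    left out.\<close>
  have l_half: "2 / sqrt C1 * sqrt (ln (real n) / real m) \<le> l / 2"
  proof -
    have eq: "4 * a / r * w / 2 = a * (2 / r * w)" for a r w :: real by simp
    have "1 * (2 / sqrt C1 * sqrt (ln (real n) / real m))
      \<le> (1 + C3 * \<bar>slope\<bar>) * (2 / sqrt C1 * sqrt (ln (real n) / real m))"
      using C3_0 C1_pos ln by (intro mult_right_mono) auto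
    then show ?thesis unfolding l eq by simp
  qed
  \<comment> \<open>The factor 6 of the deterministic bound times the 4 in l gives 24, below 816 (4
    kappa + 1)^2. Dividing 1 + C3 |c| by |c| gives 1 / |c| + C3, and the bound on 1 / |c| produces
    the stated fraction.\<close>
  have bound: "6 * l * sqrt (real s) / gamma_min S / \<bar>slope\<bar>
      \<le> 816 * (4 * kappa S + 1)\<^sup>2 / gamma_min S
        * ((\<sigma> + 1 + C3 * \<bar>q - 1/2\<bar>) / (sqrt C1 * \<bar>q - 1/2\<bar>))
        * sqrt (real s * ln (real n) / real m)"
  proof -
    define R where "R = sqrt (real s * ln (real n) / real m)"
    have R: "sqrt (real s) * sqrt (ln (real n) / real m) = R"
      by (simp add: R_def flip: real_sqrt_mult)
    have R0: "0 \<le> R" using ln by (simp add: R_def)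
    have eq: "6 * (4 * a / r * w) * v / g / b = 24 / g * ((a / b) / r) * (v * w)" for a b g r v w :: real
      by (simp add: mult_ac)
    have frac: "(1 + C3 * \<bar>slope\<bar>) / \<bar>slope\<bar> = 1 / \<bar>slope\<bar> + C3"
      using slope_bounds(1) by (simp add: field_simps)
    have "6 * l * sqrt (real s) / gamma_min S / \<bar>slope\<bar>
      = 24 / gamma_min S * (((1 + C3 * \<bar>slope\<bar>) / \<bar>slope\<bar>) / sqrt C1) * R"
      unfolding l R[symmetric] by (rule eq)
    also have "\<dots> \<le> 816 * (4 * kappa S + 1)\<^sup>2 / gamma_min S
        * (((\<sigma> + 1) / \<bar>q - 1/2\<bar> + C3) / sqrt C1) * R"
      unfolding frac using slope_bounds g \<kappa>5 C1_pos C3_0 R0 sigma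
      by (intro mult_right_mono mult_mono divide_right_mono add_right_mono divide_nonneg_nonneg) auto
    also have "((\<sigma> + 1) / \<bar>q - 1/2\<bar> + C3) / sqrt C1 = (\<sigma> + 1 + C3 * \<bar>q - 1/2\<bar>) / (sqrt C1 * \<bar>q - 1/2\<bar>)"
      using q C1_pos by (simp add: field_simps)
    finally show ?thesis unfolding R_def .
  qed
  define A where "A = space M - (E1 \<union> E2)"
  have A: "A \<in> events" using E1 E2 by (auto simp: A_def)
  moreover have "1 - 2 / real n ^ 3 - 6 / real n ^ 2 \<le> prob A"
  proof -
    have "prob A = 1 - prob (E1 \<union> E2)" unfolding A_def using E1 E2 by (intro prob_compl) auto
    moreover have "prob (E1 \<union> E2) \<le> prob E1 + prob E2" by (intro measure_Un_le E1 E2)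
    moreover have "2 / (real n)\<^sup>2 + 2 / (real n)\<^sup>2 \<le> 6 / (real n)\<^sup>2" by (simp add: add_divide_distrib[symmetric] divide_right_mono)
    moreover have "0 \<le> 2 / real n ^ 3" by simp
    ultimately show ?thesis using E1_prob E2_prob by linarith
  qed
  moreover have "norm2 ((1 / slope) \<cdot>\<^sub>v x - xstar)
      \<le> 816 * (4 * kappa S + 1)\<^sup>2 / gamma_min S
        * ((\<sigma> + 1 + C3 * \<bar>q - 1/2\<bar>) / (sqrt C1 * \<bar>q - 1/2\<bar>))
        * sqrt (real s * ln (real n) / real m)"
    if \<omega>: "\<omega> \<in> A" and x: "is_arg_min (lasso_objective (\<Psi> \<omega>) (response (\<Psi> \<omega>) (\<epsilon> \<omega>) (\<eta> \<omega>) xstar) l)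
        (\<lambda>x. x \<in> carrier_vec n) x" for \<omega> x
  proof (rule order_trans[OF _ bound])
    show "norm2 ((1 / slope) \<cdot>\<^sub>v x - xstar) \<le> 6 * l * sqrt (real s) / gamma_min S / \<bar>slope\<bar>"
      unfolding s_def
    proof (rule lasso_error_of_good_event[OF _ m l_pos _ _ x])
      show "\<omega> \<in> space M" using \<omega> by (simp add: A_def)
      show "\<bar>(\<Sum>i<m. \<Psi> \<omega> $$ (i, j) * resid i \<omega>) / real m\<bar> \<le> l / 2" if "j < n" for j
      proof -
        have "\<not> 2 / sqrt C1 * sqrt (ln (real n) / real m) < \<bar>(\<Sum>i<m. \<Psi> \<omega> $$ (i, j) * resid i \<omega>) / real m\<bar>"
          using \<omega> that unfolding A_def E1_def by blast
        then show ?thesis using l_half by linarith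
      qed
      show "\<bar>(\<Sum>i<m. (lin i (net_point (norm0 xstar) z) \<omega>)\<^sup>2
          - Sform (net_point (norm0 xstar) z) (net_point (norm0 xstar) z)) / real m\<bar> \<le> gamma_min S / 50 / 2"
        if "z \<in> int_ball {..<n} (32 * norm0 xstar)" for z
        using \<omega> that unfolding A_def E2_def s_def not_less[symmetric] by blast
    qed
  qed
  ultimately show ?thesis unfolding s_def by blast
qed

end

theorem theorem3p1:
  fixes K :: real
  shows "\<exists>C1>0. \<exists>C2>0.
    \<forall>(M :: 'w measure) (m::nat) (n::nat) (S :: real mat) (\<sigma>::real) (q::real) (xstar :: real vec)
      (\<Psi> :: 'w \<Rightarrow> real mat) (\<epsilon> :: 'w \<Rightarrow> real vec) (\<eta> :: 'w \<Rightarrow> real vec) (C3::real)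
      (s::nat) (c::real) (l::real).
      one_bit_model M m n S \<sigma> q xstar \<Psi> \<epsilon> \<eta> \<longrightarrow>
      (SUP i\<in>{..<m}. subgaussian_norm_vec M n (\<lambda>\<omega>. row (\<Psi> \<omega>) i)) = ereal K \<longrightarrow>
      s = norm0 xstar \<longrightarrow>
      c = (2 * q - 1) * sqrt (2 / (pi * (\<sigma>\<^sup>2 + 1))) \<longrightarrow>
      C3 \<ge> norm1 xstar \<longrightarrow>
      n > m \<longrightarrow>
      real m \<ge> max (4 * C1 / C2\<^sup>2 * ln (real n))
                   (64 * (4 * kappa S + 1)\<^sup>2 / C1 * real s * ln (exp 1 * real n / real s)) \<longrightarrow>
      real s \<le> exp (1 - C1 / 2) * real n \<longrightarrow>
      l = 4 * (1 + C3 * \<bar>c\<bar>) / sqrt C1 * sqrt (ln (real n) / real m) \<longrightarrow>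
      (\<exists>A\<in>sets M. measure M A \<ge> 1 - 2 / real n ^ 3 - 6 / real n ^ 2 \<and>
        (\<forall>\<omega>\<in>A. \<forall>x.
          is_arg_min (lasso_objective (\<Psi> \<omega>) (response (\<Psi> \<omega>) (\<epsilon> \<omega>) (\<eta> \<omega>) xstar) l)
            (\<lambda>x. x \<in> carrier_vec n) x \<longrightarrow>
          norm2 ((1 / c) \<cdot>\<^sub>v x - xstar)
            \<le> 816 * (4 * kappa S + 1)\<^sup>2 / gamma_min S
               * ((\<sigma> + 1 + C3 * \<bar>q - 1/2\<bar>) / (sqrt C1 * \<bar>q - 1/2\<bar>))
               * sqrt (real s * ln (real n) / real m)))"
proof -
  \<comment> \<open>K is an arbitrary real here; |K| + 1 is at least 1 and dominates K in modulus,
    and C1 is fixed before the dimensions.\<close>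
  define C1 where "C1 = 1 / (200000 * (\<bar>K\<bar> + 1)\<^sup>2)"
  have "0 < \<bar>K\<bar> + 1" by (simp add: add_nonneg_pos)
  then have C1_pos: "0 < C1" by (simp add: C1_def)
  (* C2 is arbitrary, because ln n is at most s ln (e n / s): the second lower bound on m already
     implies the one that the concentration inequalities need. *)
  show ?thesis
  proof (intro exI[of _ C1] conjI allI impI, goal_cases)
    case 1
    show ?case by (rule C1_pos)
  next
    case 2
    show ?case by (rule C1_pos)
  next
    case (3 M m n S \<sigma> q xstar \<Psi> \<epsilon> \<eta> C3 s c l)
    interpret one_bit_model M m n S \<sigma> q xstar \<Psi> \<epsilon> \<eta> by fact
    have c: "c = slope" unfolding slope_def by (rule 3(4))
    have size: "64 * (4 * kappa S + 1)\<^sup>2 / C1 * real (norm0 xstar)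
        * ln (exp 1 * real n / real (norm0 xstar)) \<le> real m"
      using 3(7) unfolding 3(3) by (rule order_trans[OF max.cobounded2])
    show ?case
      unfolding c 3(3)
      by (rule lasso_estimate[OF 3(2) C1_def 3(5,6) size]) (rule 3(9)[unfolded c])
  qed
qed

end
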